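(* Let $X,Y,A,B$ be non-empty finite sets. Then $\mathsf{QC}(\mathcal R_{\rm qc})=\mathcal Q_{\rm qc}$.
   Context: A block operator isometry over $(X,A)$ is an isometry $U=(U_{a,x})_{a\in A,x\in X}:K^X\to L^A$ with $U_{a,x}\in\mathcal B(K,L)$. Block operator isometries $U=(U_{a,x})$ over $(X,A)$ with entries in $\mathcal B(K,L)$ and $V=(V_{b,y})$ over $(Y,B)$ with entries in $\mathcal B(H,K)$ semi-commute if every $U_{a,x}^*U_{a',x'}$ commutes with every $V_{b,y}V_{b',y'}^*$ (as operators on $K$). Then $U\cdot V=(U_{a,x}V_{b,y})_{(a,b),(x,y)}$ is a block operator isometry over $(X\times Y,A\times B)$; $\mathcal R_{\rm qc}$ is the set of all such $U\cdot V$ with $U,V$ semi-commuting (all Hilbert spaces). For a block operator isometry $W$ over $(XY,AB)$ with entries in $\mathcal B(H,L)$ and a normal state $\sigma$ on $\mathcal B(H)$, $\Gamma_{W,\sigma}(\epsilon_{x,x'}\otimes\epsilon_{y,y'})=\sum_{a,a',b,b'}\sigma(W_{(a,b),(x,y)}^*W_{(a',b'),(x',y')})\epsilon_{a,a'}\otimes\epsilon_{b,b'}$, and $\mathsf{QC}(\mathcal R)=\{\Gamma_{W,\sigma}:W\in\mathcal R\}$. A stochastic operator matrix over $(X,A)$ acting on $H$ is a positive $E=(E_{x,x',a,a'})\in M_{XA}(\mathcal B(H))$ with $\sum_{a\in A}E_{x,x',a,a}=\delta_{x,x'}I_H$. $\mathcal Q_{\rm qc}$ is the set of maps $\Gamma:M_{XY}\to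 M_{AB}$ for which there exist a Hilbert space $H$, a unit vector $\xi\in H$, and stochastic operator matrices $E$ over $(X,A)$ and $F$ over $(Y,B)$ acting on $H$ whose entries mutually commute ($E_{x,x',a,a'}F_{y,y',b,b'}=F_{y,y',b,b'}E_{x,x',a,a'}$), with $\Gamma(\epsilon_{x,x'}\otimes\epsilon_{y,y'})=\sum_{a,a',b,b'}\langle E_{x,x',a,a'}F_{y,y',b,b'}\xi,\xi\rangle\epsilon_{a,a'}\otimes\epsilon_{b,b'}$. *)

theory Defs
  imports Complex_Main
begin

class complex_inner = real_normed_vector +
  fixes cscale :: "complex \<Rightarrow> 'a \<Rightarrow> 'a"
    and cinner :: "'a \<Rightarrow> 'a \<Rightarrow> complex"
  assumes cscale_add_right: "cscale c (x + y) = cscale c x + cscale c y"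
    and cscale_add_left: "cscale (c + d) x = cscale c x + cscale d x"
    and cscale_cscale: "cscale c (cscale d x) = cscale (c * d) x"
    and cscale_one: "cscale 1 x = x"
    and scaleR_cscale: "scaleR r x = cscale (complex_of_real r) x"
    and cinner_commute: "cinner x y = cnj (cinner y x)"
    and cinner_add_left: "cinner (x + y) z = cinner x z + cinner y z"
    and cinner_cscale_left: "cinner (cscale c x) y = c * cinner x y"
    and cinner_self_nonneg: "0 \<le> Re (cinner x x)"
    and cinner_self_eq_zero: "cinner x x = 0 \<longleftrightarrow> x = 0"
    and norm_eq_sqrt_cinner: "norm x = sqrt (Re (cinner x x))"

class chilbert_space = complex_inner + complete_space

definition infinite_dimensional :: "'u::chilbert_space itself \<Rightarrow> bool" where
  "infinite_dimensional _ \<longleftrightarrow>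
     \<not> (\<exists>F::'u set. finite F \<and> (\<forall>v. \<exists>c. v = (\<Sum>f\<in>F. cscale (c f) f)))"

text \<open>Hilbert spaces are modelled as closed complex subspaces of an ambient
  (infinite-dimensional) Hilbert space of type 'u.\<close>

definition closed_csubspace :: "'u::chilbert_space set \<Rightarrow> bool" where
  "closed_csubspace S \<longleftrightarrow> 0 \<in> S \<and> (\<forall>x\<in>S. \<forall>y\<in>S. x + y \<in> S)
     \<and> (\<forall>c. \<forall>x\<in>S. cscale c x \<in> S) \<and> closed S"

definition bounded_clinear :: "('u::chilbert_space \<Rightarrow> 'u) \<Rightarrow> bool" where
  "bounded_clinear T \<longleftrightarrow> (\<forall>x y. T (x + y) = T x + T y)
     \<and> (\<forall>c x. T (cscale c x) = cscale c (T x)) \<and> (\<exists>K. \<forall>x. norm (T x) \<le> norm x * K)"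

definition orth :: "'u::chilbert_space \<Rightarrow> 'u set \<Rightarrow> bool" where
  "orth x S \<longleftrightarrow> (\<forall>z\<in>S. cinner x z = 0)"

text \<open>An operator in B(K,L), encoded as a bounded operator on the ambient space
  that vanishes on the orthogonal complement of K and has range in L.\<close>

definition in_B :: "'u::chilbert_space set \<Rightarrow> 'u set \<Rightarrow> ('u \<Rightarrow> 'u) \<Rightarrow> bool" where
  "in_B K L T \<longleftrightarrow> bounded_clinear T \<and> (\<forall>x. orth x K \<longrightarrow> T x = 0) \<and> (\<forall>x. T x \<in> L)"

definition adj :: "('u::chilbert_space \<Rightarrow> 'u) \<Rightarrow> ('u \<Rightarrow> 'u)" where
  "adj T = (SOME S. \<forall>x y. cinner (T x) y = cinner x (S y))"

text \<open>The identity operator I_H of B(H) (orthogonal projection onto H in the encoding).\<close>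

definition proj :: "'u::chilbert_space set \<Rightarrow> 'u \<Rightarrow> 'u" where
  "proj H x = (THE y. y \<in> H \<and> orth (x - y) H)"

definition positive_op :: "('u::chilbert_space \<Rightarrow> 'u) \<Rightarrow> bool" where
  "positive_op T \<longleftrightarrow> (\<forall>v. Im (cinner (T v) v) = 0 \<and> 0 \<le> Re (cinner (T v) v))"

definition loewner_le :: "('u::chilbert_space \<Rightarrow> 'u) \<Rightarrow> ('u \<Rightarrow> 'u) \<Rightarrow> bool" where
  "loewner_le S T \<longleftrightarrow> positive_op (\<lambda>v. T v - S v)"

text \<open>Normal states on B(H): positive unital linear functionals preserving suprema of
  bounded increasing nets (= upward directed families) of positive operators.\<close>

definition normal_state :: "'u::chilbert_space set \<Rightarrow> (('u \<Rightarrow> 'u) \<Rightarrow> complex) \<Rightarrow> bool" where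
  "normal_state H \<sigma> \<longleftrightarrow>
     (\<forall>S T. in_B H H S \<longrightarrow> in_B H H T \<longrightarrow> \<sigma> (\<lambda>v. S v + T v) = \<sigma> S + \<sigma> T)
   \<and> (\<forall>c T. in_B H H T \<longrightarrow> \<sigma> (\<lambda>v. cscale c (T v)) = c * \<sigma> T)
   \<and> (\<forall>T. in_B H H T \<longrightarrow> positive_op T \<longrightarrow> Im (\<sigma> T) = 0 \<and> 0 \<le> Re (\<sigma> T))
   \<and> \<sigma> (proj H) = 1
   \<and> (\<forall>\<T> T0. \<T> \<noteq> {} \<longrightarrow> (\<forall>T\<in>\<T>. in_B H H T \<and> positive_op T)
        \<longrightarrow> (\<forall>S\<in>\<T>. \<forall>T\<in>\<T>. \<exists>R\<in>\<T>. loewner_le S R \<and> loewner_le T R)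
        \<longrightarrow> in_B H H T0 \<longrightarrow> (\<forall>T\<in>\<T>. loewner_le T T0)
        \<longrightarrow> (\<forall>B. in_B H H B \<longrightarrow> (\<forall>T\<in>\<T>. loewner_le T B) \<longrightarrow> loewner_le T0 B)
        \<longrightarrow> Re (\<sigma> T0) = (SUP T\<in>\<T>. Re (\<sigma> T)))"

definition block_isometry ::
  "'u::chilbert_space set \<Rightarrow> 'u set \<Rightarrow> ('a::finite \<Rightarrow> 'x::finite \<Rightarrow> 'u \<Rightarrow> 'u) \<Rightarrow> bool" where
  "block_isometry K L U \<longleftrightarrow> (\<forall>a x. in_B K L (U a x))
     \<and> (\<forall>k::'x \<Rightarrow> 'u. (\<forall>x. k x \<in> K) \<longrightarrow>
          (\<Sum>a\<in>UNIV. (norm (\<Sum>x\<in>UNIV. U a x (k x)))\<^sup>2) = (\<Sum>x\<in>UNIV. (norm (k x))\<^sup>2))"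

definition semi_commute ::
  "('a::finite \<Rightarrow> 'x::finite \<Rightarrow> 'u::chilbert_space \<Rightarrow> 'u) \<Rightarrow> ('b::finite \<Rightarrow> 'y::finite \<Rightarrow> 'u \<Rightarrow> 'u) \<Rightarrow> bool" where
  "semi_commute U V \<longleftrightarrow> (\<forall>a x a' x' b y b' y'.
     (adj (U a x) \<circ> U a' x') \<circ> (V b y \<circ> adj (V b' y'))
       = (V b y \<circ> adj (V b' y')) \<circ> (adj (U a x) \<circ> U a' x'))"

definition block_prod ::
  "('a::finite \<Rightarrow> 'x::finite \<Rightarrow> 'u::chilbert_space \<Rightarrow> 'u) \<Rightarrow> ('b::finite \<Rightarrow> 'y::finite \<Rightarrow> 'u \<Rightarrow> 'u)
    \<Rightarrow> ('a \<times> 'b) \<Rightarrow> ('x \<times> 'y) \<Rightarrow> 'u \<Rightarrow> 'u" where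
  "block_prod U V = (\<lambda>(a, b) (x, y). U a x \<circ> V b y)"

text \<open>Linear maps M_{XY} \<rightarrow> M_{AB}; matrices are functions on index pairs, and
  \<epsilon>_{x,x'} \<otimes> \<epsilon>_{y,y'} is the matrix unit at ((x,y),(x',y')).\<close>

type_synonym ('i) mat = "'i \<Rightarrow> 'i \<Rightarrow> complex"

definition Gamma_W ::
  "(('a::finite \<times> 'b::finite) \<Rightarrow> ('x::finite \<times> 'y::finite) \<Rightarrow> 'u::chilbert_space \<Rightarrow> 'u)
    \<Rightarrow> (('u \<Rightarrow> 'u) \<Rightarrow> complex) \<Rightarrow> ('x \<times> 'y) mat \<Rightarrow> ('a \<times> 'b) mat" where
  "Gamma_W W \<sigma> M = (\<lambda>r r'. \<Sum>c\<in>UNIV. \<Sum>c'\<in>UNIV. M c c' * \<sigma> (adj (W r c) \<circ> W r' c'))"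

definition R_qc :: "(('a::finite \<times> 'b::finite) \<Rightarrow> ('x::finite \<times> 'y::finite) \<Rightarrow> 'u::chilbert_space \<Rightarrow> 'u) set" where
  "R_qc = {W. \<exists>H K L (U::'a \<Rightarrow> 'x \<Rightarrow> 'u \<Rightarrow> 'u) (V::'b \<Rightarrow> 'y \<Rightarrow> 'u \<Rightarrow> 'u).
     closed_csubspace H \<and> closed_csubspace K \<and> closed_csubspace L
     \<and> block_isometry K L U \<and> block_isometry H K V \<and> semi_commute U V \<and> W = block_prod U V}"

definition QC_R_qc :: "('u::chilbert_space itself) \<Rightarrow> (('x::finite \<times> 'y::finite) mat \<Rightarrow> ('a::finite \<times> 'b::finite) mat) set" where
  "QC_R_qc _ = {\<Gamma>. \<exists>H K L (U::'a \<Rightarrow> 'x \<Rightarrow> 'u \<Rightarrow> 'u) (V::'b \<Rightarrow> 'y \<Rightarrow> 'u \<Rightarrow> 'u) \<sigma>.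
     closed_csubspace H \<and> closed_csubspace K \<and> closed_csubspace L
     \<and> block_isometry K L U \<and> block_isometry H K V \<and> semi_commute U V
     \<and> normal_state H \<sigma> \<and> \<Gamma> = Gamma_W (block_prod U V) \<sigma>}"

definition stochastic_op_matrix ::
  "'u::chilbert_space set \<Rightarrow> ('x::finite \<Rightarrow> 'x \<Rightarrow> 'a::finite \<Rightarrow> 'a \<Rightarrow> 'u \<Rightarrow> 'u) \<Rightarrow> bool" where
  "stochastic_op_matrix H E \<longleftrightarrow> (\<forall>x x' a a'. in_B H H (E x x' a a'))
     \<and> (\<forall>h::'x \<times> 'a \<Rightarrow> 'u. (\<forall>i. h i \<in> H) \<longrightarrow>
          (let s = (\<Sum>(x,a)\<in>UNIV. \<Sum>(x',a')\<in>UNIV. cinner (E x x' a a' (h (x',a'))) (h (x,a)))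
           in Im s = 0 \<and> 0 \<le> Re s))
     \<and> (\<forall>x x'. (\<lambda>v. \<Sum>a\<in>UNIV. E x x' a a v) = (if x = x' then proj H else (\<lambda>v. 0)))"

definition Gamma_Q ::
  "('x::finite \<Rightarrow> 'x \<Rightarrow> 'a::finite \<Rightarrow> 'a \<Rightarrow> 'u::chilbert_space \<Rightarrow> 'u)
    \<Rightarrow> ('y::finite \<Rightarrow> 'y \<Rightarrow> 'b::finite \<Rightarrow> 'b \<Rightarrow> 'u \<Rightarrow> 'u) \<Rightarrow> 'u
    \<Rightarrow> ('x \<times> 'y) mat \<Rightarrow> ('a \<times> 'b) mat" where
  "Gamma_Q E F \<xi> M = (\<lambda>(a, b) (a', b'). \<Sum>(x, y)\<in>UNIV. \<Sum>(x', y')\<in>UNIV.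
      M (x, y) (x', y') * cinner (E x x' a a' (F y y' b b' \<xi>)) \<xi>)"

definition Q_qc :: "('u::chilbert_space itself) \<Rightarrow> (('x::finite \<times> 'y::finite) mat \<Rightarrow> ('a::finite \<times> 'b::finite) mat) set" where
  "Q_qc _ = {\<Gamma>. \<exists>H (\<xi>::'u) (E::'x \<Rightarrow> 'x \<Rightarrow> 'a \<Rightarrow> 'a \<Rightarrow> 'u \<Rightarrow> 'u) (F::'y \<Rightarrow> 'y \<Rightarrow> 'b \<Rightarrow> 'b \<Rightarrow> 'u \<Rightarrow> 'u).
     closed_csubspace H \<and> \<xi> \<in> H \<and> norm \<xi> = 1
     \<and> stochastic_op_matrix H E \<and> stochastic_op_matrix H F
     \<and> (\<forall>x x' a a' y y' b b'. E x x' a a' \<circ> F y y' b b' = F y y' b b' \<circ> E x x' a a')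
     \<and> \<Gamma> = Gamma_Q E F \<xi>}"

end

theory Submission
  imports Defs "HOL-Analysis.Analysis"
begin

text \<open>Let \<open>U\<close>, \<open>V\<close> semi-commute. Put \<open>F = V\<^sup>* V\<close> and, for one fixed \<open>y\<close>, let \<open>E\<close> have the entries
  \<open>\<Sum>\<^sub>b V\<^sub>b\<^sub>y\<^sup>* T V\<^sub>b\<^sub>y\<close>, where \<open>T\<close> runs through the operators \<open>U\<^sub>a\<^sub>x\<^sup>* U\<^sub>a\<^sub>'\<^sub>x\<^sub>'\<close>. Semi-commutation and
  \<open>\<Sum>\<^sub>b V\<^sub>b\<^sub>y\<^sup>* V\<^sub>b\<^sub>y\<^sub>' = \<delta> I\<close> make both products of \<open>E\<close> and \<open>F\<close> equal to \<open>V\<^sup>* T V\<close>. The state becomes a vector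
  state by the GNS construction for the unital algebra generated by the finitely many entries of
  \<open>E\<close> and \<open>F\<close>; it is separable, so it fits into the ambient space.

  Conversely, given commuting \<open>E\<close> and \<open>F\<close> on \<open>H\<close>, let \<open>J\<^sub>i\<close> be isometries with orthogonal
  ranges, \<open>R\<close> the square root of \<open>\<Sum> J\<^sub>i F\<^sub>i\<^sub>j J\<^sub>j\<^sup>*\<close> and \<open>V\<^sub>i = R J\<^sub>i\<close>. Then \<open>V\<^sub>i\<^sup>* V\<^sub>j = F\<^sub>i\<^sub>j\<close>, and \<open>V\<^sub>i V\<^sub>j\<^sup>*\<close> commutes
  with the amplification \<open>\<Sum> J\<^sub>i E J\<^sub>i\<^sup>*\<close>, which is factorized as \<open>U\<^sup>* U\<close> in the same way.\<close>

text \<open>All Hilbert spaces are closed subspaces of one ambient space, so direct sums, tensor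
  factors and quotients have to be found inside it. Infinite dimension allows this: an infinite
  orthonormal basis has room for finitely many disjoint copies of itself. In the converse an
  arbitrary factorization of \<open>F\<close> would not do, because nothing forces it to respect
  \<open>E\<close>; the square root is chosen because it is a strong limit of polynomials in the
  block operator and so commutes with whatever commutes with that operator. In the GNS step the
  space attached to all of B(H) could be too large for the ambient space, which is why only words in
  the entries enter. The quotient by null vectors is replaced by a choice of vectors with the
  prescribed Gram matrix, equality of classes being tested by inner products. That a vector state is
  normal also takes an argument: normality speaks of suprema of directed families, which compare
  quadratic forms only.\<close>

section \<open>Complex inner product spaces\<close>

lemma cscale_zero_left [simp]: "cscale 0 (x::'a::complex_inner) = 0"
  using scaleR_cscale[of 0 x] by simp

lemma cscale_zero_right [simp]: "cscale c (0::'a::complex_inner) = 0"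
  using cscale_add_right[of c 0 "0::'a"] by simp

lemma cscale_minus_one: "cscale (- 1) x = - (x::'a::complex_inner)"
  using scaleR_cscale[of "-1" x] by simp

lemma cscale_minus_right: "cscale c (- x) = - cscale c (x::'a::complex_inner)"
  using cscale_add_right[of c x "-x"] by (simp add: add_eq_0_iff)

lemma cscale_diff_right: "cscale c (x - y) = cscale c x - cscale c (y::'a::complex_inner)"
  using cscale_add_right[of c x "-y"] by (simp add: cscale_minus_right)

lemma cscale_sum_right: "cscale c (\<Sum>i\<in>I. f i) = (\<Sum>i\<in>I. cscale c (f i :: 'a::complex_inner))"
  by (induction I rule: infinite_finite_induct) (simp_all add: cscale_add_right)

lemma cinner_add_right: "cinner x (y + z) = cinner x y + cinner (x::'a::complex_inner) z"
  by (metis cinner_add_left cinner_commute complex_cnj_add)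

lemma cinner_cscale_right: "cinner x (cscale c y) = cnj c * cinner (x::'a::complex_inner) y"
  by (metis cinner_cscale_left cinner_commute complex_cnj_mult)

lemma cinner_zero_left [simp]: "cinner 0 (x::'a::complex_inner) = 0"
  using cinner_add_left[of 0 0 x] by simp

lemma cinner_zero_right [simp]: "cinner (x::'a::complex_inner) 0 = 0"
  using cinner_add_right[of x 0 0] by simp

lemma cinner_minus_left [simp]: "cinner (- x) y = - cinner (x::'a::complex_inner) y"
  using cinner_add_left[of x "-x" y] by (simp add: add_eq_0_iff)

lemma cinner_minus_right [simp]: "cinner x (- y) = - cinner (x::'a::complex_inner) y"
  using cinner_add_right[of x y "-y"] by (simp add: add_eq_0_iff)

lemma cinner_diff_left: "cinner (x - y) z = cinner x z - cinner (y::'a::complex_inner) z"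
  using cinner_add_left[of x "-y" z] by simp

lemma cinner_diff_right: "cinner x (y - z) = cinner x y - cinner (x::'a::complex_inner) z"
  using cinner_add_right[of x y "-z"] by simp

lemma cinner_sum_left: "cinner (\<Sum>i\<in>I. f i) y = (\<Sum>i\<in>I. cinner (f i :: 'a::complex_inner) y)"
  by (induction I rule: infinite_finite_induct) (simp_all add: cinner_add_left)

lemma cinner_sum_right: "cinner y (\<Sum>i\<in>I. f i) = (\<Sum>i\<in>I. cinner y (f i :: 'a::complex_inner))"
  by (induction I rule: infinite_finite_induct) (simp_all add: cinner_add_right)

lemma cinner_scaleR_left: "cinner (scaleR r x) y = of_real r * cinner (x::'a::complex_inner) y"
  by (simp add: scaleR_cscale cinner_cscale_left)

lemma cinner_scaleR_right: "cinner x (scaleR r y) = of_real r * cinner (x::'a::complex_inner) y"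
  by (simp add: scaleR_cscale cinner_cscale_right)

lemmas cinner_simps = cinner_add_left cinner_add_right cinner_diff_left cinner_diff_right
  cinner_cscale_left cinner_cscale_right cinner_sum_left cinner_sum_right

lemma cinner_self: "cinner x x = of_real ((norm (x::'a::complex_inner))\<^sup>2)"
proof -
  have "Im (cinner x x) = 0"
    using arg_cong[OF cinner_commute[of x x], of Im] by simp
  then show ?thesis
    by (simp add: complex_eq_iff norm_eq_sqrt_cinner cinner_self_nonneg)
qed

lemma norm_sq_cinner: "(norm (x::'a::complex_inner))\<^sup>2 = Re (cinner x x)"
  by (simp add: cinner_self)

lemma norm_add_sq:
  "(norm (x + y))\<^sup>2 = (norm x)\<^sup>2 + (norm y)\<^sup>2 + 2 * Re (cinner (x::'a::complex_inner) y)"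
proof -
  have "Re (cinner y x) = Re (cinner x y)"
    by (subst cinner_commute) simp
  then show ?thesis
    by (simp add: norm_sq_cinner cinner_simps)
qed

lemma norm_diff_sq:
  "(norm (x - y))\<^sup>2 = (norm x)\<^sup>2 + (norm y)\<^sup>2 - 2 * Re (cinner (x::'a::complex_inner) y)"
  using norm_add_sq[of x "-y"] by simp

lemma norm_cscale: "norm (cscale c x) = norm c * norm (x::'a::complex_inner)"
proof (rule power2_eq_imp_eq)
  have "complex_of_real ((norm (cscale c x))\<^sup>2) = c * cnj c * cinner x x"
    by (simp add: cinner_self[symmetric] cinner_simps mult_ac del: of_real_power)
  also have "\<dots> = of_real ((norm c * norm x)\<^sup>2)"
    by (simp add: complex_norm_square[symmetric] cinner_self power_mult_distrib)
  finally show "(norm (cscale c x))\<^sup>2 = (norm c * norm x)\<^sup>2"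
    by (simp only: of_real_eq_iff)
qed auto

lemma cinner_ext_right: "(\<And>z. cinner z x = cinner z (y::'a::complex_inner)) \<Longrightarrow> x = y"
  by (metis cinner_diff_right cinner_self_eq_zero diff_self eq_iff_diff_eq_0)

lemma cinner_ext_left: "(\<And>z. cinner x z = cinner (y::'a::complex_inner) z) \<Longrightarrow> x = y"
  by (metis cinner_diff_left cinner_self_eq_zero diff_self eq_iff_diff_eq_0)

section \<open>Bounded operators\<close>

lemma bounded_clinearI:
  assumes "\<And>x y. T (x + y) = T x + T y" "\<And>c x. T (cscale c x) = cscale c (T x)"
    "\<And>x. norm (T x) \<le> norm x * K"
  shows "bounded_clinear T"
  using assms unfolding bounded_clinear_def by blast

lemma bcl_add: "bounded_clinear T \<Longrightarrow> T (x + y) = T x + T y"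
  and bcl_cscale: "bounded_clinear T \<Longrightarrow> T (cscale c x) = cscale c (T x)"
  by (auto simp: bounded_clinear_def)

lemma bcl_bounded_linear:
  assumes "bounded_clinear T"
  shows "bounded_linear T"
proof -
  obtain K where "\<And>x. norm (T x) \<le> norm x * K" using assms by (auto simp: bounded_clinear_def)
  then show ?thesis
    using assms by (intro bounded_linear_intro[of T K]) (simp_all add: scaleR_cscale bounded_clinear_def)
qed

lemma bcl_linear: "bounded_clinear T \<Longrightarrow> linear T"
  by (rule bounded_linear.linear[OF bcl_bounded_linear])

lemma bcl_zero: "bounded_clinear T \<Longrightarrow> T 0 = 0"
  and bcl_diff: "bounded_clinear T \<Longrightarrow> T (x - y) = T x - T y"
  and bcl_minus: "bounded_clinear T \<Longrightarrow> T (- x) = - T x"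
  and bcl_scaleR: "bounded_clinear T \<Longrightarrow> T (scaleR r x) = scaleR r (T x)"
  and bcl_sum: "bounded_clinear T \<Longrightarrow> T (\<Sum>i\<in>I. f i) = (\<Sum>i\<in>I. T (f i))"
  by (simp_all only: bcl_linear linear_0 linear_diff linear_neg linear_scale linear_sum)

lemmas bcl_simps = bcl_add bcl_cscale bcl_zero bcl_diff bcl_minus bcl_scaleR bcl_sum

lemma bcl_bound:
  assumes "bounded_clinear T"
  obtains K where "K > 0" "\<And>x. norm (T x) \<le> K * norm x"
  using bounded_linear.pos_bounded[OF bcl_bounded_linear[OF assms]] by (metis mult.commute)

lemma bcl_tendsto: "bounded_clinear T \<Longrightarrow> (f \<longlongrightarrow> x) F \<Longrightarrow> ((\<lambda>n. T (f n)) \<longlongrightarrow> T x) F"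
  by (rule bounded_linear.tendsto[OF bcl_bounded_linear])

lemma bcl_id: "bounded_clinear (\<lambda>x. x)"
  by (rule bounded_clinearI[where K=1]) auto

lemma bcl_const_zero: "bounded_clinear (\<lambda>x. 0)"
  by (rule bounded_clinearI[where K=1]) auto

lemma bcl_compose:
  assumes "bounded_clinear S" "bounded_clinear T"
  shows "bounded_clinear (\<lambda>x. S (T x))"
proof -
  obtain K where K: "K > 0" "\<And>x. norm (S x) \<le> K * norm x" using bcl_bound[OF assms(1)] by blast
  obtain M where M: "M > 0" "\<And>x. norm (T x) \<le> M * norm x" using bcl_bound[OF assms(2)] by blast
  show ?thesis
  proof (rule bounded_clinearI[where K="K * M"])
    fix x show "norm (S (T x)) \<le> norm x * (K * M)"
      using order_trans[OF K(2)[of "T x"] mult_left_mono[OF M(2)[of x], of K]] K(1)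
      by (simp add: mult_ac)
  qed (simp_all add: assms bcl_simps)
qed

lemma bcl_plus:
  assumes "bounded_clinear S" "bounded_clinear T"
  shows "bounded_clinear (\<lambda>x. S x + T x)"
proof -
  obtain K where K: "K > 0" "\<And>x. norm (S x) \<le> K * norm x" using bcl_bound[OF assms(1)] by blast
  obtain M where M: "M > 0" "\<And>x. norm (T x) \<le> M * norm x" using bcl_bound[OF assms(2)] by blast
  show ?thesis
  proof (rule bounded_clinearI[where K="K + M"])
    fix x show "norm (S x + T x) \<le> norm x * (K + M)"
      using norm_triangle_ineq[of "S x" "T x"] K(2)[of x] M(2)[of x] by (simp add: algebra_simps)
  qed (simp_all add: assms bcl_simps cscale_add_right)
qed

lemma bcl_cscale_fun:
  assumes "bounded_clinear T"
  shows "bounded_clinear (\<lambda>x. cscale c (T x))"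
proof -
  obtain K where K: "K > 0" "\<And>x. norm (T x) \<le> K * norm x" using bcl_bound[OF assms] by blast
  show ?thesis
  proof (rule bounded_clinearI[where K="norm c * K"])
    fix x show "norm (cscale c (T x)) \<le> norm x * (norm c * K)"
      using mult_left_mono[OF K(2)[of x], of "norm c"] by (simp add: norm_cscale mult_ac)
  qed (simp_all add: assms bcl_simps cscale_add_right cscale_cscale mult.commute)
qed

lemma bcl_scaleR_fun: "bounded_clinear T \<Longrightarrow> bounded_clinear (\<lambda>x. scaleR r (T x))"
  by (simp add: scaleR_cscale bcl_cscale_fun)

lemma bcl_minus_fun:
  assumes "bounded_clinear S" "bounded_clinear T"
  shows "bounded_clinear (\<lambda>x. S x - T x)"
  using bcl_plus[OF assms(1) bcl_cscale_fun[OF assms(2), of "-1"]] by (simp add: cscale_minus_one)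

lemma bcl_sum_fun: "(\<And>i. i \<in> I \<Longrightarrow> bounded_clinear (T i)) \<Longrightarrow> bounded_clinear (\<lambda>x. \<Sum>i\<in>I. T i x)"
  by (induction I rule: infinite_finite_induct) (simp_all add: bcl_const_zero bcl_plus)

lemma positive_op_cinner:
  "positive_op T \<Longrightarrow> cinner (T v) v = of_real (Re (cinner (T v) v))"
  by (simp add: positive_op_def complex_eq_iff)

lemma positive_op_Re: "positive_op T \<Longrightarrow> 0 \<le> Re (cinner (T v) v)"
  by (simp add: positive_op_def)

text \<open>The imaginary part of the quadratic form vanishes at \<open>x + y\<close> and at \<open>x + \<i> y\<close>.\<close>

lemma positive_op_hermitian:
  assumes "bounded_clinear T" "positive_op T"
  shows "cinner (T x) y = cinner x (T y)"
proof -
  have im: "Im (cinner (T v) v) = 0" for v using assms(2) by (simp add: positive_op_def)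
  have 1: "Im (cinner (T x) y) + Im (cinner (T y) x) = 0"
    using im[of "x + y"] im[of x] im[of y] by (simp add: bcl_simps assms(1) cinner_simps)
  have 2: "Re (cinner (T x) y) = Re (cinner (T y) x)"
    using im[of "x + cscale \<i> y"] im[of x] im[of y]
    by (simp add: bcl_simps assms(1) cinner_simps)
  have "cinner (T x) y = cnj (cinner (T y) x)"
    using 1 2 by (simp add: complex_eq_iff)
  then show ?thesis
    by (metis cinner_commute)
qed

text \<open>Discriminant argument for the form of \<open>T\<close> at \<open>x - t z y\<close> with
  \<open>z = cinner (T x) y\<close>; the factor \<open>z\<close> makes the cross term real. The
  optimal \<open>t\<close> is \<open>1 / b\<close>, and for \<open>b = 0\<close> a large
  \<open>t\<close> forces \<open>z = 0\<close>.\<close>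

lemma positive_op_Cauchy_Schwarz:
  assumes T: "bounded_clinear T" "positive_op T"
  shows "(norm (cinner (T x) y))\<^sup>2 \<le> Re (cinner (T x) x) * Re (cinner (T y) y)"
proof -
  define a b z where "a = Re (cinner (T x) x)" and "b = Re (cinner (T y) y)" and "z = cinner (T x) y"
  have yx: "cinner (T y) x = cnj z"
    unfolding z_def by (subst cinner_commute) (simp add: positive_op_hermitian[OF T])
  have q: "0 \<le> a - 2 * t * (norm z)\<^sup>2 + t\<^sup>2 * (norm z)\<^sup>2 * b" for t :: real
  proof -
    define c where "c = of_real t * z"
    have "0 \<le> Re (cinner (T (x - cscale c y)) (x - cscale c y))"
      by (rule positive_op_Re[OF T(2)])
    also have "cinner (T (x - cscale c y)) (x - cscale c y)
       = of_real a - 2 * of_real t * (z * cnj z) + (of_real t)\<^sup>2 * (z * cnj z) * of_real b"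
      unfolding c_def a_def b_def positive_op_cinner[OF T(2), symmetric]
      by (simp add: bcl_simps T(1) cinner_simps yx z_def[symmetric] algebra_simps power2_eq_square)
    also have "\<dots> = of_real (a - 2 * t * (norm z)\<^sup>2 + t\<^sup>2 * (norm z)\<^sup>2 * b)"
      by (simp add: complex_norm_square[symmetric])
    finally show ?thesis by simp
  qed
  have b: "b \<ge> 0" unfolding b_def by (rule positive_op_Re[OF T(2)])
  have "(norm z)\<^sup>2 \<le> a * b"
  proof (cases "b = 0")
    case False
    then show ?thesis using q[of "1 / b"] b by (simp add: field_simps power2_eq_square)
  next
    case True
    have "norm z = 0"
    proof (rule ccontr)
      assume "norm z \<noteq> 0"
      \<comment> \<open>With this \<open>t\<close> the bound reads
        \<open>0 \<le> a - 2 (a + 1)\<close>, impossible for nonnegative \<open>a\<close>.\<close>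
      then show False using q[of "(a + 1) / (norm z)\<^sup>2"] True by (simp add: a_def positive_op_Re[OF T(2)] not_le)
          (smt (verit) a_def positive_op_Re[OF T(2)])
    qed
    then show ?thesis using True by simp
  qed
  then show ?thesis by (simp add: a_def b_def z_def)
qed

lemma positive_op_id: "positive_op (\<lambda>x. x)"
  by (simp add: positive_op_def cinner_self)

lemma cinner_Cauchy_Schwarz: "norm (cinner x (y::'u::chilbert_space)) \<le> norm x * norm y"
  using positive_op_Cauchy_Schwarz[OF bcl_id positive_op_id, of x y]
  by (simp add: norm_sq_cinner[symmetric] power_mult_distrib[symmetric] power2_le_iff_abs_le abs_mult)

lemma bounded_bilinear_cinner: "bounded_bilinear (cinner :: 'u::chilbert_space \<Rightarrow> 'u \<Rightarrow> complex)"
  by (unfold_locales)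
     (auto simp: cinner_simps cinner_scaleR_left cinner_scaleR_right scaleR_conv_of_real
       intro!: exI[of _ 1] cinner_Cauchy_Schwarz)

lemmas tendsto_cinner [tendsto_intros] = bounded_bilinear.tendsto[OF bounded_bilinear_cinner]

lemma tendsto_cscale [tendsto_intros]:
  "(f \<longlongrightarrow> (x::'u::chilbert_space)) F \<Longrightarrow> ((\<lambda>n. cscale c (f n)) \<longlongrightarrow> cscale c x) F"
  using bcl_tendsto[OF bcl_cscale_fun[OF bcl_id]] .

section \<open>Orthogonal projections and adjoints\<close>

lemma orth_cscale: "orth x S \<Longrightarrow> orth (cscale c x) S"
  and orth_add: "orth x S \<Longrightarrow> orth y S \<Longrightarrow> orth (x + y) S"
  and orth_diff: "orth x S \<Longrightarrow> orth y S \<Longrightarrow> orth (x - y) S"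
  by (auto simp: orth_def cinner_simps)

lemma csubspace_0: "closed_csubspace S \<Longrightarrow> 0 \<in> S"
  and csubspace_add: "closed_csubspace S \<Longrightarrow> x \<in> S \<Longrightarrow> y \<in> S \<Longrightarrow> x + y \<in> S"
  and csubspace_cscale: "closed_csubspace S \<Longrightarrow> x \<in> S \<Longrightarrow> cscale c x \<in> S"
  and csubspace_closed: "closed_csubspace S \<Longrightarrow> closed S"
  by (auto simp: closed_csubspace_def)

lemma csubspace_diff: "closed_csubspace S \<Longrightarrow> x \<in> S \<Longrightarrow> y \<in> S \<Longrightarrow> x - y \<in> S"
  using csubspace_add[of S x "cscale (-1) y"] csubspace_cscale[of S y "-1"] by (simp add: cscale_minus_one)

lemma csubspace_UNIV: "closed_csubspace UNIV"
  by (simp add: closed_csubspace_def)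

text \<open>A minimizing sequence is Cauchy by the parallelogram identity, since midpoints stay in
  \<open>S\<close> and so remain at distance at least \<open>d\<close> from
  \<open>x\<close>.\<close>

lemma csubspace_nearest_point:
  fixes S :: "'u::chilbert_space set"
  assumes S: "closed_csubspace S"
  obtains y where "y \<in> S" "\<And>z. z \<in> S \<Longrightarrow> norm (x - y) \<le> norm (x - z)"
proof -
  define d where "d = (INF y\<in>S. norm (x - y))"
  have bdd: "bdd_below ((\<lambda>y. norm (x - y)) ` S)" by (rule bdd_belowI[of _ 0]) auto
  have ne: "S \<noteq> {}" using csubspace_0[OF S] by blast
  have d_le: "d \<le> norm (x - z)" if "z \<in> S" for z
    unfolding d_def using bdd that by (rule cINF_lower)
  have d0: "0 \<le> d" unfolding d_def using ne by (intro cINF_greatest) auto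
  have "\<exists>y\<in>S. (norm (x - y))\<^sup>2 < d\<^sup>2 + 1 / real (Suc n)" for n
  proof -
    have "d < sqrt (d\<^sup>2 + 1 / real (Suc n))" using d0 by (intro real_less_rsqrt) auto
    then obtain y where y: "y \<in> S" "norm (x - y) < sqrt (d\<^sup>2 + 1 / real (Suc n))"
      using cINF_less_iff[OF ne bdd] unfolding d_def by auto
    then have "(norm (x - y))\<^sup>2 < (sqrt (d\<^sup>2 + 1 / real (Suc n)))\<^sup>2"
      by (intro power_strict_mono) auto
    then show ?thesis using y(1) by (intro bexI[of _ y]) (auto simp: add_nonneg_nonneg)
  qed
  then obtain y where y: "\<And>n. y n \<in> S" "\<And>n. (norm (x - y n))\<^sup>2 < d\<^sup>2 + 1 / real (Suc n)"
    by metis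
  have par: "(norm (y m - y n))\<^sup>2 \<le> 2 / real (Suc m) + 2 / real (Suc n)" for m n
  proof -
    have "(norm ((x - y n) + (x - y m)))\<^sup>2 + (norm ((x - y n) - (x - y m)))\<^sup>2
        = 2 * (norm (x - y n))\<^sup>2 + 2 * (norm (x - y m))\<^sup>2"
      unfolding norm_add_sq norm_diff_sq by simp
    moreover have "(x - y n) + (x - y m) = 2 *\<^sub>R (x - (1/2) *\<^sub>R (y n + y m))"
      by (simp add: algebra_simps scaleR_2)
    moreover have "d \<le> norm (x - (1/2) *\<^sub>R (y n + y m))"
      by (rule d_le) (simp add: scaleR_cscale S y(1) csubspace_cscale csubspace_add)
    then have "d\<^sup>2 \<le> (norm (x - (1/2) *\<^sub>R (y n + y m)))\<^sup>2" using d0 by (intro power_mono) auto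
    ultimately show ?thesis using y(2)[of n] y(2)[of m] by (simp add: power_mult_distrib)
  qed
  have "Cauchy y"
  proof (rule metric_CauchyI)
    fix e :: real assume e: "e > 0"
    obtain N where N: "4 / e\<^sup>2 < real N" using reals_Archimedean2 by blast
    have "dist (y m) (y n) < e" if "m \<ge> N" "n \<ge> N" for m n
    proof -
      have *: "1 / real (Suc k) < e\<^sup>2 / 4" if "k \<ge> N" for k
      proof -
        have "4 / e\<^sup>2 < real (Suc k)" using N that by linarith
        then show ?thesis using e by (simp add: field_simps)
      qed
      have "(norm (y m - y n))\<^sup>2 < e\<^sup>2"
        using par[of m n] *[OF that(1)] *[OF that(2)] by simp
      then show ?thesis using e by (simp add: dist_norm power_less_imp_less_base)
    qed
    then show "\<exists>M. \<forall>m\<ge>M. \<forall>n\<ge>M. dist (y m) (y n) < e" by blast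
  qed
  then obtain l where l: "y \<longlonglongrightarrow> l" using Cauchy_convergent convergent_def by blast
  have "l \<in> S" using csubspace_closed[OF S] y(1) l by (rule closed_sequentially)
  moreover have "norm (x - l) \<le> norm (x - z)" if "z \<in> S" for z
  proof -
    have "(\<lambda>n. (norm (x - y n))\<^sup>2) \<longlonglongrightarrow> (norm (x - l))\<^sup>2" by (intro tendsto_intros l)
    moreover have "(\<lambda>n. d\<^sup>2 + 1 / real (Suc n)) \<longlonglongrightarrow> d\<^sup>2 + 0"
      using LIMSEQ_inverse_real_of_nat by (intro tendsto_intros) (simp add: inverse_eq_divide)
    ultimately have "(norm (x - l))\<^sup>2 \<le> d\<^sup>2 + 0"
      using y(2) by (intro LIMSEQ_le) (auto intro: less_imp_le)
    then have "norm (x - l) \<le> d" using power2_le_imp_le[OF _ d0] by simp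
    then show ?thesis using d_le[OF that] by simp
  qed
  ultimately show ?thesis using that by blast
qed

text \<open>First variation of the distance: moving \<open>y\<close> by \<open>t w z\<close> inside
  \<open>S\<close> cannot bring it closer to \<open>x\<close>. For small positive \<open>t\<close>
  the term linear in \<open>t\<close> dominates, so \<open>w\<close> must vanish.\<close>

lemma nearest_point_orth:
  fixes S :: "'u::chilbert_space set"
  assumes S: "closed_csubspace S" and y: "y \<in> S" "\<And>z. z \<in> S \<Longrightarrow> norm (x - y) \<le> norm (x - z)"
  shows "orth (x - y) S"
  unfolding orth_def
proof
  fix z assume z: "z \<in> S"
  define w where "w = cinner (x - y) z"
  have q: "2 * t * (norm w)\<^sup>2 \<le> t\<^sup>2 * (norm w)\<^sup>2 * (norm z)\<^sup>2" for t :: real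
  proof -
    have "norm (x - y) \<le> norm (x - (y + cscale (of_real t * w) z))"
      by (rule y(2)) (simp add: S y z csubspace_add csubspace_cscale)
    then have "(norm (x - y))\<^sup>2 \<le> (norm ((x - y) - cscale (of_real t * w) z))\<^sup>2"
      by (intro power_mono) (auto simp: algebra_simps)
    moreover have "cinner (x - y) (cscale (of_real t * w) z) = of_real (t * (norm w)\<^sup>2)"
      by (simp add: cinner_cscale_right w_def[symmetric] complex_norm_square mult_ac del: of_real_power)
    ultimately show ?thesis
      unfolding norm_diff_sq[of "x - y"] by (simp add: norm_cscale norm_mult power_mult_distrib)
  qed
  show "cinner (x - y) z = 0"
  proof (rule ccontr)
    assume "cinner (x - y) z \<noteq> 0"
    then have w0: "w \<noteq> 0" and z0: "z \<noteq> 0" by (auto simp: w_def)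
    have "2 * t \<le> t\<^sup>2 * (norm z)\<^sup>2" for t
      using q[of t] w0 by (simp add: mult.assoc[symmetric] mult.commute[of _ "(norm w)\<^sup>2"])
    \<comment> \<open>At this \<open>t\<close> the left side is twice the right side, and both are
      positive.\<close>
    from this[of "1 / (norm z)\<^sup>2"] z0 show False by (simp add: field_simps power2_eq_square)
  qed
qed

lemma orth_self: "x \<in> S \<Longrightarrow> orth x S \<Longrightarrow> x = 0"
  by (metis cinner_self_eq_zero orth_def)

lemma proj_unique:
  assumes S: "closed_csubspace S" and "y \<in> S" "orth (x - y) S"
  shows "proj S x = y"
  unfolding proj_def
proof (rule the_equality)
  fix z assume z: "z \<in> S \<and> orth (x - z) S"
  have "orth (z - y) S" using orth_diff[of "x - y" S "x - z"] assms z by (simp add: algebra_simps)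
  moreover have "z - y \<in> S" using z assms by (simp add: csubspace_diff)
  ultimately show "z = y" using orth_self[of "z - y"] by simp
qed (use assms in simp)

lemma proj_in: "closed_csubspace S \<Longrightarrow> proj S x \<in> S"
  and proj_orth: "closed_csubspace S \<Longrightarrow> orth (x - proj S x) S"
proof -
  assume S: "closed_csubspace S"
  obtain y where "y \<in> S" "orth (x - y) S"
    using csubspace_nearest_point[OF S, of x] nearest_point_orth[OF S] by metis
  then show "proj S x \<in> S" "orth (x - proj S x) S" using proj_unique[OF S, of y x] by auto
qed

lemma proj_id: "closed_csubspace S \<Longrightarrow> x \<in> S \<Longrightarrow> proj S x = x"
  by (rule proj_unique) (auto simp: orth_def)

lemma proj_eq_0: "closed_csubspace S \<Longrightarrow> orth x S \<Longrightarrow> proj S x = 0"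
  by (rule proj_unique) (auto simp: csubspace_0)

lemma cinner_proj_left: "closed_csubspace S \<Longrightarrow> y \<in> S \<Longrightarrow> cinner (proj S x) y = cinner x y"
  using proj_orth[of S x] by (simp add: orth_def cinner_diff_left)

lemma cinner_proj_right: "closed_csubspace S \<Longrightarrow> y \<in> S \<Longrightarrow> cinner y (proj S x) = cinner y x"
  by (metis cinner_commute cinner_proj_left)

lemma proj_selfadj: "closed_csubspace S \<Longrightarrow> cinner (proj S x) y = cinner x (proj S y)"
  by (metis cinner_proj_left cinner_proj_right proj_in)

lemma norm_proj_le:
  assumes "closed_csubspace S"
  shows "norm (proj S x) \<le> norm x"
proof -
  have "(norm (proj S x))\<^sup>2 \<le> norm x * norm (proj S x)"
    using cinner_Cauchy_Schwarz[of x "proj S x"] complex_Re_le_cmod[of "cinner x (proj S x)"]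
    by (simp add: norm_sq_cinner cinner_proj_left[OF assms proj_in[OF assms]])
  then show ?thesis by (cases "proj S x = 0") (auto simp: power2_eq_square)
qed

lemma bcl_proj:
  assumes S: "closed_csubspace S"
  shows "bounded_clinear (proj S)"
proof (rule bounded_clinearI[where K=1])
  fix x y c
  show "proj S (x + y) = proj S x + proj S y"
    using orth_add[OF proj_orth[OF S, of x] proj_orth[OF S, of y]]
    by (intro proj_unique S csubspace_add proj_in) (simp add: algebra_simps)
  show "proj S (cscale c x) = cscale c (proj S x)"
    using orth_cscale[OF proj_orth[OF S, of x], of c]
    by (intro proj_unique S csubspace_cscale proj_in) (simp add: cscale_diff_right)
  show "norm (proj S x) \<le> norm x * 1" using norm_proj_le[OF S] by simp
qed

lemma csubspace_biorth:
  assumes S: "closed_csubspace S" and "\<And>z. orth z S \<Longrightarrow> cinner x z = 0"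
  shows "x \<in> S"
proof -
  define z where "z = x - proj S x"
  have "orth z S" unfolding z_def by (rule proj_orth[OF S])
  then have "cinner x z = 0" "cinner (proj S x) z = 0"
    using assms(2) proj_in[OF S, of x] by (auto simp: orth_def) (metis cinner_commute complex_cnj_zero)
  then have "cinner z z = 0" by (simp add: z_def cinner_diff_left)
  then show ?thesis using proj_in[OF S, of x] by (simp add: cinner_self_eq_zero z_def)
qed

section \<open>Riesz representation and adjoints\<close>

lemma Riesz_representation:
  fixes f :: "'u::chilbert_space \<Rightarrow> complex"
  assumes add: "\<And>x y. f (x + y) = f x + f y" and scale: "\<And>c x. f (cscale c x) = c * f x"
    and bound: "\<And>x. norm (f x) \<le> norm x * K"
  obtains z where "\<And>x. f x = cinner x z"
proof (cases "\<forall>x. f x = 0")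
  case True
  then show ?thesis using that[of 0] by simp
next
  case False
  then obtain u where u: "f u \<noteq> 0" by blast
  have bl: "bounded_linear f"
    by (rule bounded_linear_intro[of _ K]) (auto simp: add scale scaleR_cscale bound scaleR_conv_of_real)
  define S where "S = {x. f x = 0}"
  have "closed S"
    unfolding S_def by (intro closed_Collect_eq continuous_on_const linear_continuous_on bl)
  then have S: "closed_csubspace S"
    by (auto simp: closed_csubspace_def S_def add scale linear_0 bounded_linear.linear[OF bl])
  define v where "v = u - proj S u"
  have fp: "f (proj S u) = 0" using proj_in[OF S, of u] by (simp add: S_def)
  have fv: "f v \<noteq> 0" using u by (simp add: v_def linear_diff bounded_linear.linear[OF bl] fp)
  then have v0: "v \<noteq> 0" using linear_0[OF bounded_linear.linear[OF bl]] by auto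
  have ov: "orth v S" unfolding v_def by (rule proj_orth[OF S])
  \<comment> \<open>\<open>x - (f x / f v) v\<close> lies in the kernel \<open>S\<close> and is
    therefore orthogonal to \<open>v\<close>; solving for \<open>f x\<close> gives the representing
    vector. The conjugate compensates for \<open>cinner\<close> being conjugate linear in its second
    argument.\<close>
  have "f x = cinner x (cscale (cnj (f v / cinner v v)) v)" for x
  proof -
    have "x - cscale (f x / f v) v \<in> S"
      using fv by (simp add: S_def linear_diff bounded_linear.linear[OF bl] scale)
    then have "cinner v (x - cscale (f x / f v) v) = 0" using ov by (simp add: orth_def)
    then have "cinner (x - cscale (f x / f v) v) v = 0" by (metis cinner_commute complex_cnj_zero)
    then show ?thesis using fv v0 by (simp add: cinner_simps field_simps cinner_self_eq_zero)
  qed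
  then show ?thesis by (rule that)
qed

lemma adj_exists:
  assumes T: "bounded_clinear T"
  shows "\<exists>S. \<forall>x y. cinner (T x) y = cinner x (S y)"
proof -
  obtain K where K: "K > 0" "\<And>x. norm (T x) \<le> K * norm x" using bcl_bound[OF T] by blast
  have "\<exists>z. \<forall>x. cinner (T x) y = cinner x z" for y
  proof -
    have "norm (cinner (T x) y) \<le> norm x * (K * norm y)" for x
      using cinner_Cauchy_Schwarz[of "T x" y] mult_right_mono[OF K(2)[of x], of "norm y"]
      by (simp add: mult_ac)
    then show ?thesis
      by (rule Riesz_representation[of "\<lambda>x. cinner (T x) y", rotated 2])
         (auto simp: bcl_simps T cinner_simps)
  qed
  then show ?thesis by metis
qed

lemma cinner_adj_right:
  assumes "bounded_clinear T"
  shows "cinner x (adj T y) = cinner (T x) y"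
proof -
  have "\<forall>x y. cinner (T x) y = cinner x (adj T y)"
    unfolding adj_def by (rule someI_ex[OF adj_exists[OF assms]])
  then show ?thesis by simp
qed

lemma cinner_adj_left: "bounded_clinear T \<Longrightarrow> cinner (adj T x) y = cinner x (T y)"
  by (metis cinner_commute cinner_adj_right)

lemma adj_eqI:
  assumes "bounded_clinear T" "\<And>x y. cinner (T x) y = cinner x (S y)"
  shows "adj T = S"
  by (rule ext, rule cinner_ext_right) (simp add: cinner_adj_right assms)

lemma bcl_adj:
  assumes T: "bounded_clinear T"
  shows "bounded_clinear (adj T)"
proof -
  obtain K where K: "K > 0" "\<And>x. norm (T x) \<le> K * norm x" using bcl_bound[OF T] by blast
  show ?thesis
  proof (rule bounded_clinearI[where K=K])
    fix x y c
    show "adj T (x + y) = adj T x + adj T y"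
      by (rule cinner_ext_right) (simp add: cinner_adj_right T cinner_simps)
    show "adj T (cscale c x) = cscale c (adj T x)"
      by (rule cinner_ext_right) (simp add: cinner_adj_right T cinner_simps)
    \<comment> \<open>The square of the norm is \<open>cinner (T (adj T x)) x\<close>, so the bound
      \<open>K\<close> of \<open>T\<close> serves for the adjoint too.\<close>
    have "(norm (adj T x))\<^sup>2 \<le> norm (T (adj T x)) * norm x"
      using cinner_Cauchy_Schwarz[of "T (adj T x)" x] complex_Re_le_cmod[of "cinner (T (adj T x)) x"]
      by (simp add: norm_sq_cinner cinner_adj_right T)
    also have "\<dots> \<le> K * norm (adj T x) * norm x" by (intro mult_right_mono K) simp
    finally show "norm (adj T x) \<le> norm x * K"
      using K(1) by (cases "adj T x = 0") (auto simp: power2_eq_square mult_ac)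
  qed
qed

lemma adj_compose:
  "bounded_clinear S \<Longrightarrow> bounded_clinear T \<Longrightarrow> adj (\<lambda>x. S (T x)) = (\<lambda>x. adj T (adj S x))"
  by (rule adj_eqI) (auto simp: bcl_compose cinner_adj_right)

lemma adj_proj: "closed_csubspace S \<Longrightarrow> adj (proj S) = proj S"
  by (rule adj_eqI) (auto simp: bcl_proj proj_selfadj)

section \<open>Operators between closed subspaces\<close>

lemma in_B_bcl: "in_B K L T \<Longrightarrow> bounded_clinear T"
  and in_B_orth: "in_B K L T \<Longrightarrow> orth x K \<Longrightarrow> T x = 0"
  and in_B_range: "in_B K L T \<Longrightarrow> T x \<in> L"
  by (auto simp: in_B_def)

lemma in_B_proj_left: "in_B K L T \<Longrightarrow> closed_csubspace L \<Longrightarrow> proj L (T x) = T x"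
  by (simp add: proj_id in_B_range)

lemma in_B_proj_right:
  assumes "in_B K L T" "closed_csubspace K"
  shows "T (proj K x) = T x"
proof -
  have "T (x - proj K x) = 0" using assms proj_orth in_B_orth by blast
  then show ?thesis using in_B_bcl[OF assms(1)] by (simp add: bcl_simps)
qed

text \<open>Vanishing on the orthogonal complement is replaced by the equation
  \<open>T (proj K x) = T x\<close>, which is easy to check for operators built with an explicit
  \<open>proj\<close>.\<close>

lemma in_BI:
  assumes K: "closed_csubspace K" and "bounded_clinear T" "\<And>x. T (proj K x) = T x" "\<And>x. T x \<in> L"
  shows "in_B K L T"
  using assms(2-4) proj_eq_0[OF K] bcl_zero[OF assms(2)] unfolding in_B_def by metis

lemma in_B_adj:
  assumes T: "in_B K L T" and K: "closed_csubspace K"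
  shows "in_B L K (adj T)"
proof -
  have b: "bounded_clinear T" using T by (rule in_B_bcl)
  have "adj T x = 0" if "orth x L" for x
    using that T by (intro cinner_ext_left) (simp add: cinner_adj_left b orth_def in_B_range)
  moreover have "adj T x \<in> K" for x
    by (rule csubspace_biorth[OF K]) (simp add: cinner_adj_left b in_B_orth[OF T])
  ultimately show ?thesis by (simp add: in_B_def bcl_adj b)
qed

lemma in_B_compose: "in_B L M S \<Longrightarrow> in_B K L T \<Longrightarrow> in_B K M (\<lambda>x. S (T x))"
  by (simp add: in_B_def bcl_compose bcl_zero)

lemma in_B_plus: "closed_csubspace L \<Longrightarrow> in_B K L S \<Longrightarrow> in_B K L T \<Longrightarrow> in_B K L (\<lambda>x. S x + T x)"
  by (simp add: in_B_def bcl_plus csubspace_add)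

lemma in_B_cscale: "closed_csubspace L \<Longrightarrow> in_B K L T \<Longrightarrow> in_B K L (\<lambda>x. cscale c (T x))"
  by (simp add: in_B_def bcl_cscale_fun csubspace_cscale)

lemma in_B_zero: "closed_csubspace L \<Longrightarrow> in_B K L (\<lambda>x. 0)"
  by (simp add: in_B_def bcl_const_zero csubspace_0)

lemma in_B_sum:
  "closed_csubspace L \<Longrightarrow> (\<And>i. i \<in> I \<Longrightarrow> in_B K L (T i)) \<Longrightarrow> in_B K L (\<lambda>x. \<Sum>i\<in>I. T i x)"
  by (induction I rule: infinite_finite_induct) (auto simp: in_B_zero in_B_plus)

lemma in_B_proj: "closed_csubspace K \<Longrightarrow> in_B K K (proj K)"
  by (simp add: in_B_def bcl_proj proj_in proj_eq_0)

section \<open>Closures and extension by continuity\<close>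

lemma closure_csubspace:
  fixes S :: "'u::chilbert_space set"
  assumes "0 \<in> S" "\<And>x y. x \<in> S \<Longrightarrow> y \<in> S \<Longrightarrow> x + y \<in> S" "\<And>c x. x \<in> S \<Longrightarrow> cscale c x \<in> S"
  shows "closed_csubspace (closure S)"
  unfolding closed_csubspace_def
proof (intro conjI ballI allI)
  show "0 \<in> closure S" using assms(1) closure_subset by blast
  fix x y c assume x: "x \<in> closure S"
  then obtain f where f: "\<And>n. f n \<in> S" "f \<longlonglongrightarrow> x" by (auto simp: closure_sequential)
  show "cscale c x \<in> closure S"
    unfolding closure_sequential
    by (rule exI[of _ "\<lambda>n. cscale c (f n)"]) (simp add: f assms tendsto_cscale)
  assume "y \<in> closure S"
  then obtain g where g: "\<And>n. g n \<in> S" "g \<longlonglongrightarrow> y" by (auto simp: closure_sequential)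
  show "x + y \<in> closure S"
    unfolding closure_sequential
    by (rule exI[of _ "\<lambda>n. f n + g n"]) (simp add: f g assms tendsto_add)
qed simp

text \<open>The closure of the graph \<open>G\<close> is again the graph of a bounded operator, by completeness.\<close>

lemma bounded_graph_extension:
  fixes G :: "('u::chilbert_space \<times> 'u) set"
  assumes zero: "(0, 0) \<in> G"
    and add: "\<And>x y x' y'. (x, y) \<in> G \<Longrightarrow> (x', y') \<in> G \<Longrightarrow> (x + x', y + y') \<in> G"
    and scale: "\<And>c x y. (x, y) \<in> G \<Longrightarrow> (cscale c x, cscale c y) \<in> G"
    and bound: "\<And>x y. (x, y) \<in> G \<Longrightarrow> norm y \<le> C * norm x" and C: "0 \<le> C"
  obtains T where "in_B (closure (fst ` G)) (closure (snd ` G)) T" "\<And>x y. (x, y) \<in> G \<Longrightarrow> T x = y"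
proof -
  define R where "R x y \<longleftrightarrow> (\<exists>f g. (\<forall>n. (f n, g n) \<in> G) \<and> f \<longlonglongrightarrow> x \<and> g \<longlonglongrightarrow> y)" for x y
  define H where "H = closure (fst ` G)"
  have diff: "(x - x', y - y') \<in> G" if "(x, y) \<in> G" "(x', y') \<in> G" for x y x' y'
    using add[OF that(1) scale[OF that(2), of "-1"]] by (simp add: cscale_minus_one)
  have H: "closed_csubspace H"
    unfolding H_def
  proof (rule closure_csubspace)
    show "0 \<in> fst ` G" using zero by force
    show "x + y \<in> fst ` G" if "x \<in> fst ` G" "y \<in> fst ` G" for x y
      using that add by force
    show "cscale c x \<in> fst ` G" if "x \<in> fst ` G" for c x
      using that scale by force
  qed
  have R_G: "R x y" if "(x, y) \<in> G" for x y
    unfolding R_def using that by (intro exI[of _ "\<lambda>_. x"] exI[of _ "\<lambda>_. y"]) auto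
  have R_add: "R (x + x') (y + y')" if xy: "R x y" "R x' y'" for x y x' y'
  proof -
    obtain f g where "\<forall>n. (f n, g n) \<in> G" "f \<longlonglongrightarrow> x" "g \<longlonglongrightarrow> y" using xy(1) by (auto simp: R_def)
    moreover obtain f' g' where "\<forall>n. (f' n, g' n) \<in> G" "f' \<longlonglongrightarrow> x'" "g' \<longlonglongrightarrow> y'"
      using xy(2) by (auto simp: R_def)
    ultimately show ?thesis
      unfolding R_def
      by (intro exI[of _ "\<lambda>n. f n + f' n"] exI[of _ "\<lambda>n. g n + g' n"]) (auto intro: add tendsto_add)
  qed
  have R_scale: "R (cscale c x) (cscale c y)" if xy: "R x y" for c x y
  proof -
    obtain f g where "\<forall>n. (f n, g n) \<in> G" "f \<longlonglongrightarrow> x" "g \<longlonglongrightarrow> y" using xy by (auto simp: R_def)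
    then show ?thesis
      unfolding R_def
      by (intro exI[of _ "\<lambda>n. cscale c (f n)"] exI[of _ "\<lambda>n. cscale c (g n)"])
         (auto intro: scale tendsto_cscale)
  qed
  have R_bound: "norm y \<le> C * norm x" if xy: "R x y" for x y
  proof -
    obtain f g where fg: "\<forall>n. (f n, g n) \<in> G" "f \<longlonglongrightarrow> x" "g \<longlonglongrightarrow> y" using xy by (auto simp: R_def)
    have "(\<lambda>n. norm (g n)) \<longlonglongrightarrow> norm y" "(\<lambda>n. C * norm (f n)) \<longlonglongrightarrow> C * norm x"
      by (intro tendsto_intros fg)+
    then show ?thesis using fg(1) bound by (intro LIMSEQ_le) auto
  qed
  \<comment> \<open>Linearity and the bound apply to the pair \<open>(0, y - y')\<close>, so the
    closed relation \<open>R\<close> is single-valued.\<close>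
  have R_unique: "y = y'" if "R x y" "R x y'" for x y y'
    using R_bound[OF R_add[OF that(1) R_scale[OF that(2), of "-1"]]] by (simp add: cscale_minus_one)
  have R_ex: "\<exists>y. R x y" if x: "x \<in> H" for x
  proof -
    obtain f where f: "\<And>n. f n \<in> fst ` G" "f \<longlonglongrightarrow> x"
      using x by (auto simp: H_def closure_sequential)
    then have "\<forall>n. \<exists>y. (f n, y) \<in> G" by force
    then obtain g where g: "\<And>n. (f n, g n) \<in> G" by metis
    have "Cauchy g"
    proof (rule metric_CauchyI)
      fix e :: real assume e: "e > 0"
      have "Cauchy f" using f(2) convergent_Cauchy convergent_def by blast
      \<comment> \<open>Dividing by \<open>C + 1\<close> covers the case \<open>C = 0\<close> as
        well.\<close>
      then obtain M where M: "\<And>m n. m \<ge> M \<Longrightarrow> n \<ge> M \<Longrightarrow> dist (f m) (f n) < e / (C + 1)"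
        using metric_CauchyD[of f "e / (C + 1)"] e C by auto
      have "dist (g m) (g n) < e" if "m \<ge> M" "n \<ge> M" for m n
      proof -
        have "dist (g m) (g n) \<le> C * dist (f m) (f n)"
          using bound[OF diff[OF g g]] by (simp add: dist_norm)
        also have "\<dots> \<le> (C + 1) * dist (f m) (f n)" by (intro mult_right_mono) auto
        also have "\<dots> < e" using M[OF that] C by (simp add: field_simps)
        finally show ?thesis .
      qed
      then show "\<exists>M. \<forall>m\<ge>M. \<forall>n\<ge>M. dist (g m) (g n) < e" by blast
    qed
    then obtain y where "g \<longlonglongrightarrow> y" using Cauchy_convergent convergent_def by blast
    then show ?thesis using f(2) g unfolding R_def by blast
  qed
  \<comment> \<open>Precomposing with \<open>proj H\<close> extends the operator by zero to the
    orthogonal complement, as \<open>in_B\<close> demands.\<close>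
  define T where "T x = (THE y. R (proj H x) y)" for x
  have RT: "R (proj H x) (T x)" for x
    unfolding T_def using R_ex[OF proj_in[OF H]] R_unique by (metis (mono_tags, lifting) theI_unique)
  have T_eq: "T x = y" if "R (proj H x) y" for x y
    using R_unique[OF RT that] .
  have bT: "bounded_clinear T"
  proof (rule bounded_clinearI[where K=C])
    fix x y c
    show "T (x + y) = T x + T y"
      by (rule T_eq) (simp add: bcl_simps bcl_proj H R_add RT)
    show "T (cscale c x) = cscale c (T x)"
      by (rule T_eq) (simp add: bcl_simps bcl_proj H R_scale RT)
    show "norm (T x) \<le> norm x * C"
      using order_trans[OF R_bound[OF RT] mult_left_mono[OF norm_proj_le[OF H] C]] by (simp add: mult.commute)
  qed
  have "in_B H (closure (snd ` G)) T"
    unfolding in_B_def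
  proof (intro conjI allI impI bT)
    fix x
    show "T x = 0" if "orth x H"
      by (rule T_eq) (simp add: proj_eq_0 H that R_G zero)
    obtain f g where "\<forall>n. (f n, g n) \<in> G" "g \<longlonglongrightarrow> T x" using RT[of x] unfolding R_def by blast
    then show "T x \<in> closure (snd ` G)"
      unfolding closure_sequential by (intro exI[of _ g]) force
  qed
  moreover have "T x = y" if xy: "(x, y) \<in> G" for x y
  proof (rule T_eq)
    have "x \<in> H" unfolding H_def using xy closure_subset by force
    then show "R (proj H x) y" by (simp add: proj_id H R_G xy)
  qed
  ultimately show ?thesis using that unfolding H_def by blast
qed

section \<open>Square roots of positive operators\<close>

text \<open>The operator inequality \<open>T^2 \<le> K T\<close>, from Cauchy--Schwarz for the form
  of \<open>T\<close> at \<open>x\<close> and \<open>T x\<close>. It turns convergence of quadratic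
  forms along a monotone family into norm convergence, both for the square root iteration and for
  the normality of vector states.\<close>

lemma positive_op_norm_sq_le:
  assumes T: "bounded_clinear T" "positive_op T"
    and K: "\<And>y. Re (cinner (T y) y) \<le> K * (norm y)\<^sup>2"
  shows "(norm (T x))\<^sup>2 \<le> K * Re (cinner (T x) x)"
proof -
  have "((norm (T x))\<^sup>2)\<^sup>2 \<le> Re (cinner (T x) x) * Re (cinner (T (T x)) (T x))"
    using positive_op_Cauchy_Schwarz[OF T, of x "T x"] by (simp add: cinner_self norm_power)
  also have "\<dots> \<le> Re (cinner (T x) x) * (K * (norm (T x))\<^sup>2)"
    by (intro mult_left_mono K positive_op_Re T)
  finally have "(norm (T x))\<^sup>2 * (norm (T x))\<^sup>2 \<le> (K * Re (cinner (T x) x)) * (norm (T x))\<^sup>2"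
    by (simp add: power2_eq_square mult_ac)
  then show ?thesis by (cases "T x = 0") (simp_all only: mult_le_cancel_right, auto)
qed

text \<open>Polynomials in \<open>Z\<close> with nonnegative coefficients. The class is closed under
  sums and products, and its members are positive because the powers of \<open>Z\<close> are; this
  is how products occurring in the iteration are seen to be positive.\<close>

inductive positive_poly :: "('u::chilbert_space \<Rightarrow> 'u) \<Rightarrow> ('u \<Rightarrow> 'u) \<Rightarrow> bool" for Z where
  zero: "positive_poly Z (\<lambda>x. 0)"
| monom: "0 \<le> c \<Longrightarrow> positive_poly Z S \<Longrightarrow> positive_poly Z (\<lambda>x. c *\<^sub>R (Z ^^ k) x + S x)"

lemma bcl_funpow: "bounded_clinear Z \<Longrightarrow> bounded_clinear (Z ^^ k)"
  by (induction k) (simp_all add: bcl_id id_def comp_def bcl_compose)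

text \<open>The form of \<open>Z ^^ (k + 2)\<close> at \<open>v\<close> is that of
  \<open>Z ^^ k\<close> at \<open>Z v\<close>; hence the induction in steps of two with two base
  cases.\<close>

lemma positive_op_funpow:
  assumes Z: "bounded_clinear Z" "positive_op Z"
  shows "positive_op (Z ^^ k)"
proof (induction k rule: induct_nat_012)
  case 0 then show ?case using positive_op_id by (simp add: id_def)
next
  case 1 then show ?case using Z by simp
next
  case (ge2 k)
  have "cinner ((Z ^^ Suc (Suc k)) v) v = cinner ((Z ^^ k) (Z v)) (Z v)" for v
    using positive_op_hermitian[OF Z, of "(Z ^^ k) (Z v)" v] by (simp add: funpow_swap1)
  then show ?case using ge2(1) by (simp only: positive_op_def) simp
qed

lemma positive_poly_bcl: "positive_poly Z S \<Longrightarrow> bounded_clinear Z \<Longrightarrow> bounded_clinear S"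
  by (induction rule: positive_poly.induct)
     (auto intro!: bcl_plus bcl_scaleR_fun bcl_const_zero bcl_funpow)

lemma positive_poly_positive:
  "positive_poly Z S \<Longrightarrow> bounded_clinear Z \<Longrightarrow> positive_op Z \<Longrightarrow> positive_op S"
proof (induction rule: positive_poly.induct)
  case (monom c S k)
  then show ?case using positive_op_funpow[of Z k]
    by (simp add: positive_op_def cinner_simps cinner_scaleR_left)
qed (simp add: positive_op_def)

lemma positive_poly_commute:
  assumes "positive_poly Z S" "bounded_clinear Z" "bounded_clinear B" "\<And>x. B (Z x) = Z (B x)"
  shows "B (S x) = S (B x)"
  using assms(1)
proof (induction arbitrary: x rule: positive_poly.induct)
  case (monom c S k)
  have "B ((Z ^^ k) x) = (Z ^^ k) (B x)" for x by (induction k) (simp_all add: assms(4))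
  then show ?case using monom assms(3) by (simp add: bcl_simps)
qed (simp add: bcl_simps assms)

lemma positive_poly_self: "positive_poly Z Z"
  using positive_poly.monom[of 1 Z, OF _ positive_poly.zero, of 1] by simp

lemma positive_poly_add:
  assumes "positive_poly Z S" "positive_poly Z T"
  shows "positive_poly Z (\<lambda>x. S x + T x)"
  using assms(1)
proof (induction rule: positive_poly.induct)
  case (monom c S k)
  then show ?case using positive_poly.monom[OF monom(1) monom(3), of k] by (simp add: add.assoc)
qed (simp add: assms)

lemma positive_poly_monom_mult:
  assumes Z: "bounded_clinear Z" and "0 \<le> c" "positive_poly Z T"
  shows "positive_poly Z (\<lambda>x. c *\<^sub>R (Z ^^ k) (T x))"
  using assms(3)
proof (induction rule: positive_poly.induct)
  case zero
  then show ?case using positive_poly.zero bcl_funpow[OF Z] by (simp add: bcl_simps)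
next
  case (monom d T m)
  have "positive_poly Z (\<lambda>x. (c * d) *\<^sub>R (Z ^^ (k + m)) x + c *\<^sub>R (Z ^^ k) (T x))"
    by (rule positive_poly.monom) (use monom assms in auto)
  then show ?case using bcl_funpow[OF Z, of k]
    by (simp add: bcl_simps funpow_add scaleR_add_right)
qed

lemma positive_poly_compose:
  assumes Z: "bounded_clinear Z" and "positive_poly Z S" "positive_poly Z T"
  shows "positive_poly Z (\<lambda>x. S (T x))"
  using assms(2)
proof (induction rule: positive_poly.induct)
  case zero
  show ?case by (rule positive_poly.zero)
next
  case (monom c S k)
  show ?case by (rule positive_poly_add[OF positive_poly_monom_mult[OF Z monom(1) assms(3)] monom(3)])
qed

lemma positive_poly_scaleR:
  assumes Z: "bounded_clinear Z" and "0 \<le> c" "positive_poly Z T"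
  shows "positive_poly Z (\<lambda>x. c *\<^sub>R T x)"
  using positive_poly_monom_mult[OF assms, of 0] by simp

primrec sqrt_iter :: "('u::chilbert_space \<Rightarrow> 'u) \<Rightarrow> nat \<Rightarrow> 'u \<Rightarrow> 'u" where
  "sqrt_iter Z 0 = (\<lambda>x. 0)"
| "sqrt_iter Z (Suc n) = (\<lambda>x. (1/2) *\<^sub>R (Z x + sqrt_iter Z n (sqrt_iter Z n x)))"

lemma positive_poly_sqrt_iter:
  assumes Z: "bounded_clinear Z"
  shows "positive_poly Z (sqrt_iter Z n)"
proof (induction n)
  case (Suc n)
  show ?case unfolding sqrt_iter.simps
    by (rule positive_poly_scaleR[OF Z _ positive_poly_add[OF positive_poly_self
          positive_poly_compose[OF Z Suc Suc]]]) simp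
qed (simp add: positive_poly.zero)

text \<open>The limit \<open>X\<close> of the iteration satisfies \<open>X = (Z + X\<^sup>2) / 2\<close>, that is \<open>(1 - X)\<^sup>2 = 1 - Z\<close>.
  The increments are polynomials in \<open>Z\<close> with nonnegative coefficients, which makes
  the iteration monotone.\<close>

lemma sqrt_iter_limit:
  assumes Z: "bounded_clinear Z" "positive_op Z" "\<And>x. norm (Z x) \<le> norm x"
  obtains X where "\<And>x. (\<lambda>n. sqrt_iter Z n x) \<longlonglongrightarrow> X x" "\<And>x. X x = (1/2) *\<^sub>R (Z x + X (X x))"
    "\<And>x. norm (X x) \<le> norm x"
proof -
  let ?X = "sqrt_iter Z"
  have pp: "positive_poly Z (?X n)" for n
    by (rule positive_poly_sqrt_iter) fact
  have bX: "bounded_clinear (?X n)" for n using positive_poly_bcl[OF pp Z(1)] .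
  have comm: "?X m (?X n x) = ?X n (?X m x)" for m n x
    by (rule positive_poly_commute[OF pp Z(1) bX], rule sym,
        rule positive_poly_commute[OF pp Z(1) Z(1)]) simp
  have step: "positive_poly Z (\<lambda>x. ?X (Suc n) x - ?X n x)" for n
  proof (induction n)
    case 0
    then show ?case using positive_poly_scaleR[OF Z(1) _ positive_poly_self, of "1/2"] by simp
  next
    case (Suc n)
    \<comment> \<open>Difference of squares: as all iterates commute, the next increment is half the
      product of the previous increment and the sum of the two previous iterates.\<close>
    have "positive_poly Z (\<lambda>x. (1/2) *\<^sub>R ((\<lambda>y. ?X (Suc n) y - ?X n y) (?X (Suc n) x + ?X n x)))"
      by (intro positive_poly_scaleR[OF Z(1)] positive_poly_compose[OF Z(1) Suc] positive_poly_add pp) simp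
    also have "(\<lambda>x. (1/2) *\<^sub>R ((\<lambda>y. ?X (Suc n) y - ?X n y) (?X (Suc n) x + ?X n x)))
        = (\<lambda>x. ?X (Suc (Suc n)) x - ?X (Suc n) x)"
    proof
      fix x
      have "?X (Suc (Suc n)) x - ?X (Suc n) x
          = (1/2) *\<^sub>R (?X (Suc n) (?X (Suc n) x) - ?X n (?X n x))"
        unfolding sqrt_iter.simps(2)[of Z "Suc n"] sqrt_iter.simps(2)[of Z n, THEN fun_cong, of x]
        by (simp only: scaleR_diff_right[symmetric] add_diff_cancel_left)
      also have "?X (Suc n) (?X (Suc n) x) - ?X n (?X n x)
          = ?X (Suc n) (?X (Suc n) x + ?X n x) - ?X n (?X (Suc n) x + ?X n x)"
        unfolding bcl_add[OF bX] comm[of "Suc n" n] by simp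
      finally show "(1/2) *\<^sub>R ((\<lambda>y. ?X (Suc n) y - ?X n y) (?X (Suc n) x + ?X n x))
          = ?X (Suc (Suc n)) x - ?X (Suc n) x" by simp
    qed
    finally show ?case .
  qed
  have mono: "positive_poly Z (\<lambda>x. ?X m x - ?X n x)" if "n \<le> m" for m n
    using that
  proof (induction m rule: dec_induct)
    case (step k)
    then show ?case using positive_poly_add[OF \<open>positive_poly Z (\<lambda>x. ?X (Suc k) x - ?X k x)\<close> step(3)] by simp
  qed (simp add: positive_poly.zero)
  have nX: "norm (?X n x) \<le> norm x" for n x
  proof (induction n arbitrary: x)
    case (Suc n)
    have "norm (?X n (?X n x)) \<le> norm x" using Suc[of "?X n x"] Suc[of x] by linarith
    then have "norm (Z x + ?X n (?X n x)) \<le> 2 * norm x"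
      using Z(3)[of x] norm_triangle_ineq[of "Z x" "?X n (?X n x)"] by linarith
    then show ?case by simp
  qed simp
  have conv: "convergent (\<lambda>n. ?X n x)" for x
  proof -
    define q where "q n = Re (cinner (?X n x) x)" for n
    \<comment> \<open>The factor \<open>2\<close> bounds the difference of two contractions. Norm
      distances are thereby controlled by the bounded increasing sequence \<open>q\<close>.\<close>
    have le: "(norm (?X m x - ?X n x))\<^sup>2 \<le> 2 * (q m - q n)" if "n \<le> m" for m n
    proof -
      have "(norm (?X m x - ?X n x))\<^sup>2 \<le> 2 * Re (cinner (?X m x - ?X n x) x)"
      proof (rule positive_op_norm_sq_le)
        show "bounded_clinear (\<lambda>x. ?X m x - ?X n x)" by (intro bcl_minus_fun bX)
        show "positive_op (\<lambda>x. ?X m x - ?X n x)"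
          by (rule positive_poly_positive[OF mono[OF that] Z(1,2)])
        fix y
        have "Re (cinner (?X m y - ?X n y) y) \<le> norm (?X m y - ?X n y) * norm y"
          by (rule order_trans[OF complex_Re_le_cmod cinner_Cauchy_Schwarz])
        also have "\<dots> \<le> (2 * norm y) * norm y"
          using norm_triangle_ineq4[of "?X m y" "?X n y"] nX[of m y] nX[of n y]
          by (intro mult_right_mono) auto
        finally show "Re (cinner (?X m y - ?X n y) y) \<le> 2 * (norm y)\<^sup>2"
          by (simp add: power2_eq_square)
      qed
      then show ?thesis by (simp add: q_def cinner_simps)
    qed
    have "incseq q" unfolding incseq_def using le by (smt (verit) zero_le_power2)
    moreover have "q n \<le> (norm x)\<^sup>2" for n
    proof -
      have "q n \<le> norm (?X n x) * norm x"
        unfolding q_def by (rule order_trans[OF complex_Re_le_cmod cinner_Cauchy_Schwarz])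
      also have "\<dots> \<le> norm x * norm x" by (intro mult_right_mono nX) simp
      finally show ?thesis by (simp add: power2_eq_square)
    qed
    ultimately obtain L where "q \<longlonglongrightarrow> L" using incseq_convergent by blast
    then have "Cauchy q" using convergent_Cauchy convergent_def by blast
    have "Cauchy (\<lambda>n. ?X n x)"
    proof (rule metric_CauchyI)
      fix e :: real assume e: "e > 0"
      obtain M where M: "\<And>m n. m \<ge> M \<Longrightarrow> n \<ge> M \<Longrightarrow> dist (q m) (q n) < e\<^sup>2 / 2"
        using metric_CauchyD[OF \<open>Cauchy q\<close>, of "e\<^sup>2 / 2"] e by auto
      have *: "dist (?X m x) (?X n x) < e" if "n \<ge> M" "n \<le> m" for m n
      proof -
        have "q m - q n < e\<^sup>2 / 2"
          using M[OF order_trans[OF that] that(1)] unfolding dist_real_def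
          by (rule le_less_trans[OF abs_ge_self])
        then have "2 * (q m - q n) < e\<^sup>2" by simp
        with le[OF that(2)] have "(norm (?X m x - ?X n x))\<^sup>2 < e\<^sup>2" by (rule le_less_trans)
        then show ?thesis using e by (simp add: dist_norm power_less_imp_less_base)
      qed
      have "dist (?X m x) (?X n x) < e" if "n \<ge> M" "m \<ge> M" for m n
        using *[of n m] *[of m n] that by (cases "n \<le> m") (auto simp: dist_commute)
      then show "\<exists>M. \<forall>m\<ge>M. \<forall>n\<ge>M. dist (?X m x) (?X n x) < e" by blast
    qed
    then show ?thesis by (rule Cauchy_convergent)
  qed
  then obtain X where X: "\<And>x. (\<lambda>n. ?X n x) \<longlonglongrightarrow> X x" unfolding convergent_def by metis
  have nXl: "norm (X x) \<le> norm x" for x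
    by (rule LIMSEQ_le_const2[OF tendsto_norm[OF X]]) (use nX in auto)
  \<comment> \<open>Split \<open>?X n (?X n x)\<close> into \<open>?X n (?X n x - X x)\<close> and
    \<open>?X n (X x)\<close>; contractivity, uniform in \<open>n\<close>, makes the first part tend
    to zero.\<close>
  have XX: "(\<lambda>n. ?X n (?X n x)) \<longlonglongrightarrow> X (X x)" for x
  proof -
    have "(\<lambda>n. ?X n x - X x) \<longlonglongrightarrow> 0" using X[of x] by (simp add: LIM_zero)
    then have "(\<lambda>n. ?X n (?X n x - X x)) \<longlonglongrightarrow> 0"
      by (rule Lim_null_comparison[OF _ tendsto_norm_zero, rotated]) (use nX in auto)
    from tendsto_add[OF this X[of "X x"]] show ?thesis by (simp add: bcl_diff[OF bX])
  qed
  have "X x = (1/2) *\<^sub>R (Z x + X (X x))" for x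
  proof (rule LIMSEQ_unique)
    show "(\<lambda>n. ?X (Suc n) x) \<longlonglongrightarrow> X x" by (rule LIMSEQ_Suc[OF X])
    show "(\<lambda>n. ?X (Suc n) x) \<longlonglongrightarrow> (1/2) *\<^sub>R (Z x + X (X x))"
      unfolding sqrt_iter.simps by (intro tendsto_intros XX)
  qed
  then show ?thesis using that X nXl by blast
qed

text \<open>Set \<open>Z = 1 - A\<close>, again a positive contraction by
  \<open>positive_op_norm_sq_le\<close> with constant \<open>1\<close>, and \<open>R = 1 - X\<close>
  for the fixed point \<open>X\<close> of the iteration. Whatever commutes with \<open>A\<close>
  commutes with every iterate and hence with the limit.\<close>

lemma contraction_sqrt:
  assumes A: "bounded_clinear A" "positive_op A" "\<And>x. norm (A x) \<le> norm x"
  obtains R where "bounded_clinear R" "\<And>x y. cinner (R x) y = cinner x (R y)"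
    "\<And>x. R (R x) = A x"
    "\<And>B x. bounded_clinear B \<Longrightarrow> (\<And>x. B (A x) = A (B x)) \<Longrightarrow> B (R x) = R (B x)"
proof -
  define Z where "Z x = x - A x" for x
  have bZ: "bounded_clinear Z" unfolding Z_def by (intro bcl_minus_fun bcl_id A)
  have A_le: "Re (cinner (A x) x) \<le> (norm x)\<^sup>2" for x
  proof -
    have "Re (cinner (A x) x) \<le> norm (A x) * norm x"
      by (rule order_trans[OF complex_Re_le_cmod cinner_Cauchy_Schwarz])
    also have "\<dots> \<le> norm x * norm x" by (intro mult_right_mono A) simp
    finally show ?thesis by (simp add: power2_eq_square)
  qed
  have pZ: "positive_op Z"
    using A(2) A_le by (simp add: positive_op_def Z_def cinner_simps cinner_self)
  have Z_le: "Re (cinner (Z x) x) \<le> 1 * (norm x)\<^sup>2" for x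
    using positive_op_Re[OF A(2), of x] by (simp add: Z_def cinner_simps cinner_self)
  have nZ: "norm (Z x) \<le> norm x" for x
    by (rule power2_le_imp_le)
       (use positive_op_norm_sq_le[OF bZ pZ Z_le, of x] Z_le[of x] in linarith, simp)
  obtain X where X: "\<And>x. (\<lambda>n. sqrt_iter Z n x) \<longlonglongrightarrow> X x" "\<And>x. X x = (1/2) *\<^sub>R (Z x + X (X x))"
    "\<And>x. norm (X x) \<le> norm x"
    using sqrt_iter_limit[OF bZ pZ nZ] by blast
  have pp: "positive_poly Z (sqrt_iter Z n)" for n
    by (rule positive_poly_sqrt_iter) fact
  have bX: "bounded_clinear X"
  proof (rule bounded_clinearI[where K=1])
    fix x y c
    show "X (x + y) = X x + X y"
      by (rule LIMSEQ_unique[OF X(1)])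
         (simp add: bcl_add[OF positive_poly_bcl[OF pp bZ]] tendsto_add X(1))
    show "X (cscale c x) = cscale c (X x)"
      by (rule LIMSEQ_unique[OF X(1)])
         (simp add: bcl_cscale[OF positive_poly_bcl[OF pp bZ]] tendsto_cscale X(1))
    show "norm (X x) \<le> norm x * 1" using X(3) by simp
  qed
  have hX: "cinner (X x) y = cinner x (X y)" for x y
  proof (rule LIMSEQ_unique)
    show "(\<lambda>n. cinner (sqrt_iter Z n x) y) \<longlonglongrightarrow> cinner (X x) y" by (intro tendsto_intros X)
    show "(\<lambda>n. cinner (sqrt_iter Z n x) y) \<longlonglongrightarrow> cinner x (X y)"
      by (subst positive_op_hermitian[OF positive_poly_bcl[OF pp bZ] positive_poly_positive[OF pp bZ pZ]])
         (intro tendsto_intros X)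
  qed
  show ?thesis
  proof (rule that[of "\<lambda>x. x - X x"])
    show "bounded_clinear (\<lambda>x. x - X x)" by (intro bcl_minus_fun bcl_id bX)
    show "cinner (x - X x) y = cinner x (y - X y)" for x y by (simp add: cinner_simps hX)
    show "x - X x - X (x - X x) = A x" for x
    proof -
      have "2 *\<^sub>R X x = Z x + X (X x)" using arg_cong[OF X(2)[of x], of "scaleR 2"] by simp
      then have "X x + X x = (x - A x) + X (X x)" by (simp add: scaleR_2 Z_def)
      then show ?thesis by (simp add: bcl_diff[OF bX] algebra_simps)
    qed
    fix B x assume B: "bounded_clinear B" "\<And>x. B (A x) = A (B x)"
    have "B (Z x) = Z (B x)" for x using B by (simp add: Z_def bcl_simps)
    then have c: "B (sqrt_iter Z n x) = sqrt_iter Z n (B x)" for n x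
      using positive_poly_commute[OF pp bZ B(1)] by blast
    have "B (X x) = X (B x)"
      by (rule LIMSEQ_unique[OF bcl_tendsto[OF B(1) X(1)]]) (simp add: c X(1))
    then show "B (x - X x) = B x - X (B x)" by (simp add: bcl_simps B(1))
  qed
qed

lemma positive_sqrt:
  assumes A: "bounded_clinear A" "positive_op A"
  obtains R where "bounded_clinear R" "\<And>x y. cinner (R x) y = cinner x (R y)"
    "\<And>x. R (R x) = A x"
    "\<And>B x. bounded_clinear B \<Longrightarrow> (\<And>x. B (A x) = A (B x)) \<Longrightarrow> B (R x) = R (B x)"
proof -
  obtain K where K: "K > 0" "\<And>x. norm (A x) \<le> K * norm x" using bcl_bound[OF A(1)] by blast
  define A' where "A' x = (1/K) *\<^sub>R A x" for x
  have 1: "bounded_clinear A'" unfolding A'_def by (intro bcl_scaleR_fun A)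
  have 2: "positive_op A'"
    using A(2) K(1) by (simp add: positive_op_def A'_def cinner_scaleR_left)
  have 3: "norm (A' x) \<le> norm x" for x
    using K(1) K(2)[of x] by (simp add: A'_def field_simps)
  obtain R where R: "bounded_clinear R" "\<And>x y. cinner (R x) y = cinner x (R y)"
    "\<And>x. R (R x) = A' x"
    "\<And>B x. bounded_clinear B \<Longrightarrow> (\<And>x. B (A' x) = A' (B x)) \<Longrightarrow> B (R x) = R (B x)"
    using contraction_sqrt[OF 1 2 3] by blast
  show ?thesis
  proof (rule that[of "\<lambda>x. sqrt K *\<^sub>R R x"])
    show "bounded_clinear (\<lambda>x. sqrt K *\<^sub>R R x)" by (intro bcl_scaleR_fun R)
    show "cinner (sqrt K *\<^sub>R R x) y = cinner x (sqrt K *\<^sub>R R y)" for x y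
      by (simp add: cinner_scaleR_left cinner_scaleR_right R(2))
    show "sqrt K *\<^sub>R R (sqrt K *\<^sub>R R x) = A x" for x
      using K(1) by (simp add: bcl_scaleR[OF R(1)] R(3) A'_def)
    fix B x assume B: "bounded_clinear B" "\<And>x. B (A x) = A (B x)"
    have "B (A' x) = A' (B x)" for x by (simp add: A'_def B bcl_scaleR)
    then show "B (sqrt K *\<^sub>R R x) = sqrt K *\<^sub>R R (B x)" using R(4)[OF B(1)] by (simp add: bcl_scaleR B(1))
  qed
qed

section \<open>Linear spans and operators prescribed on a spanning family\<close>

definition cspan :: "('i \<Rightarrow> 'u::chilbert_space) \<Rightarrow> 'i set \<Rightarrow> 'u set" where
  "cspan \<phi> I = {\<Sum>i\<in>F. cscale (c i) (\<phi> i) | F c. finite F \<and> F \<subseteq> I}"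

lemma lincomb_extend:
  assumes "finite A" "F \<subseteq> A"
  shows "(\<Sum>i\<in>F. cscale (c i) (\<phi> i)) = (\<Sum>i\<in>A. cscale (if i \<in> F then c i else 0) (\<phi> i :: 'u::chilbert_space))"
  by (rule sum.mono_neutral_cong_left) (use assms in auto)

lemma lincomb_add:
  assumes "finite F" "finite F'"
  shows "(\<Sum>i\<in>F. cscale (c i) (\<phi> i)) + (\<Sum>i\<in>F'. cscale (c' i) (\<phi> i))
    = (\<Sum>i\<in>F \<union> F'. cscale ((if i \<in> F then c i else 0) + (if i \<in> F' then c' i else 0))
        (\<phi> i :: 'u::chilbert_space))"
  using assms
  by (simp add: lincomb_extend[of "F \<union> F'" F] lincomb_extend[of "F \<union> F'" F'] cscale_add_left
      sum.distrib)

lemma cspan_base: "i \<in> I \<Longrightarrow> \<phi> i \<in> cspan \<phi> I"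
  unfolding cspan_def by (intro CollectI exI[of _ "{i}"] exI[of _ "\<lambda>_. 1"]) (simp add: cscale_one)

lemma cspan_lincomb: "finite F \<Longrightarrow> F \<subseteq> I \<Longrightarrow> (\<Sum>i\<in>F. cscale (c i) (\<phi> i)) \<in> cspan \<phi> I"
  unfolding cspan_def by blast

lemma closed_csubspace_cspan: "closed_csubspace (closure (cspan \<phi> I))"
proof (rule closure_csubspace)
  show "0 \<in> cspan \<phi> I" using cspan_lincomb[of "{}" I "\<lambda>_. 0" \<phi>] by simp
  fix x y c assume "x \<in> cspan \<phi> I"
  then obtain F a where x: "finite F" "F \<subseteq> I" "x = (\<Sum>i\<in>F. cscale (a i) (\<phi> i))" by (auto simp: cspan_def)
  show "cscale c x \<in> cspan \<phi> I"
    using cspan_lincomb[OF x(1,2), of "\<lambda>i. c * a i" \<phi>] by (simp add: x(3) cscale_sum_right cscale_cscale)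
  assume "y \<in> cspan \<phi> I"
  then obtain F' b where y: "finite F'" "F' \<subseteq> I" "y = (\<Sum>i\<in>F'. cscale (b i) (\<phi> i))" by (auto simp: cspan_def)
  show "x + y \<in> cspan \<phi> I"
    unfolding x(3) y(3) lincomb_add[OF x(1) y(1)] by (rule cspan_lincomb) (use x y in auto)
qed

text \<open>The bound also makes the assignment well defined: a vanishing combination of the
  \<open>\<phi> i\<close> forces the same combination of the \<open>\<psi> i\<close> to vanish.
  Indexed families are used instead of sets because vectors with different indices may coincide, as
  Gram vectors can.\<close>

lemma cspan_extension:
  fixes \<phi> \<psi> :: "'i \<Rightarrow> 'u::chilbert_space"
  assumes bound: "\<And>F c. finite F \<Longrightarrow> F \<subseteq> I \<Longrightarrow>
      norm (\<Sum>i\<in>F. cscale (c i) (\<psi> i)) \<le> C * norm (\<Sum>i\<in>F. cscale (c i) (\<phi> i))" and C: "0 \<le> C"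
  obtains T where "in_B (closure (cspan \<phi> I)) (closure (cspan \<psi> I)) T" "\<And>i. i \<in> I \<Longrightarrow> T (\<phi> i) = \<psi> i"
proof -
  define G where "G = {(\<Sum>i\<in>F. cscale (c i) (\<phi> i), \<Sum>i\<in>F. cscale (c i) (\<psi> i)) | F c. finite F \<and> F \<subseteq> I}"
  have GI: "(\<Sum>i\<in>F. cscale (c i) (\<phi> i), \<Sum>i\<in>F. cscale (c i) (\<psi> i)) \<in> G" if "finite F" "F \<subseteq> I" for F c
    using that unfolding G_def by blast
  have GE: "\<exists>F c. finite F \<and> F \<subseteq> I \<and> x = (\<Sum>i\<in>F. cscale (c i) (\<phi> i)) \<and> y = (\<Sum>i\<in>F. cscale (c i) (\<psi> i))"
    if "(x, y) \<in> G" for x y using that unfolding G_def by blast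
  have zero: "(0, 0) \<in> G" using GI[of "{}" "\<lambda>_. 0"] by simp
  have add: "(x + x', y + y') \<in> G" if xy: "(x, y) \<in> G" "(x', y') \<in> G" for x y x' y'
  proof -
    obtain F c where 1: "finite F" "F \<subseteq> I" "x = (\<Sum>i\<in>F. cscale (c i) (\<phi> i))" "y = (\<Sum>i\<in>F. cscale (c i) (\<psi> i))"
      using GE[OF xy(1)] by blast
    obtain F' c' where 2: "finite F'" "F' \<subseteq> I" "x' = (\<Sum>i\<in>F'. cscale (c' i) (\<phi> i))" "y' = (\<Sum>i\<in>F'. cscale (c' i) (\<psi> i))"
      using GE[OF xy(2)] by blast
    show ?thesis unfolding 1(3,4) 2(3,4) lincomb_add[OF 1(1) 2(1)] by (rule GI) (use 1 2 in auto)
  qed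
  have scale: "(cscale a x, cscale a y) \<in> G" if xy: "(x, y) \<in> G" for a x y
  proof -
    obtain F c where 1: "finite F" "F \<subseteq> I" "x = (\<Sum>i\<in>F. cscale (c i) (\<phi> i))" "y = (\<Sum>i\<in>F. cscale (c i) (\<psi> i))"
      using GE[OF xy] by blast
    show ?thesis using GI[OF 1(1,2), of "\<lambda>i. a * c i"] by (simp add: 1(3,4) cscale_sum_right cscale_cscale)
  qed
  have bd: "norm y \<le> C * norm x" if xy: "(x, y) \<in> G" for x y
    using GE[OF xy] bound by blast
  obtain T where T: "in_B (closure (fst ` G)) (closure (snd ` G)) T" "\<And>x y. (x, y) \<in> G \<Longrightarrow> T x = y"
    using bounded_graph_extension[OF zero add scale bd C] by metis
  have "fst ` G = cspan \<phi> I" "snd ` G = cspan \<psi> I"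
    unfolding G_def cspan_def by force+
  moreover have "T (\<phi> i) = \<psi> i" if "i \<in> I" for i
    using T(2)[OF GI[of "{i}" "\<lambda>_. 1"]] that by (simp add: cscale_one)
  ultimately show ?thesis using T(1) by (intro that[of T]) simp_all
qed

section \<open>Orthonormal bases and isometries with orthogonal ranges\<close>

definition orthonormal :: "'u::chilbert_space set \<Rightarrow> bool" where
  "orthonormal B \<longleftrightarrow> (\<forall>a\<in>B. \<forall>b\<in>B. cinner a b = (if a = b then 1 else 0))"

lemma maximal_orthonormal:
  obtains B :: "'u::chilbert_space set" where "orthonormal B" "\<And>x. orth x B \<Longrightarrow> x = 0"
proof -
  let ?A = "{B :: 'u set. orthonormal B}"
  have "\<exists>M\<in>?A. \<forall>X\<in>?A. M \<subseteq> X \<longrightarrow> X = M"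
  proof (rule subset_Zorn')
    fix c assume c: "subset.chain ?A c"
    have "\<exists>D\<in>c. a \<in> D \<and> b \<in> D" if ab: "a \<in> \<Union>c" "b \<in> \<Union>c" for a b
    proof -
      obtain D D' where "D \<in> c" "a \<in> D" "D' \<in> c" "b \<in> D'" using ab by blast
      then show ?thesis using subset_chain_def[of ?A c] c by (metis subset_iff)
    qed
    moreover have "c \<subseteq> ?A" using c by (simp add: subset_chain_def)
    ultimately show "\<Union>c \<in> ?A" unfolding orthonormal_def by blast
  qed
  then obtain B :: "'u set" where B: "orthonormal B" "\<And>X. orthonormal X \<Longrightarrow> B \<subseteq> X \<Longrightarrow> X = B" by blast
  have "x = 0" if x: "orth x B" for x
  proof (rule ccontr)
    assume x0: "x \<noteq> 0"
    define u where "u = (1 / norm x) *\<^sub>R x"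
    have uu: "cinner u u = 1" using x0 by (simp add: u_def cinner_self)
    have ub: "cinner u b = 0" if "b \<in> B" for b
      using x that by (simp add: u_def cinner_scaleR_left orth_def)
    then have bu: "cinner b u = 0" if "b \<in> B" for b
      using that by (metis cinner_commute complex_cnj_zero)
    have "u \<notin> B" using ub uu by force
    then have "orthonormal (insert u B)"
      using B(1) uu ub bu unfolding orthonormal_def by auto
    then show False using B(2)[of "insert u B"] \<open>u \<notin> B\<close> by blast
  qed
  then show ?thesis using that B(1) by blast
qed

text \<open>A finite maximal orthonormal set would span: \<open>v\<close> minus its Fourier sum is
  orthogonal to \<open>B\<close>, hence zero.\<close>

lemma infinite_orthonormal_basis:
  assumes "infinite_dimensional TYPE('u::chilbert_space)"
  obtains B :: "'u::chilbert_space set" where "orthonormal B" "\<And>x. orth x B \<Longrightarrow> x = 0" "infinite B"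
proof -
  obtain B :: "'u set" where B: "orthonormal B" "\<And>x. orth x B \<Longrightarrow> x = 0"
    using maximal_orthonormal by blast
  have "infinite B"
  proof
    assume fin: "finite B"
    have "v = (\<Sum>b\<in>B. cscale (cinner v b) b)" for v
    proof -
      have "orth (v - (\<Sum>b\<in>B. cscale (cinner v b) b)) B"
        unfolding orth_def
      proof
        fix z assume z: "z \<in> B"
        have "(\<Sum>b\<in>B. cinner v b * cinner b z) = (\<Sum>b\<in>B. if b = z then cinner v b else 0)"
          using B(1) z by (intro sum.cong) (auto simp: orthonormal_def)
        then show "cinner (v - (\<Sum>b\<in>B. cscale (cinner v b) b)) z = 0"
          using fin z by (simp add: cinner_simps)
      qed
      then have "v - (\<Sum>b\<in>B. cscale (cinner v b) b) = 0" by (rule B(2))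
      then show ?thesis by simp
    qed
    then have "\<exists>F::'u set. finite F \<and> (\<forall>v. \<exists>c. v = (\<Sum>f\<in>F. cscale (c f) f))" using fin by blast
    then show False using assms by (simp add: infinite_dimensional_def)
  qed
  then show ?thesis using that B by blast
qed

lemma cinner_lincomb_orthonormal:
  assumes "finite F" "\<And>i j. i \<in> F \<Longrightarrow> j \<in> F \<Longrightarrow> cinner (\<psi> i) (\<psi> j) = (if i = j then 1 else 0)"
  shows "cinner (\<Sum>i\<in>F. cscale (c i) (\<psi> i)) (\<Sum>i\<in>F. cscale (d i) (\<psi> i :: 'u::chilbert_space))
    = (\<Sum>i\<in>F. c i * cnj (d i))"
proof -
  have "cinner (\<Sum>i\<in>F. cscale (c i) (\<psi> i)) (\<Sum>i\<in>F. cscale (d i) (\<psi> i))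
     = (\<Sum>i\<in>F. \<Sum>j\<in>F. c i * cnj (d j) * cinner (\<psi> i) (\<psi> j))"
    by (subst sum.swap) (simp add: cinner_simps sum_distrib_left mult_ac)
  also have "\<dots> = (\<Sum>i\<in>F. \<Sum>j\<in>F. if i = j then c i * cnj (d j) else 0)"
    using assms(2) by (intro sum.cong) auto
  finally show ?thesis using assms(1) by simp
qed

text \<open>An infinite basis \<open>B\<close> contains finitely many disjoint copies of itself, and
  \<open>J i\<close> moves \<open>B\<close> onto the \<open>i\<close>-th copy. The injection comes
  from cardinal arithmetic, so non-separable ambient spaces are covered. The identity on adjoints
  expresses isometry (\<open>i = j\<close>) and orthogonality of ranges at once.\<close>

lemma orthogonal_isometries:
  assumes "infinite_dimensional TYPE('u::chilbert_space)"
  obtains J :: "'i::finite \<Rightarrow> 'u::chilbert_space \<Rightarrow> 'u" where "\<And>i. bounded_clinear (J i)"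
    "\<And>i j x. adj (J i) (J j x) = (if i = j then x else 0)"
proof -
  obtain B :: "'u set" where B: "orthonormal B" "\<And>x. orth x B \<Longrightarrow> x = 0" "infinite B"
    using infinite_orthonormal_basis[OF assms] by blast
  have "(card_of (UNIV :: 'i set), card_of B) \<in> ordLeq"
    using B(3) by (intro ordLess_imp_ordLeq finite_ordLess_infinite card_of_Well_order)
      (simp_all add: Field_card_of)
  then have "(card_of (B \<times> (UNIV :: 'i set)), card_of B) \<in> ordLeq"
    using card_of_Times_infinite[OF B(3), of "UNIV :: 'i set"] by (auto intro: ordIso_imp_ordLeq)
  then obtain f where f: "inj_on f (B \<times> (UNIV :: 'i set))" "f ` (B \<times> UNIV) \<subseteq> B"
    using card_of_ordLeq[of "B \<times> (UNIV :: 'i set)" B] by blast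
  have ff: "cinner (f (a, i)) (f (b, j)) = (if a = b \<and> i = j then 1 else 0)" if "a \<in> B" "b \<in> B" for a b i j
  proof -
    have "f (a, i) \<in> B" "f (b, j) \<in> B" using f(2) that by auto
    moreover have "f (a, i) = f (b, j) \<longleftrightarrow> a = b \<and> i = j"
      using inj_onD[OF f(1), of "(a, i)" "(b, j)"] that by auto
    ultimately show ?thesis using B(1) by (simp add: orthonormal_def)
  qed
  have dense: "closure (cspan (\<lambda>b. b) B) = UNIV"
  proof -
    have "x \<in> closure (cspan (\<lambda>b. b) B)" for x
    proof (rule csubspace_biorth[OF closed_csubspace_cspan])
      fix z assume "orth z (closure (cspan (\<lambda>b. b) B))"
      then have "orth z B"
        using cspan_base[of _ B "\<lambda>b. b"] closure_subset unfolding orth_def by fast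
      then show "cinner x z = 0" using B(2)[of z] by simp
    qed
    then show ?thesis by blast
  qed
  have "\<exists>T. bounded_clinear T \<and> (\<forall>b\<in>B. T b = f (b, i))" for i
  proof -
    have "norm (\<Sum>b\<in>F. cscale (c b) (f (b, i))) \<le> 1 * norm (\<Sum>b\<in>F. cscale (c b) b)"
      if F: "finite F" "F \<subseteq> B" for F c
    proof -
      have "cinner (\<Sum>b\<in>F. cscale (c b) (f (b, i))) (\<Sum>b\<in>F. cscale (c b) (f (b, i)))
          = (\<Sum>b\<in>F. c b * cnj (c b))"
        by (rule cinner_lincomb_orthonormal[OF F(1)]) (use F(2) in \<open>subst ff; auto\<close>)
      also have "\<dots> = cinner (\<Sum>b\<in>F. cscale (c b) b) (\<Sum>b\<in>F. cscale (c b) b)"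
        by (rule cinner_lincomb_orthonormal[OF F(1), symmetric])
           (use F(2) B(1) in \<open>auto simp: orthonormal_def subset_iff\<close>)
      finally show ?thesis by (simp add: norm_eq_sqrt_cinner)
    qed
    from cspan_extension[OF this] obtain T where
      "in_B (closure (cspan (\<lambda>b. b) B)) (closure (cspan (\<lambda>b. f (b, i)) B)) T" "\<And>b. b \<in> B \<Longrightarrow> T b = f (b, i)"
      by auto
    then show ?thesis using in_B_bcl by blast
  qed
  then obtain J where J: "\<And>i. bounded_clinear (J i)" "\<And>i b. b \<in> B \<Longrightarrow> J i b = f (b, i)" by metis
  have base: "adj (J i) (J j b) = (if i = j then b else 0)" if b: "b \<in> B" for i j b
  proof -
    have "orth (adj (J i) (J j b) - (if i = j then b else 0)) B"
      unfolding orth_def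
    proof
      fix z assume z: "z \<in> B"
      have "cinner (adj (J i) (J j b)) z = (if i = j then cinner b z else 0)"
        using b z B(1) by (simp add: cinner_adj_left J ff orthonormal_def)
      then show "cinner (adj (J i) (J j b) - (if i = j then b else 0)) z = 0" by (simp add: cinner_diff_left)
    qed
    then have "adj (J i) (J j b) - (if i = j then b else 0) = 0" by (rule B(2))
    then show ?thesis by simp
  qed
  have "adj (J i) (J j x) = (if i = j then x else 0)" for i j x
  proof -
    \<comment> \<open>The defect of the identity is bounded and vanishes on \<open>B\<close>, hence
      on the dense span of \<open>B\<close>.\<close>
    define D where "D x = adj (J i) (J j x) - (if i = j then x else 0)" for x
    have bD: "bounded_clinear D"
      unfolding D_def by (cases "i = j") (auto intro!: bcl_minus_fun bcl_compose[OF bcl_adj] J bcl_id bcl_const_zero)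
    have D0: "D x = 0" if x: "x \<in> cspan (\<lambda>b. b) B" for x
    proof -
      obtain F c where "finite F" "F \<subseteq> B" "x = (\<Sum>b\<in>F. cscale (c b) b)" using x by (auto simp: cspan_def)
      moreover from this have "D b = 0" if "b \<in> F" for b using that by (auto simp: D_def base)
      ultimately show ?thesis by (simp add: bcl_simps bD)
    qed
    have "x \<in> closure (cspan (\<lambda>b. b) B)" using dense by simp
    then obtain g where g: "\<And>n. g n \<in> cspan (\<lambda>b. b) B" "g \<longlonglongrightarrow> x" by (auto simp: closure_sequential)
    have "D x = 0"
      using LIMSEQ_unique[OF bcl_tendsto[OF bD g(2)], of 0] D0[OF g(1)] by simp
    then show ?thesis by (simp add: D_def)
  qed
  then show ?thesis using that J(1) by blast
qed

section \<open>Realizing positive semidefinite kernels\<close>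

text \<open>An abstract Gram matrix: \<open>k i j\<close> stands for the inner product of the
  \<open>i\<close>-th and the \<open>j\<close>-th vector. The Hermitian clause makes the sums real,
  so testing \<open>Re\<close> suffices.\<close>

definition psd_kernel :: "('i \<Rightarrow> 'i \<Rightarrow> complex) \<Rightarrow> bool" where
  "psd_kernel k \<longleftrightarrow> (\<forall>i j. k i j = cnj (k j i)) \<and>
     (\<forall>F c. finite F \<longrightarrow> 0 \<le> Re (\<Sum>i\<in>F. \<Sum>j\<in>F. c i * cnj (c j) * k i j))"

text \<open>The Schur complement; for a vanishing pivot, division by zero makes it equal to \<open>k\<close>,
  which is what is needed because the pivot column then vanishes as well.\<close>

definition schur :: "'i \<Rightarrow> ('i \<Rightarrow> 'i \<Rightarrow> complex) \<Rightarrow> 'i \<Rightarrow> 'i \<Rightarrow> complex" where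
  "schur n k i j = k i j - k i n * cnj (k j n) / k n n"

lemma psd_kernel_hermitian: "psd_kernel k \<Longrightarrow> k i j = cnj (k j i)"
  unfolding psd_kernel_def by blast

lemma psd_kernel_nonneg:
  "psd_kernel k \<Longrightarrow> finite F \<Longrightarrow> 0 \<le> Re (\<Sum>i\<in>F. \<Sum>j\<in>F. c i * cnj (c j) * k i j)"
  unfolding psd_kernel_def by blast

lemma psd_kernel_diag: "psd_kernel k \<Longrightarrow> k i i = of_real (Re (k i i))" "psd_kernel k \<Longrightarrow> 0 \<le> Re (k i i)"
proof -
  assume k: "psd_kernel k"
  have h: "k i i = cnj (k i i)" using k by (rule psd_kernel_hermitian)
  show "k i i = of_real (Re (k i i))"
    using arg_cong[OF h, of Im] by (simp add: complex_eq_iff)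
  have "0 \<le> Re (\<Sum>i\<in>{i}. \<Sum>j\<in>{i}. 1 * cnj 1 * k i j)"
    using psd_kernel_nonneg[OF k, of "{i}" "\<lambda>_. 1"] by simp
  then show "0 \<le> Re (k i i)" by simp
qed

lemma psd_kernel_zero_column:
  assumes k: "psd_kernel k" and n: "k n n = 0"
  shows "k i n = 0"
proof (rule ccontr)
  assume ne: "k i n \<noteq> 0"
  then have "i \<noteq> n" using n by auto
  \<comment> \<open>For the test vector with entries \<open>1\<close> at \<open>i\<close> and
    \<open>- r k i n\<close> at \<open>n\<close> the form is \<open>k i i - 2 r |k i n|^2\<close>,
    since the pivot contributes nothing; this \<open>r\<close> makes it negative.\<close>
  define r where "r = (Re (k i i) + 1) / (norm (k i n))\<^sup>2"
  define c where "c j = (if j = i then 1 else - of_real r * k i n)" for j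
  have ni: "k n i = cnj (k i n)" using k by (rule psd_kernel_hermitian)
  have "(\<Sum>a\<in>{i, n}. \<Sum>b\<in>{i, n}. c a * cnj (c b) * k a b) = k i i - 2 * of_real r * (k i n * cnj (k i n))"
    using \<open>i \<noteq> n\<close> by (simp add: c_def n ni algebra_simps)
  also have "\<dots> = k i i - of_real (2 * r * (norm (k i n))\<^sup>2)"
    by (simp add: complex_norm_square[symmetric])
  finally have "0 \<le> Re (k i i) - 2 * r * (norm (k i n))\<^sup>2"
    using psd_kernel_nonneg[OF k, of "{i, n}" c] by simp
  then show False using ne psd_kernel_diag(2)[OF k, of i] by (simp add: r_def)
qed

lemma schur_pivot:
  assumes k: "psd_kernel k"
  shows "schur n k i n = 0"
proof (cases "k n n = 0")
  case True
  then show ?thesis by (simp add: schur_def psd_kernel_zero_column[OF k])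
next
  case False
  have "cnj (k n n) = k n n" using psd_kernel_hermitian[OF k, of n n] by (rule sym)
  then show ?thesis using False by (simp add: schur_def)
qed

text \<open>Completing the square. In terms of vectors, the Schur complement is the Gram matrix
  after projecting away the \<open>n\<close>-th vector; its form at \<open>d\<close> is the form of
  \<open>k\<close> at \<open>d'\<close>, where \<open>t\<close> is the coefficient of that
  projection.\<close>

lemma psd_kernel_schur:
  assumes k: "psd_kernel k"
  shows "psd_kernel (schur n k)"
proof (cases "k n n = 0")
  case True
  then have "schur n k = k" by (intro ext) (simp add: schur_def)
  then show ?thesis using k by simp
next
  case False
  have h: "k i j = cnj (k j i)" for i j using k by (rule psd_kernel_hermitian)
  have nn: "cnj (k n n) = k n n" using h[of n n, symmetric] .
  have "0 \<le> Re (\<Sum>i\<in>F. \<Sum>j\<in>F. c i * cnj (c j) * schur n k i j)" if F: "finite F" for F c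
  proof -
    \<comment> \<open>The pivot is adjoined because the shifted coefficients \<open>d'\<close> may
      be nonzero at \<open>n\<close> even when \<open>n\<close> is outside \<open>F\<close>.\<close>
    define A where "A = insert n F"
    define d where "d i = (if i \<in> F then c i else 0)" for i
    define s where "s = (\<Sum>i\<in>A. d i * k i n)"
    define t where "t = s / k n n"
    define d' where "d' i = d i - (if i = n then t else 0)" for i
    have A: "finite A" "n \<in> A" "F \<subseteq> A" using F by (auto simp: A_def)
    have "(\<Sum>i\<in>F. \<Sum>j\<in>F. c i * cnj (c j) * schur n k i j) = (\<Sum>i\<in>A. \<Sum>j\<in>A. d i * cnj (d j) * schur n k i j)"
    proof (rule sum.mono_neutral_cong_left)
      show "(\<Sum>j\<in>F. c i * cnj (c j) * schur n k i j) = (\<Sum>j\<in>A. d i * cnj (d j) * schur n k i j)" if "i \<in> F" for i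
        by (rule sum.mono_neutral_cong_left) (use A that in \<open>auto simp: d_def\<close>)
    qed (use A in \<open>auto simp: d_def\<close>)
    also have "\<dots> = (\<Sum>i\<in>A. \<Sum>j\<in>A. d i * cnj (d j) * k i j) - s * cnj s / k n n"
    proof -
      have "s * cnj s / k n n = (\<Sum>i\<in>A. \<Sum>j\<in>A. d i * cnj (d j) * (k i n * cnj (k j n) / k n n))"
        unfolding s_def cnj_sum sum_product sum_divide_distrib by (intro sum.cong refl) simp
      then show ?thesis by (simp add: schur_def right_diff_distrib sum_subtractf)
    qed
    also have "\<dots> = (\<Sum>i\<in>A. \<Sum>j\<in>A. d' i * cnj (d' j) * k i j)"
    proof -
      have 1: "(\<Sum>j\<in>A. d' i * cnj (d' j) * k i j) = d' i * ((\<Sum>j\<in>A. cnj (d j) * k i j) - cnj t * k i n)" for i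
      proof -
        have "(\<Sum>j\<in>A. cnj (d' j) * k i j) = (\<Sum>j\<in>A. cnj (d j) * k i j - (if j = n then cnj t * k i j else 0))"
          by (intro sum.cong) (auto simp: d'_def algebra_simps)
        also have "\<dots> = (\<Sum>j\<in>A. cnj (d j) * k i j) - cnj t * k i n" using A by (simp add: sum_subtractf)
        finally show ?thesis by (simp add: sum_distrib_left[symmetric] mult.assoc)
      qed
      define g where "g i = (\<Sum>j\<in>A. cnj (d j) * k i j) - cnj t * k i n" for i
      have "(\<Sum>i\<in>A. \<Sum>j\<in>A. d' i * cnj (d' j) * k i j) = (\<Sum>i\<in>A. d i * g i - (if i = n then t * g i else 0))"
        unfolding 1 g_def[symmetric] by (intro sum.cong) (auto simp: d'_def algebra_simps)
      also have "\<dots> = (\<Sum>i\<in>A. d i * g i) - t * g n" using A by (simp add: sum_subtractf)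
      also have "(\<Sum>i\<in>A. d i * g i) = (\<Sum>i\<in>A. \<Sum>j\<in>A. d i * cnj (d j) * k i j) - cnj t * s"
        by (simp add: g_def s_def right_diff_distrib sum_subtractf sum_distrib_left mult_ac)
      also have "g n = cnj s - cnj t * k n n"
      proof -
        have "(\<Sum>j\<in>A. cnj (d j) * k n j) = cnj s"
          unfolding s_def cnj_sum by (intro sum.cong refl) (simp add: h[of n])
        then show ?thesis by (simp add: g_def)
      qed
      also have "cnj t * k n n = cnj s" using False by (simp add: t_def nn)
      finally show ?thesis by (simp add: t_def nn)
    qed
    finally show ?thesis using psd_kernel_nonneg[OF k A(1)] by (simp only:)
  qed
  moreover have "schur n k i j = cnj (schur n k j i)" for i j
    by (simp add: schur_def nn h[of i j] mult.commute)
  ultimately show ?thesis unfolding psd_kernel_def by blast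
qed

primrec schur_iter :: "(nat \<Rightarrow> nat \<Rightarrow> complex) \<Rightarrow> nat \<Rightarrow> nat \<Rightarrow> nat \<Rightarrow> complex" where
  "schur_iter k 0 = k"
| "schur_iter k (Suc n) = schur n (schur_iter k n)"

text \<open>Cholesky decomposition of the kernel.\<close>

lemma psd_kernel_realization:
  assumes k: "psd_kernel (k :: nat \<Rightarrow> nat \<Rightarrow> complex)"
    and "infinite_dimensional TYPE('u::chilbert_space)"
  obtains \<phi> :: "nat \<Rightarrow> 'u::chilbert_space" where "\<And>i j. cinner (\<phi> i) (\<phi> j) = k i j"
proof -
  obtain B :: "'u set" where B: "orthonormal B" "infinite B"
    using infinite_orthonormal_basis[OF assms(2)] by blast
  obtain e :: "nat \<Rightarrow> 'u" where e: "inj e" "range e \<subseteq> B"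
    using infinite_countable_subset[OF B(2)] by blast
  have ee: "cinner (e m) (e n) = (if m = n then 1 else 0)" for m n
    using B(1) e unfolding orthonormal_def inj_def by (metis rangeI subset_iff)
  let ?K = "schur_iter k"
  have psd: "psd_kernel (?K n)" for n
    by (induction n) (simp_all add: k psd_kernel_schur)
  \<comment> \<open>Step \<open>n\<close> of the elimination clears row and column \<open>n\<close>,
    and later steps keep the earlier ones zero.\<close>
  have K0: "?K m i j = 0" if "j < m" for m i j
    using that
  proof (induction m arbitrary: i j)
    case (Suc m)
    show ?case
    proof (cases "j = m")
      case True
      then show ?thesis using schur_pivot[OF psd, of m m i] by simp
    next
      case False
      then have "j < m" using Suc by simp
      then have "?K m i j = 0" "?K m m j = 0" by (rule Suc.IH)+
      moreover have "?K m j m = cnj (?K m m j)" using psd by (rule psd_kernel_hermitian)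
      ultimately show ?thesis by (simp add: schur_def)
    qed
  qed simp
  have K0': "?K m i j = 0" if "i < m" for m i j
  proof -
    have "?K m i j = cnj (?K m j i)" using psd by (rule psd_kernel_hermitian)
    then show ?thesis using K0[OF that] by simp
  qed
  define L where "L i n = ?K n i n / of_real (sqrt (Re (?K n n n)))" for i n
  \<comment> \<open>For a vanishing pivot both sides are zero by the convention for
    division.\<close>
  have LL: "L i n * cnj (L j n) = ?K n i n * cnj (?K n j n) / ?K n n n" for i j n
  proof -
    have "complex_of_real (sqrt (Re (?K n n n))) * of_real (sqrt (Re (?K n n n))) = ?K n n n"
      using psd_kernel_diag(2)[OF psd, of n n] psd_kernel_diag(1)[OF psd, of n n, symmetric]
      by (simp flip: of_real_mult)
    then show ?thesis by (simp add: L_def)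
  qed
  have dec: "k i j = (\<Sum>n<m. L i n * cnj (L j n)) + ?K m i j" for m i j
  proof (induction m)
    case (Suc m)
    then show ?case by (simp add: LL schur_def)
  qed simp
  \<comment> \<open>The sum may stop at \<open>n = i\<close>: row \<open>i\<close> of
    \<open>?K n\<close> is zero for \<open>n > i\<close>, so \<open>L\<close> is lower
    triangular.\<close>
  define \<phi> where "\<phi> i = (\<Sum>n\<le>i. cscale (L i n) (e n))" for i
  have \<phi>: "\<phi> i = (\<Sum>n<m. cscale (L i n) (e n))" if "i < m" for i m
    unfolding \<phi>_def
  proof (rule sum.mono_neutral_left)
    show "\<forall>n\<in>{..<m} - {..i}. cscale (L i n) (e n) = 0"
      using K0' by (auto simp: L_def)
  qed (use that in auto)
  have "cinner (\<phi> i) (\<phi> j) = k i j" for i j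
  proof -
    define m where "m = Suc (max i j)"
    have m: "i < m" "j < m" by (auto simp: m_def)
    have "cinner (\<phi> i) (\<phi> j) = (\<Sum>n<m. L i n * cnj (L j n))"
      unfolding \<phi>[OF m(1)] \<phi>[OF m(2)] by (rule cinner_lincomb_orthonormal) (auto simp: ee)
    then show ?thesis using dec[of i j m] K0[OF m(2)] by simp
  qed
  then show ?thesis by (rule that)
qed

section \<open>Vector states are normal\<close>

lemma quadratic_form_bound:
  assumes "bounded_clinear T"
  obtains K where "K > 0" "\<And>y. Re (cinner (T y) y) \<le> K * (norm y)\<^sup>2"
proof -
  obtain K where K: "K > 0" "\<And>x. norm (T x) \<le> K * norm x" using bcl_bound[OF assms] by blast
  have "Re (cinner (T y) y) \<le> K * (norm y)\<^sup>2" for y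
  proof -
    have "Re (cinner (T y) y) \<le> norm (T y) * norm y"
      by (rule order_trans[OF complex_Re_le_cmod cinner_Cauchy_Schwarz])
    also have "\<dots> \<le> K * norm y * norm y" by (intro mult_right_mono K) simp
    finally show ?thesis by (simp add: power2_eq_square)
  qed
  then show ?thesis using that K(1) by blast
qed

lemma loewner_leD: "loewner_le S T \<Longrightarrow> Re (cinner (S v) v) \<le> Re (cinner (T v) v)"
  by (simp add: loewner_le_def positive_op_def cinner_diff_left)

lemma bcl_rank_one: "bounded_clinear (\<lambda>v. cscale (cinner v \<eta>) (\<eta>::'u::chilbert_space))"
proof (rule bounded_clinearI[where K="norm \<eta> * norm \<eta>"])
  fix v
  show "norm (cscale (cinner v \<eta>) \<eta>) \<le> norm v * (norm \<eta> * norm \<eta>)"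
    using mult_right_mono[OF cinner_Cauchy_Schwarz[of v \<eta>], of "norm \<eta>"]
    by (simp add: norm_cscale mult.assoc)
qed (simp_all add: cinner_simps cscale_add_left cscale_cscale)

text \<open>If the supremum \<open>S\<close> of the values were smaller than the value at \<open>T0\<close>, then, with \<open>\<eta>\<close> the limit
  of \<open>(T0 - T) \<xi>\<close> along the family and \<open>s\<close> the gap, subtracting the rank-one operator
  \<open>|\<eta>\<rangle>\<langle>\<eta>| / s\<close> from \<open>T0\<close> would give a smaller upper bound.\<close>

lemma vector_functional_sup:
  fixes \<xi> :: "'u::chilbert_space"
  assumes H: "closed_csubspace H" and \<xi>: "\<xi> \<in> H"
    and ne: "\<T> \<noteq> {}" and \<T>: "\<And>T. T \<in> \<T> \<Longrightarrow> in_B H H T" "\<And>T. T \<in> \<T> \<Longrightarrow> positive_op T"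
    and dir: "\<And>S T. S \<in> \<T> \<Longrightarrow> T \<in> \<T> \<Longrightarrow> \<exists>R\<in>\<T>. loewner_le S R \<and> loewner_le T R"
    and T0: "in_B H H T0" "\<And>T. T \<in> \<T> \<Longrightarrow> loewner_le T T0"
    and least: "\<And>B. in_B H H B \<Longrightarrow> (\<And>T. T \<in> \<T> \<Longrightarrow> loewner_le T B) \<Longrightarrow> loewner_le T0 B"
  shows "Re (cinner (T0 \<xi>) \<xi>) = (SUP T\<in>\<T>. Re (cinner (T \<xi>) \<xi>))"
proof -
  define S where "S = (SUP T\<in>\<T>. Re (cinner (T \<xi>) \<xi>))"
  define s where "s = Re (cinner (T0 \<xi>) \<xi>) - S"
  have bdd: "bdd_above ((\<lambda>T. Re (cinner (T \<xi>) \<xi>)) ` \<T>)"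
    by (rule bdd_aboveI[of _ "Re (cinner (T0 \<xi>) \<xi>)"]) (use loewner_leD[OF T0(2)] in auto)
  have le_S: "Re (cinner (T \<xi>) \<xi>) \<le> S" if "T \<in> \<T>" for T
    unfolding S_def by (rule cSUP_upper[OF that bdd])
  have S_le: "S \<le> Re (cinner (T0 \<xi>) \<xi>)"
    unfolding S_def by (rule cSUP_least[OF ne]) (rule loewner_leD[OF T0(2)])
  have bT: "bounded_clinear T" if "T \<in> \<T>" for T using in_B_bcl[OF \<T>(1)[OF that]] .
  have bT0: "bounded_clinear T0" by (rule in_B_bcl[OF T0(1)])
  have "\<not> s > 0"
  proof
    assume s: "s > 0"
    obtain K where K: "K > 0" "\<And>y. Re (cinner (T0 y) y) \<le> K * (norm y)\<^sup>2"
      using quadratic_form_bound[OF bT0] by blast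
    have "\<exists>T\<in>\<T>. S - 1 / real (Suc n) < Re (cinner (T \<xi>) \<xi>)" for n
      using less_cSUP_iff[OF ne bdd, of "S - 1 / real (Suc n)"] by (simp add: S_def)
    then obtain T where T: "\<And>n. T n \<in> \<T>" "\<And>n. S - 1 / real (Suc n) < Re (cinner (T n \<xi>) \<xi>)"
      by metis
    \<comment> \<open>In the Loewner order \<open>0 \<le> R - T n \<le> T0 \<le> K\<close>, and the
      value of \<open>R - T n\<close> at \<open>\<xi>\<close> is below
      \<open>1 / (n + 1)\<close>.\<close>
    have near: "norm (R \<xi> - T n \<xi>) \<le> sqrt (K / real (Suc n))" if R: "R \<in> \<T>" "loewner_le (T n) R" for R n
    proof -
      have "(norm (R \<xi> - T n \<xi>))\<^sup>2 \<le> K * Re (cinner (R \<xi> - T n \<xi>) \<xi>)"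
      proof (rule positive_op_norm_sq_le)
        show "bounded_clinear (\<lambda>v. R v - T n v)" by (intro bcl_minus_fun bT R T)
        show "positive_op (\<lambda>v. R v - T n v)" using R(2) by (simp add: loewner_le_def)
        show "Re (cinner (R y - T n y) y) \<le> K * (norm y)\<^sup>2" for y
          using loewner_leD[OF T0(2)[OF R(1)], of y] positive_op_Re[OF \<T>(2)[OF T(1)[of n]], of y] K(2)[of y]
          by (simp add: cinner_diff_left)
      qed
      also have "\<dots> \<le> K * (1 / real (Suc n))"
        using le_S[OF R(1)] T(2)[of n] K(1) by (intro mult_left_mono) (auto simp: cinner_diff_left)
      finally show ?thesis using real_le_rsqrt by simp
    qed
    have sq0: "(\<lambda>n. sqrt (K / real (Suc n))) \<longlonglongrightarrow> 0"
    proof -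
      have "(\<lambda>n. sqrt (K * (1 / real (Suc n)))) \<longlonglongrightarrow> sqrt (K * 0)"
        using LIMSEQ_inverse_real_of_nat by (intro tendsto_intros) (simp add: inverse_eq_divide)
      then show ?thesis by simp
    qed
    \<comment> \<open>The chosen \<open>T n\<close> need not increase; two of them are compared
      through a common upper bound \<open>R\<close> from the directed family.\<close>
    have "Cauchy (\<lambda>n. T n \<xi>)"
    proof (rule metric_CauchyI)
      fix e :: real assume e: "e > 0"
      obtain N where N: "\<And>n. n \<ge> N \<Longrightarrow> sqrt (K / real (Suc n)) < e / 2"
        using order_tendstoD(2)[OF sq0, of "e / 2"] e by (auto simp: eventually_sequentially)
      have "dist (T m \<xi>) (T n \<xi>) < e" if "m \<ge> N" "n \<ge> N" for m n
      proof -
        obtain R where R: "R \<in> \<T>" "loewner_le (T m) R" "loewner_le (T n) R" using dir[OF T(1) T(1)] by blast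
        have "dist (T m \<xi>) (T n \<xi>) \<le> norm (R \<xi> - T m \<xi>) + norm (R \<xi> - T n \<xi>)"
          using dist_triangle2[of "T m \<xi>" "T n \<xi>" "R \<xi>"] by (simp add: dist_norm norm_minus_commute)
        then show ?thesis using near[OF R(1,2)] near[OF R(1,3)] N[OF that(1)] N[OF that(2)] by linarith
      qed
      then show "\<exists>M. \<forall>m\<ge>M. \<forall>n\<ge>M. dist (T m \<xi>) (T n \<xi>) < e" by blast
    qed
    then obtain \<zeta> where \<zeta>: "(\<lambda>n. T n \<xi>) \<longlonglongrightarrow> \<zeta>" using Cauchy_convergent convergent_def by blast
    define \<eta> where "\<eta> = T0 \<xi> - \<zeta>"
    have \<eta>_lim: "(\<lambda>n. T0 \<xi> - T n \<xi>) \<longlonglongrightarrow> \<eta>" unfolding \<eta>_def by (intro tendsto_intros \<zeta>)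
    have "\<eta> \<in> H"
      by (rule closed_sequentially[OF csubspace_closed[OF H] _ \<eta>_lim])
         (intro csubspace_diff[OF H] in_B_range[OF T0(1)] in_B_range[OF \<T>(1)[OF T(1)]])
    have inv0: "(\<lambda>n. 1 / real (Suc n)) \<longlonglongrightarrow> 0"
      using LIMSEQ_inverse_real_of_nat by (simp add: inverse_eq_divide)
    have "(\<lambda>n. Re (cinner (T0 \<xi> - T n \<xi>) \<xi>)) \<longlonglongrightarrow> s"
    proof (rule tendsto_sandwich[of "\<lambda>_. s" _ _ "\<lambda>n. s + 1 / real (Suc n)"])
      show "\<forall>\<^sub>F n in sequentially. s \<le> Re (cinner (T0 \<xi> - T n \<xi>) \<xi>)"
        using le_S[OF T(1)] by (simp add: s_def cinner_diff_left)
      show "\<forall>\<^sub>F n in sequentially. Re (cinner (T0 \<xi> - T n \<xi>) \<xi>) \<le> s + 1 / real (Suc n)"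
      proof (rule always_eventually, rule allI)
        fix n show "Re (cinner (T0 \<xi> - T n \<xi>) \<xi>) \<le> s + 1 / real (Suc n)"
          using T(2)[of n] unfolding s_def cinner_diff_left minus_complex.simps by linarith
      qed
      show "(\<lambda>n. s + 1 / real (Suc n)) \<longlonglongrightarrow> s" using tendsto_add[OF tendsto_const inv0] by simp
    qed simp
    moreover have "(\<lambda>n. Re (cinner (T0 \<xi> - T n \<xi>) \<xi>)) \<longlonglongrightarrow> Re (cinner \<eta> \<xi>)"
      by (intro tendsto_intros \<eta>_lim)
    ultimately have \<eta>\<xi>: "Re (cinner \<eta> \<xi>) = s" using LIMSEQ_unique by blast
    \<comment> \<open>In operator form: the unnormalized rank-one operator of \<eta> is at most
      \<open>s (T0 - A)\<close>. This is the limit of Cauchy--Schwarz for \<open>T0 - R n\<close>,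
      where \<open>R n\<close> dominates both \<open>A\<close> and \<open>T n\<close>.\<close>
    have key: "(norm (cinner \<eta> v))\<^sup>2 \<le> s * Re (cinner (T0 v - A v) v)" if A: "A \<in> \<T>" for A v
    proof -
      have "\<forall>n. \<exists>R. R \<in> \<T> \<and> loewner_le A R \<and> loewner_le (T n) R" using dir[OF A T(1)] by blast
      then obtain R where R: "\<And>n. R n \<in> \<T>" "\<And>n. loewner_le A (R n)" "\<And>n. loewner_le (T n) (R n)" by metis
      have "(\<lambda>n. R n \<xi> - T n \<xi>) \<longlonglongrightarrow> 0"
        by (rule Lim_null_comparison[OF _ sq0]) (use near[OF R(1) R(3)] in auto)
      from tendsto_diff[OF \<eta>_lim this] have Rl: "(\<lambda>n. T0 \<xi> - R n \<xi>) \<longlonglongrightarrow> \<eta>" by simp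
      have "(\<lambda>n. (norm (cinner (T0 \<xi> - R n \<xi>) v))\<^sup>2) \<longlonglongrightarrow> (norm (cinner \<eta> v))\<^sup>2"
        by (intro tendsto_intros Rl)
      moreover have "(\<lambda>n. (s + 1 / real (Suc n)) * Re (cinner (T0 v - A v) v))
          \<longlonglongrightarrow> (s + 0) * Re (cinner (T0 v - A v) v)"
        by (intro tendsto_intros inv0)
      moreover have "(norm (cinner (T0 \<xi> - R n \<xi>) v))\<^sup>2 \<le> (s + 1 / real (Suc n)) * Re (cinner (T0 v - A v) v)" for n
      proof -
        have p: "positive_op (\<lambda>v. T0 v - R n v)" using T0(2)[OF R(1)] by (simp add: loewner_le_def)
        have "(norm (cinner (T0 \<xi> - R n \<xi>) v))\<^sup>2
            \<le> Re (cinner (T0 \<xi> - R n \<xi>) \<xi>) * Re (cinner (T0 v - R n v) v)"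
          by (rule positive_op_Cauchy_Schwarz[OF bcl_minus_fun[OF bT0 bT[OF R(1)]] p])
        also have "\<dots> \<le> (s + 1 / real (Suc n)) * Re (cinner (T0 v - A v) v)"
        proof (rule mult_mono)
          show "Re (cinner (T0 \<xi> - R n \<xi>) \<xi>) \<le> s + 1 / real (Suc n)"
            using loewner_leD[OF R(3)[of n], of \<xi>] T(2)[of n] unfolding s_def cinner_diff_left minus_complex.simps
            by linarith
          show "Re (cinner (T0 v - R n v) v) \<le> Re (cinner (T0 v - A v) v)"
            using loewner_leD[OF R(2)[of n], of v] by (simp add: cinner_diff_left)
          show "0 \<le> Re (cinner (T0 v - R n v) v)" using positive_op_Re[OF p] .
        qed (use s in auto)
        finally show ?thesis .
      qed
      ultimately show ?thesis by (intro LIMSEQ_le[of "\<lambda>n. (norm (cinner (T0 \<xi> - R n \<xi>) v))\<^sup>2"]) auto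
    qed
    define B where "B v = T0 v - (1 / s) *\<^sub>R cscale (cinner v \<eta>) \<eta>" for v
    have B_form: "cinner (B v) v = cinner (T0 v) v - of_real ((norm (cinner \<eta> v))\<^sup>2 / s)" for v
    proof -
      have "cinner v \<eta> * cinner \<eta> v = of_real ((norm (cinner \<eta> v))\<^sup>2)"
        by (subst cinner_commute) (simp add: complex_norm_square mult.commute del: of_real_power)
      then show ?thesis by (simp add: B_def cinner_diff_left cinner_scaleR_left cinner_cscale_left)
    qed
    have "in_B H H B"
      unfolding in_B_def
    proof (intro conjI allI impI)
      show "bounded_clinear B" unfolding B_def by (intro bcl_minus_fun bT0 bcl_scaleR_fun bcl_rank_one)
      show "B v = 0" if "orth v H" for v
        using that \<open>\<eta> \<in> H\<close> in_B_orth[OF T0(1) that] by (simp add: B_def orth_def)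
      show "B v \<in> H" for v
        unfolding B_def scaleR_cscale
        by (intro csubspace_diff[OF H] csubspace_cscale[OF H] in_B_range[OF T0(1)] \<open>\<eta> \<in> H\<close>)
    qed
    moreover have "loewner_le A B" if A: "A \<in> \<T>" for A
      unfolding loewner_le_def positive_op_def
    proof (intro allI conjI)
      fix v
      have p: "positive_op (\<lambda>v. T0 v - A v)" using T0(2)[OF A] by (simp add: loewner_le_def)
      have eq: "cinner (B v - A v) v = cinner (T0 v - A v) v - of_real ((norm (cinner \<eta> v))\<^sup>2 / s)"
        by (simp add: cinner_diff_left B_form)
      show "Im (cinner (B v - A v) v) = 0" unfolding eq using p by (simp add: positive_op_def)
      show "0 \<le> Re (cinner (B v - A v) v)" unfolding eq using key[OF A, of v] s
        by (simp add: field_simps)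
    qed
    ultimately have "loewner_le T0 B" by (rule least)
    \<comment> \<open>The subtracted rank-one term would have to vanish at \<open>\<xi>\<close>,
      although \<open>cinner \<eta> \<xi>\<close> has real part \<open>s > 0\<close>.\<close>
    from loewner_leD[OF this, of \<xi>] have "(norm (cinner \<eta> \<xi>))\<^sup>2 / s \<le> 0" by (simp add: B_form)
    then have "cinner \<eta> \<xi> = 0" using s by (simp add: field_simps)
    then show False using \<eta>\<xi> s by simp
  qed
  then show ?thesis using S_le by (simp add: s_def S_def)
qed

lemma normal_state_vector:
  assumes H: "closed_csubspace H" and \<xi>: "\<xi> \<in> H" "norm \<xi> = 1"
  shows "normal_state H (\<lambda>T. cinner (T \<xi>) \<xi>)"
  unfolding normal_state_def
proof (intro conjI allI impI)
  show "cinner (proj H \<xi>) \<xi> = 1" using \<xi> by (simp add: proj_id H cinner_self)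
  fix \<T> T0
  assume "\<T> \<noteq> {}" "\<forall>T\<in>\<T>. in_B H H T \<and> positive_op T"
    "\<forall>S\<in>\<T>. \<forall>T\<in>\<T>. \<exists>R\<in>\<T>. loewner_le S R \<and> loewner_le T R"
    "in_B H H T0" "\<forall>T\<in>\<T>. loewner_le T T0"
    "\<forall>B. in_B H H B \<longrightarrow> (\<forall>T\<in>\<T>. loewner_le T B) \<longrightarrow> loewner_le T0 B"
  then show "Re (cinner (T0 \<xi>) \<xi>) = (SUP T\<in>\<T>. Re (cinner (T \<xi>) \<xi>))"
    by (intro vector_functional_sup[OF H \<xi>(1)]) blast+
qed (simp_all add: cinner_add_left cinner_cscale_left positive_op_def)

section \<open>Block operators\<close>

text \<open>The vectors range over the ambient space, which gives positivity of the block operator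
  without inserting projections; for operators on \<open>H\<close>, \<open>positive_matrixI\<close>
  reduces the test to vectors of \<open>H\<close>.\<close>

definition positive_matrix :: "('i::finite \<Rightarrow> 'i \<Rightarrow> 'u::chilbert_space \<Rightarrow> 'u) \<Rightarrow> bool" where
  "positive_matrix T \<longleftrightarrow> (\<forall>h.
     Im (\<Sum>i\<in>UNIV. \<Sum>j\<in>UNIV. cinner (T i j (h j)) (h i)) = 0 \<and>
     0 \<le> Re (\<Sum>i\<in>UNIV. \<Sum>j\<in>UNIV. cinner (T i j (h j)) (h i)))"

lemma positive_matrixI:
  assumes H: "closed_csubspace H" and T: "\<And>i j. in_B H H (T i j)"
    and pos: "\<And>h. (\<And>i. h i \<in> H) \<Longrightarrow>
      Im (\<Sum>i\<in>UNIV. \<Sum>j\<in>UNIV. cinner (T i j (h j)) (h i)) = 0 \<and>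
      0 \<le> Re (\<Sum>i\<in>UNIV. \<Sum>j\<in>UNIV. cinner (T i j (h j)) (h i))"
  shows "positive_matrix T"
  unfolding positive_matrix_def
proof
  fix h
  have "cinner (T i j (proj H (h j))) (proj H (h i)) = cinner (T i j (h j)) (h i)" for i j
    by (simp add: in_B_proj_right[OF T H] cinner_proj_right[OF H in_B_range[OF T]])
  then show "Im (\<Sum>i\<in>UNIV. \<Sum>j\<in>UNIV. cinner (T i j (h j)) (h i)) = 0 \<and>
      0 \<le> Re (\<Sum>i\<in>UNIV. \<Sum>j\<in>UNIV. cinner (T i j (h j)) (h i))"
    using pos[of "\<lambda>i. proj H (h i)"] proj_in[OF H] by simp
qed

text \<open>The \<open>J i\<close> are coordinate embeddings of a direct sum of copies of the
  ambient space into itself. Their ranges need not fill the space; \<open>blockop\<close> and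
  \<open>diagop\<close> vanish on the orthogonal complement of the ranges when their entries are
  linear.\<close>

locale isometry_family =
  fixes J :: "'i::finite \<Rightarrow> 'u::chilbert_space \<Rightarrow> 'u"
  assumes bcl_J: "bounded_clinear (J i)"
    and adj_J_J: "adj (J i) (J j x) = (if i = j then x else 0)"
begin

definition blockop :: "('i \<Rightarrow> 'i \<Rightarrow> 'u \<Rightarrow> 'u) \<Rightarrow> 'u \<Rightarrow> 'u" where
  "blockop T x = (\<Sum>i\<in>UNIV. \<Sum>j\<in>UNIV. J i (T i j (adj (J j) x)))"

text \<open>The amplification of \<open>D\<close>: in coordinates, \<open>D\<close> tensored with
  the identity matrix.\<close>

definition diagop :: "('u \<Rightarrow> 'u) \<Rightarrow> 'u \<Rightarrow> 'u" where
  "diagop D x = (\<Sum>i\<in>UNIV. J i (D (adj (J i) x)))"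

lemma bcl_adj_J: "bounded_clinear (adj (J i))"
  by (rule bcl_adj[OF bcl_J])

lemma bcl_blockop: "(\<And>i j. bounded_clinear (T i j)) \<Longrightarrow> bounded_clinear (blockop T)"
  unfolding blockop_def by (intro bcl_sum_fun bcl_compose[OF bcl_J] bcl_compose[OF _ bcl_adj_J])

lemma bcl_diagop: "bounded_clinear D \<Longrightarrow> bounded_clinear (diagop D)"
  unfolding diagop_def by (intro bcl_sum_fun bcl_compose[OF bcl_J] bcl_compose[OF _ bcl_adj_J])

lemma adj_J_sum_J: "adj (J i) (\<Sum>j\<in>UNIV. J j (f j)) = f i"
  by (simp add: bcl_sum[OF bcl_adj_J] adj_J_J)

lemma adj_J_blockop: "adj (J i) (blockop T x) = (\<Sum>j\<in>UNIV. T i j (adj (J j) x))"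
  unfolding blockop_def bcl_sum[OF bcl_J, symmetric] adj_J_sum_J ..

lemma adj_J_diagop: "adj (J i) (diagop D x) = D (adj (J i) x)"
  unfolding diagop_def adj_J_sum_J ..

lemma blockop_J:
  assumes "\<And>i j. bounded_clinear (T i j)"
  shows "blockop T (J j x) = (\<Sum>i\<in>UNIV. J i (T i j x))"
proof -
  have "T i k (adj (J k) (J j x)) = (if k = j then T i k x else 0)" for i k
    using assms by (simp add: adj_J_J bcl_zero)
  then show ?thesis unfolding blockop_def bcl_sum[OF bcl_J, symmetric] by simp
qed

lemma diagop_J: "bounded_clinear D \<Longrightarrow> diagop D (J j x) = J j (D x)"
proof -
  assume D: "bounded_clinear D"
  have "J i (D (adj (J i) (J j x))) = (if i = j then J i (D x) else 0)" for i
    using D bcl_J by (simp add: adj_J_J bcl_zero)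
  then show ?thesis unfolding diagop_def by simp
qed

lemma blockop_diagop_commute:
  assumes T: "\<And>i j. bounded_clinear (T i j)" and D: "bounded_clinear D"
    and c: "\<And>i j x. D (T i j x) = T i j (D x)"
  shows "diagop D (blockop T x) = blockop T (diagop D x)"
proof -
  have "diagop D (blockop T x) = (\<Sum>i\<in>UNIV. \<Sum>j\<in>UNIV. J i (D (T i j (adj (J j) x))))"
    unfolding diagop_def adj_J_blockop by (simp add: bcl_sum D bcl_J)
  also have "\<dots> = blockop T (diagop D x)"
    unfolding blockop_def adj_J_diagop c ..
  finally show ?thesis .
qed

lemma cinner_blockop:
  "cinner (blockop T x) y = (\<Sum>i\<in>UNIV. \<Sum>j\<in>UNIV. cinner (T i j (adj (J j) x)) (adj (J i) y))"
  unfolding blockop_def by (simp add: cinner_sum_left cinner_adj_right bcl_J)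

lemma cinner_diagop: "cinner (diagop D x) y = (\<Sum>i\<in>UNIV. cinner (D (adj (J i) x)) (adj (J i) y))"
  unfolding diagop_def by (simp add: cinner_sum_left cinner_adj_right bcl_J)

lemma positive_op_blockop: "positive_matrix T \<Longrightarrow> positive_op (blockop T)"
  unfolding positive_op_def cinner_blockop
  by (rule allI) (rule positive_matrix_def[THEN iffD1, THEN spec])

end

lemma infinite_dimensional_isometry_family:
  assumes "infinite_dimensional TYPE('u::chilbert_space)"
  obtains J :: "'i::finite \<Rightarrow> 'u::chilbert_space \<Rightarrow> 'u" where "isometry_family J"
  using orthogonal_isometries[OF assms] unfolding isometry_family_def by metis

section \<open>Stochastic operator matrices and block isometries\<close>

definition pair_matrix :: "('x \<Rightarrow> 'x \<Rightarrow> 'a \<Rightarrow> 'a \<Rightarrow> 'c) \<Rightarrow> 'x \<times> 'a \<Rightarrow> 'x \<times> 'a \<Rightarrow> 'c" where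
  "pair_matrix E p q = E (fst p) (fst q) (snd p) (snd q)"

lemma stochastic_op_matrix_iff:
  assumes H: "closed_csubspace H"
  shows "stochastic_op_matrix H E \<longleftrightarrow> (\<forall>x x' a a'. in_B H H (E x x' a a')) \<and>
    positive_matrix (pair_matrix E) \<and>
    (\<forall>x x' v. (\<Sum>a\<in>UNIV. E x x' a a v) = (if x = x' then proj H v else 0))"
proof -
  have "(\<forall>h. (\<forall>i. h i \<in> H) \<longrightarrow>
          (let s = (\<Sum>(x,a)\<in>UNIV. \<Sum>(x',a')\<in>UNIV. cinner (E x x' a a' (h (x',a'))) (h (x,a)))
           in Im s = 0 \<and> 0 \<le> Re s)) \<longleftrightarrow> positive_matrix (pair_matrix E)"
    if B: "\<forall>x x' a a'. in_B H H (E x x' a a')"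
  proof
    assume L: "\<forall>h. (\<forall>i. h i \<in> H) \<longrightarrow>
          (let s = (\<Sum>(x,a)\<in>UNIV. \<Sum>(x',a')\<in>UNIV. cinner (E x x' a a' (h (x',a'))) (h (x,a)))
           in Im s = 0 \<and> 0 \<le> Re s)"
    show "positive_matrix (pair_matrix E)"
      by (rule positive_matrixI[OF H])
         (use B L in \<open>simp_all add: pair_matrix_def Let_def case_prod_beta\<close>)
  next
    assume "positive_matrix (pair_matrix E)"
    then show "\<forall>h. (\<forall>i. h i \<in> H) \<longrightarrow>
          (let s = (\<Sum>(x,a)\<in>UNIV. \<Sum>(x',a')\<in>UNIV. cinner (E x x' a a' (h (x',a'))) (h (x,a)))
           in Im s = 0 \<and> 0 \<le> Re s)"
      by (simp add: positive_matrix_def pair_matrix_def Let_def case_prod_beta)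
  qed
  then show ?thesis unfolding stochastic_op_matrix_def by (auto simp: fun_eq_iff)
qed

lemma block_isometryI:
  fixes V :: "'b::finite \<Rightarrow> 'y::finite \<Rightarrow> 'u::chilbert_space \<Rightarrow> 'u"
  assumes H: "closed_csubspace H" and V: "\<And>b y. in_B H K (V b y)"
    and VV: "\<And>y y' v. (\<Sum>b\<in>UNIV. adj (V b y) (V b y' v)) = (if y = y' then proj H v else 0)"
  shows "block_isometry H K V"
  unfolding block_isometry_def
proof (intro conjI allI impI V)
  fix k :: "'y \<Rightarrow> 'u" assume k: "\<forall>y. k y \<in> H"
  have "complex_of_real (\<Sum>b\<in>UNIV. (norm (\<Sum>y\<in>UNIV. V b y (k y)))\<^sup>2)
      = (\<Sum>b\<in>UNIV. \<Sum>y\<in>UNIV. \<Sum>y'\<in>UNIV. cinner (adj (V b y') (V b y (k y))) (k y'))"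
    by (simp add: cinner_self[symmetric] cinner_sum_left cinner_sum_right
        cinner_adj_left[OF in_B_bcl[OF V]] del: of_real_power)
       (rule sum.cong[OF refl], rule sum.swap)
  also have "\<dots> = (\<Sum>y\<in>UNIV. \<Sum>y'\<in>UNIV. \<Sum>b\<in>UNIV. cinner (adj (V b y') (V b y (k y))) (k y'))"
    by (subst sum.swap, intro sum.cong refl, rule sum.swap)
  also have "\<dots> = (\<Sum>y\<in>UNIV. \<Sum>y'\<in>UNIV. if y' = y then cinner (k y) (k y) else 0)"
    using k by (intro sum.cong refl) (simp add: cinner_sum_left[symmetric] VV proj_id H)
  also have "\<dots> = complex_of_real (\<Sum>y\<in>UNIV. (norm (k y))\<^sup>2)" by (simp add: cinner_self)
  finally show "(\<Sum>b\<in>UNIV. (norm (\<Sum>y\<in>UNIV. V b y (k y)))\<^sup>2) = (\<Sum>y\<in>UNIV. (norm (k y))\<^sup>2)"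
    by (simp only: of_real_eq_iff)
qed

lemma block_isometry_in_B: "block_isometry H K V \<Longrightarrow> in_B H K (V b y)"
  by (simp add: block_isometry_def)

text \<open>Polarization: the norm identity at \<open>k + l\<close> and at \<open>k + \<i> l\<close>
  yields the identity of inner products, which is then tested on families supported at one
  index.\<close>

lemma block_isometry_sum:
  fixes V :: "'b::finite \<Rightarrow> 'y::finite \<Rightarrow> 'u::chilbert_space \<Rightarrow> 'u"
  assumes H: "closed_csubspace H" and V: "block_isometry H K V"
  shows "(\<Sum>b\<in>UNIV. adj (V b y) (V b y' v)) = (if y = y' then proj H v else 0)"
proof -
  have B: "bounded_clinear (V b y)" for b y by (rule in_B_bcl[OF block_isometry_in_B[OF V]])
  define W where "W k b = (\<Sum>y\<in>UNIV. V b y (k y))" for k :: "'y \<Rightarrow> 'u" and b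
  have iso: "(\<Sum>b\<in>UNIV. (norm (W k b))\<^sup>2) = (\<Sum>y\<in>UNIV. (norm (k y))\<^sup>2)" if "\<And>y. k y \<in> H" for k
    using V that by (simp add: block_isometry_def W_def)
  have W_add: "W (\<lambda>y. k y + l y) b = W k b + W l b" for k l b
    by (simp add: W_def bcl_add[OF B] sum.distrib)
  have re: "(\<Sum>b\<in>UNIV. Re (cinner (W k b) (W l b))) = (\<Sum>y\<in>UNIV. Re (cinner (k y) (l y)))"
    if "\<And>y. k y \<in> H" "\<And>y. l y \<in> H" for k l
    using iso[of "\<lambda>y. k y + l y"] iso[of k] iso[of l] that csubspace_add[OF H]
    by (simp add: W_add norm_add_sq sum.distrib sum_distrib_left[symmetric])
  have W_i: "W (\<lambda>y. cscale \<i> (k y)) b = cscale \<i> (W k b)" for k b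
    by (simp add: W_def bcl_cscale[OF B] cscale_sum_right)
  have polar: "(\<Sum>b\<in>UNIV. cinner (W k b) (W l b)) = (\<Sum>y\<in>UNIV. cinner (k y) (l y))"
    if k: "\<And>y. k y \<in> H" and l: "\<And>y. l y \<in> H" for k l
    using re[OF k l] re[of k "\<lambda>y. cscale \<i> (l y)"] k l csubspace_cscale[OF H]
    by (simp add: complex_eq_iff W_i cinner_cscale_right)
  show ?thesis
  proof (rule cinner_ext_left)
    fix w
    define k where "k z = (if z = y' then proj H v else 0)" for z
    define l where "l z = (if z = y then proj H w else 0)" for z
    have kl: "k z \<in> H" "l z \<in> H" for z by (simp_all add: k_def l_def proj_in H csubspace_0)
    have "V b z (k z) = (if z = y' then V b z v else 0)" "V b z (l z) = (if z = y then V b z w else 0)" for b z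
      using in_B_proj_right[OF block_isometry_in_B[OF V] H] by (simp_all add: k_def l_def bcl_zero[OF B])
    then have "W k b = V b y' v" "W l b = V b y w" for b by (simp_all add: W_def)
    then have "cinner (\<Sum>b\<in>UNIV. adj (V b y) (V b y' v)) w = (\<Sum>z\<in>UNIV. cinner (k z) (l z))"
      using polar[of k l, OF kl] by (simp add: cinner_sum_left cinner_adj_left B)
    also have "\<dots> = (\<Sum>z\<in>UNIV. if z = y then cinner (k y) (proj H w) else 0)"
      by (intro sum.cong) (auto simp: l_def)
    also have "\<dots> = cinner (if y = y' then proj H v else 0) w"
      by (simp add: k_def cinner_proj_right H proj_in)
    finally show "cinner (\<Sum>b\<in>UNIV. adj (V b y) (V b y' v)) w = cinner (if y = y' then proj H v else 0) w" .
  qed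
qed

lemma Gamma_W_eq_Gamma_Q:
  assumes "\<And>a b x y a' b' x' y'. \<sigma> (adj (W (a, b) (x, y)) \<circ> W (a', b') (x', y'))
    = cinner (E x x' a a' (F y y' b b' \<xi>)) \<xi>"
  shows "Gamma_W W \<sigma> = Gamma_Q E F \<xi>"
proof -
  have "\<sigma> (adj (W r c) \<circ> W r' c')
      = cinner (E (fst c) (fst c') (fst r) (fst r') (F (snd c) (snd c') (snd r) (snd r') \<xi>)) \<xi>" for r c r' c'
    using assms[of "fst r" "snd r" "fst c" "snd c" "fst r'" "snd r'" "fst c'" "snd c'"] by simp
  then show ?thesis by (intro ext) (simp add: Gamma_W_def Gamma_Q_def case_prod_beta)
qed

section \<open>Factorization by square roots, amplification\<close>

context isometry_family
begin

text \<open>As \<open>R\<close> is self-adjoint, \<open>adj (R J i) (R J j)\<close> is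
  \<open>adj (J i) R^2 (J j)\<close>, the entry of \<open>blockop T\<close> at
  \<open>(i, j)\<close>. The factor \<open>proj H\<close> makes the columns vanish on the orthogonal
  complement of \<open>H\<close>.\<close>

lemma sqrt_factorization:
  assumes H: "closed_csubspace H" and T: "\<And>i j. in_B H H (T i j)"
    and R: "bounded_clinear R" "\<And>x y. cinner (R x) y = cinner x (R y)" "\<And>x. R (R x) = blockop T x"
  shows "bounded_clinear (\<lambda>v. R (J i (proj H v)))"
    and "adj (\<lambda>v. R (J i (proj H v))) = (\<lambda>w. proj H (adj (J i) (R w)))"
    and "adj (\<lambda>v. R (J i (proj H v))) (R (J j (proj H v))) = T i j v"
proof -
  show "bounded_clinear (\<lambda>v. R (J i (proj H v)))"
    by (intro bcl_compose[OF R(1)] bcl_compose[OF bcl_J] bcl_proj H)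
  then show adj: "adj (\<lambda>v. R (J i (proj H v))) = (\<lambda>w. proj H (adj (J i) (R w)))"
    by (rule adj_eqI) (simp add: R(2) proj_selfadj[OF H, symmetric] cinner_adj_right bcl_J)
  have "adj (J i) (blockop T (J j (proj H v))) = T i j (proj H v)"
    by (simp add: blockop_J in_B_bcl[OF T] adj_J_sum_J)
  then show "adj (\<lambda>v. R (J i (proj H v))) (R (J j (proj H v))) = T i j v"
    by (simp add: adj R(3) in_B_proj_left[OF T H] in_B_proj_right[OF T H])
qed

text \<open>\<open>H\<close> tensored with a finite-dimensional space, that is, the sum of the
  images of \<open>H\<close> under the \<open>J i\<close>. Written as the fixed points of a bounded
  operator, it is visibly closed.\<close>

definition amplification :: "'u set \<Rightarrow> 'u set" where
  "amplification H = {v. diagop (proj H) v = v}"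

lemma diagop_diagop:
  assumes "bounded_clinear D" "bounded_clinear D'"
  shows "diagop D (diagop D' v) = diagop (\<lambda>x. D (D' x)) v"
  unfolding diagop_def[of D] adj_J_diagop by (simp add: diagop_def)

lemma closed_csubspace_amplification:
  assumes H: "closed_csubspace H"
  shows "closed_csubspace (amplification H)"
proof -
  have b: "bounded_clinear (diagop (proj H))" by (rule bcl_diagop[OF bcl_proj[OF H]])
  have "closed (amplification H)"
    unfolding amplification_def
    by (intro closed_Collect_eq linear_continuous_on bcl_bounded_linear b continuous_on_id)
  then show ?thesis by (auto simp: closed_csubspace_def amplification_def bcl_simps b)
qed

lemma proj_amplification:
  assumes H: "closed_csubspace H"
  shows "proj (amplification H) v = diagop (proj H) v"
proof (rule proj_unique[OF closed_csubspace_amplification[OF H]])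
  show "diagop (proj H) v \<in> amplification H"
    by (simp add: amplification_def diagop_diagop bcl_proj H proj_id proj_in)
  have sa: "cinner (diagop (proj H) x) y = cinner x (diagop (proj H) y)" for x y
  proof -
    have "cinner x (diagop (proj H) y) = cnj (cinner (diagop (proj H) y) x)" by (rule cinner_commute)
    also have "\<dots> = (\<Sum>i\<in>UNIV. cinner (adj (J i) x) (proj H (adj (J i) y)))"
      by (simp add: cinner_diagop cinner_commute[of "adj _ x"])
    finally show ?thesis by (simp add: cinner_diagop proj_selfadj[OF H])
  qed
  show "orth (v - diagop (proj H) v) (amplification H)"
    by (simp add: orth_def amplification_def cinner_diff_left sa)
qed

lemma in_B_diagop:
  assumes H: "closed_csubspace H" and D: "in_B H H D"
  shows "in_B (amplification H) (amplification H) (diagop D)"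
proof (rule in_BI[OF closed_csubspace_amplification[OF H]])
  show "bounded_clinear (diagop D)" by (rule bcl_diagop[OF in_B_bcl[OF D]])
  show "diagop D (proj (amplification H) x) = diagop D x" for x
    by (simp add: proj_amplification H diagop_diagop in_B_bcl[OF D] bcl_proj in_B_proj_right[OF D H])
  show "diagop D x \<in> amplification H" for x
    by (simp add: amplification_def H diagop_diagop in_B_bcl[OF D] bcl_proj in_B_proj_left[OF D H])
qed

text \<open>The quadratic form of the amplified matrix at \<open>h\<close> is the sum over
  \<open>i\<close> of the forms of \<open>E\<close> at the \<open>i\<close>-th coordinates of
  \<open>h\<close>.\<close>

lemma stochastic_diagop:
  assumes H: "closed_csubspace H" and E: "stochastic_op_matrix H E"
  shows "stochastic_op_matrix (amplification H) (\<lambda>x x' a a'. diagop (E x x' a a'))"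
proof -
  have B: "in_B H H (E x x' a a')" for x x' a a' using E by (simp add: stochastic_op_matrix_iff H)
  have pos: "positive_matrix (pair_matrix E)" using E by (simp add: stochastic_op_matrix_iff H)
  have "positive_matrix (pair_matrix (\<lambda>x x' a a'. diagop (E x x' a a')))"
    unfolding positive_matrix_def
  proof
    fix h :: "'a \<times> 'b \<Rightarrow> 'u"
    have "(\<Sum>p\<in>UNIV. \<Sum>q\<in>UNIV. cinner (pair_matrix (\<lambda>x x' a a'. diagop (E x x' a a')) p q (h q)) (h p))
       = (\<Sum>p\<in>UNIV. \<Sum>q\<in>UNIV. \<Sum>i\<in>UNIV. cinner (pair_matrix E p q (adj (J i) (h q))) (adj (J i) (h p)))"
      by (simp add: pair_matrix_def cinner_diagop)
    also have "\<dots> = (\<Sum>i\<in>UNIV. \<Sum>p\<in>UNIV. \<Sum>q\<in>UNIV. cinner (pair_matrix E p q (adj (J i) (h q))) (adj (J i) (h p)))"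
      by (subst (2) sum.swap, subst sum.swap) simp
    finally show "Im (\<Sum>p\<in>UNIV. \<Sum>q\<in>UNIV. cinner (pair_matrix (\<lambda>x x' a a'. diagop (E x x' a a')) p q (h q)) (h p)) = 0
       \<and> 0 \<le> Re (\<Sum>p\<in>UNIV. \<Sum>q\<in>UNIV. cinner (pair_matrix (\<lambda>x x' a a'. diagop (E x x' a a')) p q (h q)) (h p))"
      using pos[unfolded positive_matrix_def, rule_format, of "\<lambda>p. adj (J i) (h p)" for i]
      by (simp only: Im_sum Re_sum) (auto intro: sum_nonneg sum.neutral)
  qed
  moreover have "(\<Sum>a\<in>UNIV. diagop (E x x' a a) v) = (if x = x' then proj (amplification H) v else 0)" for x x' v
  proof -
    have "(\<Sum>a\<in>UNIV. diagop (E x x' a a) v) = diagop (\<lambda>v. \<Sum>a\<in>UNIV. E x x' a a v) v"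
      unfolding diagop_def by (subst sum.swap) (simp add: bcl_sum[OF bcl_J])
    also have "\<dots> = (if x = x' then diagop (proj H) v else 0)"
      using E by (simp add: stochastic_op_matrix_iff H diagop_def bcl_zero[OF bcl_J])
    finally show ?thesis by (simp add: proj_amplification H)
  qed
  ultimately show ?thesis
    by (simp add: stochastic_op_matrix_iff closed_csubspace_amplification H in_B_diagop B)
qed

end

text \<open>\<open>U\<close> consists of the columns of a square root of the block operator of
  \<open>E\<close>; the stochastic condition on \<open>E\<close> becomes the isometry condition on
  \<open>U\<close>.\<close>

lemma stochastic_factorization:
  assumes "infinite_dimensional TYPE('u::chilbert_space)"
    and K: "closed_csubspace K"
    and E: "stochastic_op_matrix K (E :: 'x::finite \<Rightarrow> 'x \<Rightarrow> 'a::finite \<Rightarrow> 'a \<Rightarrow> 'u::chilbert_space \<Rightarrow> 'u)"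
  obtains U :: "'a::finite \<Rightarrow> 'x::finite \<Rightarrow> 'u::chilbert_space \<Rightarrow> 'u" where "block_isometry K UNIV U"
    "\<And>a x a' x' v. adj (U a x) (U a' x' v) = E x x' a a' v"
proof -
  obtain J :: "'x \<times> 'a \<Rightarrow> 'u \<Rightarrow> 'u" where "isometry_family J"
    using infinite_dimensional_isometry_family[OF assms(1)] by blast
  then interpret isometry_family J .
  let ?T = "pair_matrix E"
  have T: "in_B K K (?T p q)" for p q using E by (simp add: stochastic_op_matrix_iff K pair_matrix_def)
  have "positive_op (blockop ?T)"
    using E by (intro positive_op_blockop) (simp add: stochastic_op_matrix_iff K)
  with bcl_blockop[of ?T, OF in_B_bcl[OF T]] obtain R where
    R: "bounded_clinear R" "\<And>x y. cinner (R x) y = cinner x (R y)" "\<And>x. R (R x) = blockop ?T x"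
    using positive_sqrt by metis
  note fac = sqrt_factorization[OF K T R]
  define U where "U a x = (\<lambda>v. R (J (x, a) (proj K v)))" for a x
  have UU: "adj (U a x) (U a' x' v) = E x x' a a' v" for a x a' x' v
    unfolding U_def fac(3) by (simp add: pair_matrix_def)
  have "block_isometry K UNIV U"
  proof (rule block_isometryI[OF K])
    show "in_B K UNIV (U a x)" for a x
      unfolding U_def by (rule in_BI[OF K]) (simp_all add: fac(1) proj_id K proj_in)
    show "(\<Sum>a\<in>UNIV. adj (U a x) (U a x' v)) = (if x = x' then proj K v else 0)" for x x' v
      using E by (simp add: UU stochastic_op_matrix_iff K)
  qed
  then show ?thesis using that UU by blast
qed

lemma Q_qc_subset_QC_R_qc:
  assumes inf: "infinite_dimensional TYPE('u::chilbert_space)"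
    and H: "closed_csubspace H" and \<xi>: "\<xi> \<in> H" "norm (\<xi>::'u::chilbert_space) = 1"
    and E: "stochastic_op_matrix H (E :: 'x::finite \<Rightarrow> 'x \<Rightarrow> 'a::finite \<Rightarrow> 'a \<Rightarrow> 'u::chilbert_space \<Rightarrow> 'u)"
    and F: "stochastic_op_matrix H (F :: 'y::finite \<Rightarrow> 'y \<Rightarrow> 'b::finite \<Rightarrow> 'b \<Rightarrow> 'u::chilbert_space \<Rightarrow> 'u)"
    and comm: "\<And>x x' a a' y y' b b'. E x x' a a' \<circ> F y y' b b' = F y y' b b' \<circ> E x x' a a'"
  shows "Gamma_Q E F \<xi> \<in> QC_R_qc TYPE('u::chilbert_space)"
proof -
  obtain J :: "'y \<times> 'b \<Rightarrow> 'u \<Rightarrow> 'u" where "isometry_family J"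
    using infinite_dimensional_isometry_family[OF inf] by blast
  then interpret isometry_family J .
  let ?T = "pair_matrix F"
  have E_B: "in_B H H (E x x' a a')" for x x' a a' using E by (simp add: stochastic_op_matrix_iff H)
  have T: "in_B H H (?T p q)" for p q using F by (simp add: stochastic_op_matrix_iff H pair_matrix_def)
  have pos: "positive_op (blockop ?T)"
    using F by (intro positive_op_blockop) (simp add: stochastic_op_matrix_iff H)
  obtain R where
    R: "bounded_clinear R" "\<And>x y. cinner (R x) y = cinner x (R y)" "\<And>x. R (R x) = blockop ?T x"
    and R_comm: "\<And>B x. bounded_clinear B \<Longrightarrow> (\<And>x. B (blockop ?T x) = blockop ?T (B x)) \<Longrightarrow> B (R x) = R (B x)"
    using positive_sqrt[OF bcl_blockop[of ?T, OF in_B_bcl[OF T]] pos] by blast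
  note fac = sqrt_factorization[OF H T R]
  have ER: "diagop (E x x' a a') (R v) = R (diagop (E x x' a a') v)" for x x' a a' v
  proof (rule R_comm)
    show "bounded_clinear (diagop (E x x' a a'))" by (rule bcl_diagop[OF in_B_bcl[OF E_B]])
    show "diagop (E x x' a a') (blockop ?T v) = blockop ?T (diagop (E x x' a a') v)" for v
      by (rule blockop_diagop_commute[OF in_B_bcl[OF T] in_B_bcl[OF E_B]])
         (simp add: pair_matrix_def fun_cong[OF comm, unfolded comp_def])
  qed
  \<comment> \<open>Commutation with the amplified projection is what places the range of
    \<open>V\<close> in \<open>K\<close>.\<close>
  have QR: "diagop (proj H) (R v) = R (diagop (proj H) v)" for v
  proof (rule R_comm)
    show "bounded_clinear (diagop (proj H))" by (rule bcl_diagop[OF bcl_proj[OF H]])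
    show "diagop (proj H) (blockop ?T v) = blockop ?T (diagop (proj H) v)" for v
      by (rule blockop_diagop_commute[OF in_B_bcl[OF T] bcl_proj[OF H]])
         (simp add: in_B_proj_left[OF T H] in_B_proj_right[OF T H])
  qed
  define V where "V b y = (\<lambda>v. R (J (y, b) (proj H v)))" for b y
  define K where "K = amplification H"
  have K: "closed_csubspace K" unfolding K_def by (rule closed_csubspace_amplification[OF H])
  have VV: "adj (V b y) (V b' y' v) = F y y' b b' v" for b y b' y' v
    unfolding V_def fac(3) by (simp add: pair_matrix_def)
  have V_iso: "block_isometry H K V"
  proof (rule block_isometryI[OF H])
    show "in_B H K (V b y)" for b y
      unfolding V_def
    proof (rule in_BI[OF H])
      show "R (J (y, b) (proj H v)) \<in> K" for v
        by (simp add: K_def amplification_def QR diagop_J bcl_proj H proj_id proj_in)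
    qed (simp_all add: fac(1) proj_id H proj_in)
    show "(\<Sum>b\<in>UNIV. adj (V b y) (V b y' v)) = (if y = y' then proj H v else 0)" for y y' v
      using F by (simp add: VV stochastic_op_matrix_iff H)
  qed
  obtain U :: "'a \<Rightarrow> 'x \<Rightarrow> 'u \<Rightarrow> 'u" where U_iso: "block_isometry K UNIV U"
    and UU: "\<And>a x a' x' v. adj (U a x) (U a' x' v) = diagop (E x x' a a') v"
    using stochastic_factorization[OF inf K, unfolded K_def, OF stochastic_diagop[OF H E]]
    unfolding K_def[symmetric] by metis
  have bU: "bounded_clinear (U a x)" for a x by (rule in_B_bcl[OF block_isometry_in_B[OF U_iso]])
  have bV: "bounded_clinear (V b y)" for b y by (rule in_B_bcl[OF block_isometry_in_B[OF V_iso]])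
  have adj_V: "adj (V b y) = (\<lambda>w. proj H (adj (J (y, b)) (R w)))" for b y
    unfolding V_def by (rule fac(2))
  \<comment> \<open>\<open>V\<close> intertwines \<open>E\<close> with its amplification, and so
    does \<open>adj V\<close>. Hence the amplification commutes with every
    \<open>V b y \<circ> adj (V b' y')\<close>, and compressing it by \<open>V\<close> yields the
    products of \<open>E\<close> and \<open>F\<close>.\<close>
  have EV: "diagop (E x x' a a') (V b y v) = V b y (E x x' a a' v)" for x x' a a' b y v
    by (simp add: V_def ER diagop_J in_B_bcl[OF E_B] in_B_proj_left[OF E_B H] in_B_proj_right[OF E_B H])
  have EV': "adj (V b y) (diagop (E x x' a a') v) = E x x' a a' (adj (V b y) v)" for x x' a a' b y v
    by (simp add: adj_V ER[symmetric] adj_J_diagop in_B_proj_left[OF E_B H] in_B_proj_right[OF E_B H])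
  have "semi_commute U V"
    by (simp add: semi_commute_def fun_eq_iff UU EV EV')
  moreover have "Gamma_W (block_prod U V) (\<lambda>T. cinner (T \<xi>) \<xi>) = Gamma_Q E F \<xi>"
  proof (rule Gamma_W_eq_Gamma_Q)
    fix a b x y a' b' x' y'
    have "adj (\<lambda>v. U a x (V b y v)) (U a' x' (V b' y' \<xi>)) = adj (V b y) (diagop (E x x' a a') (V b' y' \<xi>))"
      by (simp add: adj_compose bU bV UU)
    also have "\<dots> = E x x' a a' (F y y' b b' \<xi>)" by (simp add: EV' VV)
    finally show "cinner ((adj (block_prod U V (a, b) (x, y)) \<circ> block_prod U V (a', b') (x', y')) \<xi>) \<xi>
        = cinner (E x x' a a' (F y y' b b' \<xi>)) \<xi>"
      by (simp add: block_prod_def comp_def)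
  qed
  ultimately show ?thesis
    unfolding QC_R_qc_def
    using H K csubspace_UNIV U_iso V_iso normal_state_vector[OF H \<xi>] by (metis (mono_tags, lifting) mem_Collect_eq)
qed

section \<open>The Gelfand--Naimark--Segal construction for finitely many operators\<close>

lemma adj_plus:
  "bounded_clinear S \<Longrightarrow> bounded_clinear T \<Longrightarrow> adj (\<lambda>v. S v + T v) = (\<lambda>v. adj S v + adj T v)"
  by (rule adj_eqI) (auto simp: bcl_plus cinner_adj_right cinner_simps)

lemma adj_cscale: "bounded_clinear T \<Longrightarrow> adj (\<lambda>v. cscale c (T v)) = (\<lambda>v. cscale (cnj c) (adj T v))"
  by (rule adj_eqI) (auto simp: bcl_cscale_fun cinner_adj_right cinner_simps)

locale positive_functional =
  fixes H :: "'u::chilbert_space set" and \<sigma> :: "('u \<Rightarrow> 'u) \<Rightarrow> complex"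
  assumes H: "closed_csubspace H"
    and add: "in_B H H S \<Longrightarrow> in_B H H T \<Longrightarrow> \<sigma> (\<lambda>v. S v + T v) = \<sigma> S + \<sigma> T"
    and scale: "in_B H H T \<Longrightarrow> \<sigma> (\<lambda>v. cscale c (T v)) = c * \<sigma> T"
    and pos: "in_B H H T \<Longrightarrow> positive_op T \<Longrightarrow> Im (\<sigma> T) = 0 \<and> 0 \<le> Re (\<sigma> T)"
begin

lemma \<sigma>_zero: "\<sigma> (\<lambda>v. 0) = 0"
  using scale[OF in_B_zero[OF H], of 0] by simp

lemma \<sigma>_sum:
  "finite I \<Longrightarrow> (\<And>i. i \<in> I \<Longrightarrow> in_B H H (T i)) \<Longrightarrow> \<sigma> (\<lambda>v. \<Sum>i\<in>I. T i v) = (\<Sum>i\<in>I. \<sigma> (T i))"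
  by (induction I rule: finite_induct) (simp_all add: \<sigma>_zero add in_B_sum H)

text \<open>The sesquilinear form of the GNS construction, with the adjoint on the second argument
  to match the convention of \<open>cinner\<close>; it may be degenerate.\<close>

definition ip :: "('u \<Rightarrow> 'u) \<Rightarrow> ('u \<Rightarrow> 'u) \<Rightarrow> complex" where
  "ip A B = \<sigma> (\<lambda>v. adj B (A v))"

lemma in_B_adj_compose: "in_B H H A \<Longrightarrow> in_B H H B \<Longrightarrow> in_B H H (\<lambda>v. adj B (A v))"
  by (rule in_B_compose[OF in_B_adj[OF _ H]])

lemma ip_sum_left:
  assumes "finite I" "\<And>i. i \<in> I \<Longrightarrow> in_B H H (A i)" "in_B H H B"
  shows "ip (\<lambda>v. \<Sum>i\<in>I. A i v) B = (\<Sum>i\<in>I. ip (A i) B)"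
  unfolding ip_def by (subst \<sigma>_sum[symmetric]) (use assms in \<open>auto simp: in_B_adj_compose bcl_sum bcl_adj in_B_bcl\<close>)

lemma ip_cscale_left: "in_B H H A \<Longrightarrow> in_B H H B \<Longrightarrow> ip (\<lambda>v. cscale c (A v)) B = c * ip A B"
  unfolding ip_def by (subst scale[symmetric]) (auto simp: in_B_adj_compose bcl_cscale bcl_adj in_B_bcl)

lemma ip_plus_left:
  "in_B H H A \<Longrightarrow> in_B H H A' \<Longrightarrow> in_B H H B \<Longrightarrow> ip (\<lambda>v. A v + A' v) B = ip A B + ip A' B"
  unfolding ip_def by (subst add[symmetric]) (auto simp: in_B_adj_compose bcl_add bcl_adj in_B_bcl)

lemma ip_plus_right:
  "in_B H H A \<Longrightarrow> in_B H H B \<Longrightarrow> in_B H H B' \<Longrightarrow> ip A (\<lambda>v. B v + B' v) = ip A B + ip A B'"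
  unfolding ip_def by (subst add[symmetric]) (auto simp: in_B_adj_compose adj_plus in_B_bcl)

lemma ip_cscale_right: "in_B H H A \<Longrightarrow> in_B H H B \<Longrightarrow> ip A (\<lambda>v. cscale c (B v)) = cnj c * ip A B"
  unfolding ip_def by (subst scale[symmetric]) (auto simp: in_B_adj_compose adj_cscale in_B_bcl)

lemma ip_self:
  assumes "in_B H H A"
  shows "Im (ip A A) = 0" "0 \<le> Re (ip A A)"
proof -
  have "positive_op (\<lambda>v. adj A (A v))"
    by (simp add: positive_op_def cinner_adj_left in_B_bcl[OF assms] cinner_self)
  then show "Im (ip A A) = 0" "0 \<le> Re (ip A A)"
    unfolding ip_def using pos[OF in_B_adj_compose[OF assms assms]] by auto
qed

text \<open>Positivity of \<open>\<sigma>\<close> speaks about the diagonal only; polarization at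
  \<open>A + B\<close> and \<open>A + \<i> B\<close> recovers the symmetry.\<close>

lemma ip_hermitian:
  assumes A: "in_B H H A" and B: "in_B H H B"
  shows "ip A B = cnj (ip B A)"
proof -
  note cB = in_B_cscale[OF H B, of \<i>]
  have "Im (ip A B) + Im (ip B A) = 0"
    using ip_self(1)[OF in_B_plus[OF H A B]] ip_self(1)[OF A] ip_self(1)[OF B]
    by (simp add: ip_plus_left ip_plus_right A B in_B_plus H)
  moreover have "Re (ip A B) = Re (ip B A)"
    using ip_self(1)[OF in_B_plus[OF H A cB]] ip_self(1)[OF A] ip_self(1)[OF B]
    by (simp add: ip_plus_left ip_plus_right ip_cscale_left ip_cscale_right A B cB in_B_plus H)
  ultimately show ?thesis by (simp add: complex_eq_iff)
qed

lemma ip_lincomb: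
  assumes A: "\<And>i. i \<in> I \<Longrightarrow> in_B H H (A i)" "finite I" and B: "\<And>j. j \<in> I' \<Longrightarrow> in_B H H (B j)" "finite I'"
  shows "ip (\<lambda>v. \<Sum>i\<in>I. cscale (c i) (A i v)) (\<lambda>v. \<Sum>j\<in>I'. cscale (d j) (B j v))
    = (\<Sum>i\<in>I. \<Sum>j\<in>I'. c i * cnj (d j) * ip (A i) (B j))"
proof -
  let ?B = "\<lambda>v. \<Sum>j\<in>I'. cscale (d j) (B j v)"
  have BB: "in_B H H ?B" by (intro in_B_sum in_B_cscale H B)
  have "ip (\<lambda>v. \<Sum>i\<in>I. cscale (c i) (A i v)) ?B = (\<Sum>i\<in>I. c i * ip (A i) ?B)"
    using A BB by (simp add: ip_sum_left in_B_cscale H ip_cscale_left)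
  also have "ip (A i) ?B = (\<Sum>j\<in>I'. cnj (d j) * ip (A i) (B j))" if i: "i \<in> I" for i
  proof -
    have "ip (A i) ?B = cnj (ip ?B (A i))" by (rule ip_hermitian[OF A(1)[OF i] BB])
    also have "\<dots> = (\<Sum>j\<in>I'. cnj (d j) * cnj (ip (B j) (A i)))"
      using A(1)[OF i] B by (simp add: ip_sum_left in_B_cscale H ip_cscale_left)
    also have "\<dots> = (\<Sum>j\<in>I'. cnj (d j) * ip (A i) (B j))"
      by (rule sum.cong[OF refl]) (simp add: ip_hermitian[OF A(1)[OF i] B(1)])
    finally show ?thesis .
  qed
  then have "(\<Sum>i\<in>I. c i * ip (A i) ?B) = (\<Sum>i\<in>I. \<Sum>j\<in>I'. c i * cnj (d j) * ip (A i) (B j))"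
    by (intro sum.cong) (simp_all add: sum_distrib_left mult.assoc)
  finally show ?thesis .
qed

text \<open>Left multiplication by \<open>g\<close> is bounded for the GNS seminorm:
  \<open>C^2\<close> times \<open>adj A A\<close> dominates \<open>adj (g A) (g A)\<close>, and
  \<open>\<sigma>\<close> is monotone.\<close>

lemma ip_compose_le:
  assumes A: "in_B H H A" and g: "in_B H H g" and C: "\<And>x. norm (g x) \<le> C * norm x"
  shows "Re (ip (\<lambda>v. g (A v)) (\<lambda>v. g (A v))) \<le> C\<^sup>2 * Re (ip A A)"
proof -
  have gA: "in_B H H (\<lambda>v. g (A v))" by (rule in_B_compose[OF g A])
  let ?X = "\<lambda>v. adj A (A v)" and ?Y = "\<lambda>v. adj (\<lambda>v. g (A v)) (g (A v))"
  let ?P = "\<lambda>v. cscale (of_real (C\<^sup>2)) (?X v) + cscale (-1) (?Y v)"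
  have X: "in_B H H ?X" by (rule in_B_adj_compose[OF A A])
  have Y: "in_B H H ?Y" by (rule in_B_adj_compose[OF gA gA])
  have P: "in_B H H ?P" by (intro in_B_plus in_B_cscale X Y H)
  have "positive_op ?P"
    unfolding positive_op_def
  proof
    fix v
    have "(norm (g (A v)))\<^sup>2 \<le> (C * norm (A v))\<^sup>2" by (intro power_mono C) simp
    moreover have "cinner (?P v) v = of_real (C\<^sup>2 * (norm (A v))\<^sup>2 - (norm (g (A v)))\<^sup>2)"
      by (simp add: cinner_simps cinner_adj_left in_B_bcl[OF A] in_B_bcl[OF gA] cinner_self)
    ultimately show "Im (cinner (?P v) v) = 0 \<and> 0 \<le> Re (cinner (?P v) v)"
      by (simp add: power_mult_distrib)
  qed
  from pos[OF P this] have "0 \<le> Re (\<sigma> ?P)" by blast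
  also have "\<sigma> ?P = of_real (C\<^sup>2) * ip A A - ip (\<lambda>v. g (A v)) (\<lambda>v. g (A v))"
    by (simp add: add in_B_cscale H X Y scale ip_def del: of_real_power)
  finally show ?thesis by simp
qed

end

locale gns = positive_functional H \<sigma>
  for H :: "'u::chilbert_space set" and \<sigma> +
  fixes g :: "'g::finite \<Rightarrow> 'u \<Rightarrow> 'u"
  assumes g: "in_B H H (g s)"
    and inf_dim: "infinite_dimensional TYPE('u)"
begin

text \<open>The empty word is the unit of B(H), in this encoding \<open>proj H\<close>; its Gram
  vector becomes the cyclic vector.\<close>

primrec word_op :: "'g list \<Rightarrow> 'u \<Rightarrow> 'u" where
  "word_op [] = proj H"
| "word_op (s # w) = (\<lambda>v. g s (word_op w v))"

lemma word_op_in_B: "in_B H H (word_op w)"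
  by (induction w) (simp_all add: in_B_proj H in_B_compose[OF g])

text \<open>Words over a finite alphabet are countable, and the kernel is positive because its
  quadratic form is \<open>ip\<close> of a combination of words with itself.\<close>

lemma gram_vectors_exist: "\<exists>\<phi> :: 'g list \<Rightarrow> 'u. \<forall>w w'. cinner (\<phi> w) (\<phi> w') = ip (word_op w) (word_op w')"
proof -
  define A where "A n = word_op (from_nat n)" for n :: nat
  have A: "in_B H H (A n)" for n unfolding A_def by (rule word_op_in_B)
  have "psd_kernel (\<lambda>m n. ip (A m) (A n))"
    unfolding psd_kernel_def
  proof (intro conjI allI impI)
    show "ip (A i) (A j) = cnj (ip (A j) (A i))" for i j by (rule ip_hermitian[OF A A])
    show "0 \<le> Re (\<Sum>i\<in>F. \<Sum>j\<in>F. c i * cnj (c j) * ip (A i) (A j))" if "finite F" for F c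
      using ip_self(2)[of "\<lambda>v. \<Sum>i\<in>F. cscale (c i) (A i v)"] that
      by (simp add: ip_lincomb A in_B_sum in_B_cscale H)
  qed
  then obtain \<phi> :: "nat \<Rightarrow> 'u" where "\<And>i j. cinner (\<phi> i) (\<phi> j) = ip (A i) (A j)"
    using psd_kernel_realization[OF _ inf_dim] by blast
  then show ?thesis by (intro exI[of _ "\<lambda>w. \<phi> (to_nat w)"]) (simp add: A_def)
qed

definition gram :: "'g list \<Rightarrow> 'u" where
  "gram = (SOME \<phi>. \<forall>w w'. cinner (\<phi> w) (\<phi> w') = ip (word_op w) (word_op w'))"

lemma cinner_gram: "cinner (gram w) (gram w') = ip (word_op w) (word_op w')"
  using someI_ex[OF gram_vectors_exist] unfolding gram_def by blast

text \<open>Says that \<open>x\<close> is the GNS class of \<open>A\<close>. It is a relation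
  because an operator can be a combination of words in several ways; by
  \<open>represents_unique\<close> the class is determined nevertheless.\<close>

definition represents :: "'u \<Rightarrow> ('u \<Rightarrow> 'u) \<Rightarrow> bool" where
  "represents x A \<longleftrightarrow> (\<exists>F c. finite F \<and> x = (\<Sum>w\<in>F. cscale (c w) (gram w)) \<and>
     A = (\<lambda>v. \<Sum>w\<in>F. cscale (c w) (word_op w v)))"

lemma represents_in_B: "represents x A \<Longrightarrow> in_B H H A"
  by (auto simp: represents_def intro!: in_B_sum in_B_cscale H word_op_in_B)

lemma represents_cinner:
  assumes "represents x A" "represents y B"
  shows "cinner x y = ip A B"
proof -
  obtain F c where x: "finite F" "x = (\<Sum>w\<in>F. cscale (c w) (gram w))"
    "A = (\<lambda>v. \<Sum>w\<in>F. cscale (c w) (word_op w v))" using assms(1) by (auto simp: represents_def)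
  obtain F' d where y: "finite F'" "y = (\<Sum>w\<in>F'. cscale (d w) (gram w))"
    "B = (\<lambda>v. \<Sum>w\<in>F'. cscale (d w) (word_op w v))" using assms(2) by (auto simp: represents_def)
  have "cinner x y = (\<Sum>w\<in>F. \<Sum>u\<in>F'. c w * cnj (d u) * ip (word_op w) (word_op u))"
    unfolding x(2) y(2) by (subst sum.swap) (simp add: cinner_simps cinner_gram sum_distrib_left mult_ac)
  then show ?thesis unfolding x(3) y(3) by (simp add: ip_lincomb word_op_in_B x(1) y(1))
qed

lemma represents_zero: "represents 0 (\<lambda>v. 0)"
  unfolding represents_def by (intro exI[of _ "{}"]) simp

lemma represents_shift:
  assumes "finite F"
  shows "represents (\<Sum>w\<in>F. cscale (c w) (gram (s # w))) (\<lambda>v. g s (\<Sum>w\<in>F. cscale (c w) (word_op w v)))"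
  unfolding represents_def
proof (intro exI conjI)
  show "finite ((#) s ` F)" using assms by simp
  show "(\<Sum>w\<in>F. cscale (c w) (gram (s # w))) = (\<Sum>w\<in>(#) s ` F. cscale (c (tl w)) (gram w))"
    by (subst sum.reindex) simp_all
  show "(\<lambda>v. g s (\<Sum>w\<in>F. cscale (c w) (word_op w v))) = (\<lambda>v. \<Sum>w\<in>(#) s ` F. cscale (c (tl w)) (word_op w v))"
    by (subst sum.reindex) (simp_all add: bcl_simps in_B_bcl[OF g])
qed

text \<open>The difference of the two sides is orthogonal to every represented vector and is itself
  a combination of such vectors. In this way linear relations between operators pass to GNS
  vectors.\<close>

lemma represents_sum_eq:
  assumes "finite I" and x: "\<And>i. i \<in> I \<Longrightarrow> represents (x i) (A i)" and y: "represents y (\<lambda>v. \<Sum>i\<in>I. A i v)"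
  shows "(\<Sum>i\<in>I. x i) = y"
proof -
  have 0: "cinner ((\<Sum>i\<in>I. x i) - y) z = 0" if z: "represents z C" for z C
  proof -
    have "(\<Sum>i\<in>I. cinner (x i) z) = (\<Sum>i\<in>I. ip (A i) C)"
      by (intro sum.cong refl represents_cinner x z)
    also have "\<dots> = ip (\<lambda>v. \<Sum>i\<in>I. A i v) C"
      by (rule ip_sum_left[symmetric]) (use assms(1) x z represents_in_B in auto)
    finally show ?thesis
      by (simp add: cinner_diff_left cinner_sum_left represents_cinner[OF y z])
  qed
  have "cinner ((\<Sum>i\<in>I. x i) - y) ((\<Sum>i\<in>I. x i) - y) = 0"
    unfolding cinner_diff_right[of "(\<Sum>i\<in>I. x i) - y"] cinner_sum_right 0[OF y]
    by (simp add: 0[OF x])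
  then show ?thesis by (simp add: cinner_self_eq_zero)
qed

lemma represents_unique: "represents x A \<Longrightarrow> represents y A \<Longrightarrow> x = y"
  using represents_sum_eq[of "{()}" "\<lambda>_. x" "\<lambda>_. A" y] by simp

definition gns_space :: "'u set" where
  "gns_space = closure (cspan gram UNIV)"

lemma closed_csubspace_gns: "closed_csubspace gns_space"
  unfolding gns_space_def by (rule closed_csubspace_cspan)

text \<open>By \<open>ip_compose_le\<close>, prefixing a letter is bounded on combinations of Gram
  vectors, so it extends by \<open>cspan_extension\<close>; prefixed words are words, which keeps
  the range in \<open>gns_space\<close>.\<close>

lemma gns_operator_exists: "\<exists>T. in_B gns_space gns_space T \<and> (\<forall>w. T (gram w) = gram (s # w))"
proof -
  obtain C where C: "C > 0" "\<And>x. norm (g s x) \<le> C * norm x" using bcl_bound[OF in_B_bcl[OF g[of s]]] by blast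
  have "norm (\<Sum>w\<in>F. cscale (c w) (gram (s # w))) \<le> C * norm (\<Sum>w\<in>F. cscale (c w) (gram w))"
    if F: "finite F" for F c
  proof (rule power2_le_imp_le)
    let ?A = "\<lambda>v. \<Sum>w\<in>F. cscale (c w) (word_op w v)"
    have r: "represents (\<Sum>w\<in>F. cscale (c w) (gram w)) ?A" using F by (auto simp: represents_def)
    show "(norm (\<Sum>w\<in>F. cscale (c w) (gram (s # w))))\<^sup>2 \<le> (C * norm (\<Sum>w\<in>F. cscale (c w) (gram w)))\<^sup>2"
      using ip_compose_le[OF represents_in_B[OF r] g C(2)]
      unfolding power_mult_distrib norm_sq_cinner represents_cinner[OF r r]
        represents_cinner[OF represents_shift[OF F] represents_shift[OF F]] .
    show "0 \<le> C * norm (\<Sum>w\<in>F. cscale (c w) (gram w))" using C(1) by simp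
  qed
  then obtain T where T: "in_B (closure (cspan gram UNIV)) (closure (cspan (\<lambda>w. gram (s # w)) UNIV)) T"
    "\<And>w. T (gram w) = gram (s # w)"
    using cspan_extension[of UNIV "\<lambda>w. gram (s # w)" C gram] C(1) by auto
  have "cspan (\<lambda>w. gram (s # w)) UNIV \<subseteq> cspan gram UNIV"
  proof
    fix x assume "x \<in> cspan (\<lambda>w. gram (s # w)) UNIV"
    then obtain F c where "finite F" "x = (\<Sum>w\<in>F. cscale (c w) (gram (s # w)))" by (auto simp: cspan_def)
    then have "represents x (\<lambda>v. g s (\<Sum>w\<in>F. cscale (c w) (word_op w v)))" using represents_shift by simp
    then show "x \<in> cspan gram UNIV" by (auto simp: represents_def cspan_def)
  qed
  then have "in_B gns_space gns_space T"
    using T(1) closure_mono unfolding gns_space_def in_B_def by blast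
  then show ?thesis using T(2) by blast
qed

definition gns_op :: "'g \<Rightarrow> 'u \<Rightarrow> 'u" where
  "gns_op s = (SOME T. in_B gns_space gns_space T \<and> (\<forall>w. T (gram w) = gram (s # w)))"

lemma gns_op_in_B: "in_B gns_space gns_space (gns_op s)"
  and gns_op_gram: "gns_op s (gram w) = gram (s # w)"
  using someI_ex[OF gns_operator_exists[of s]] unfolding gns_op_def by blast+

lemma represents_gns_op:
  assumes "represents x A"
  shows "represents (gns_op s x) (\<lambda>v. g s (A v))"
proof -
  obtain F c where x: "finite F" "x = (\<Sum>w\<in>F. cscale (c w) (gram w))"
    "A = (\<lambda>v. \<Sum>w\<in>F. cscale (c w) (word_op w v))" using assms by (auto simp: represents_def)
  show ?thesis
    using represents_shift[OF x(1), of c s] unfolding x(2,3) by (simp add: bcl_simps in_B_bcl[OF gns_op_in_B] gns_op_gram)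
qed

lemma represents_dense:
  assumes "x \<in> gns_space"
  obtains f A where "\<And>n. represents (f n) (A n)" "f \<longlonglongrightarrow> x"
proof -
  obtain f where f: "\<And>n. f n \<in> cspan gram UNIV" "f \<longlonglongrightarrow> x"
    using assms unfolding gns_space_def closure_sequential by blast
  then have "\<forall>n. \<exists>A. represents (f n) A" unfolding cspan_def represents_def by blast
  then show ?thesis using that f(2) by metis
qed

text \<open>Represented vectors are dense in \<open>gns_space\<close>, and both operators vanish on
  its orthogonal complement.\<close>

lemma gns_operator_eqI:
  assumes S: "in_B gns_space gns_space S" and T: "in_B gns_space gns_space T"
    and eq: "\<And>x A. represents x A \<Longrightarrow> S x = T x"
  shows "S v = T v"
proof -
  have "proj gns_space v \<in> gns_space" by (rule proj_in[OF closed_csubspace_gns])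
  then obtain f A where f: "\<And>n. represents (f n) (A n)" "f \<longlonglongrightarrow> proj gns_space v"
    using represents_dense by blast
  have "S (proj gns_space v) = T (proj gns_space v)"
    using LIMSEQ_unique[OF bcl_tendsto[OF in_B_bcl[OF S] f(2)]] bcl_tendsto[OF in_B_bcl[OF T] f(2)] eq[OF f(1)]
    by simp
  then show ?thesis
    by (simp add: in_B_proj_right[OF S closed_csubspace_gns] in_B_proj_right[OF T closed_csubspace_gns])
qed

lemma gns_op_commute:
  assumes "\<And>v. g s (g t v) = g t (g s v)"
  shows "gns_op s (gns_op t v) = gns_op t (gns_op s v)"
proof (rule gns_operator_eqI[of "\<lambda>v. gns_op s (gns_op t v)" "\<lambda>v. gns_op t (gns_op s v)"])
  fix x A assume r: "represents x A"
  show "gns_op s (gns_op t x) = gns_op t (gns_op s x)"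
    using represents_gns_op[OF represents_gns_op[OF r], of s t] represents_gns_op[OF represents_gns_op[OF r], of t s]
    by (intro represents_unique[of _ "\<lambda>v. g s (g t (A v))"]) (simp_all add: assms)
qed (intro in_B_compose[OF gns_op_in_B gns_op_in_B])+

text \<open>At represented vectors the quadratic form is \<open>\<sigma>\<close> of a sum of
  operators \<open>adj (A p) (g (e p q)) (A q)\<close>, which is positive because the matrix of the
  \<open>g (e p q)\<close> is; density gives the remaining vectors. The row sums transfer by
  \<open>represents_sum_eq\<close>.\<close>

lemma stochastic_gns:
  fixes e :: "'x::finite \<Rightarrow> 'x \<Rightarrow> 'a::finite \<Rightarrow> 'a \<Rightarrow> 'g"
  assumes E: "stochastic_op_matrix H (\<lambda>x x' a a'. g (e x x' a a'))"
  shows "stochastic_op_matrix gns_space (\<lambda>x x' a a'. gns_op (e x x' a a'))"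
proof -
  have Epos: "positive_matrix (pair_matrix (\<lambda>x x' a a'. g (e x x' a a')))"
    and Esum: "\<And>x x' v. (\<Sum>a\<in>UNIV. g (e x x' a a) v) = (if x = x' then proj H v else 0)"
    using E by (simp_all add: stochastic_op_matrix_iff H)
  let ?e = "pair_matrix e"
  let ?s = "\<lambda>h. \<Sum>p\<in>UNIV. \<Sum>q\<in>UNIV. cinner (gns_op (?e p q) (h q)) (h p)"
  have dense: "Im (?s h) = 0 \<and> 0 \<le> Re (?s h)" if h: "\<And>p. represents (h p) (A p)" for h A
  proof -
    let ?T = "\<lambda>v. \<Sum>p\<in>UNIV. \<Sum>q\<in>UNIV. adj (A p) (g (?e p q) (A q v))"
    have A: "in_B H H (A p)" for p by (rule represents_in_B[OF h])
    have gA: "in_B H H (\<lambda>v. g (?e p q) (A q v))" for p q by (rule in_B_compose[OF g A])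
    have "?s h = (\<Sum>p\<in>UNIV. \<Sum>q\<in>UNIV. ip (\<lambda>v. g (?e p q) (A q v)) (A p))"
      by (intro sum.cong refl represents_cinner represents_gns_op h)
    also have "\<dots> = \<sigma> ?T"
      by (simp add: ip_def \<sigma>_sum in_B_sum H in_B_adj_compose gA A)
    finally have eq: "?s h = \<sigma> ?T" .
    have "positive_op ?T"
      unfolding positive_op_def
      using Epos[unfolded positive_matrix_def, rule_format, of "\<lambda>p. A p v" for v]
      by (simp add: cinner_sum_left cinner_adj_left in_B_bcl[OF A] pair_matrix_def)
    then show ?thesis unfolding eq by (intro pos in_B_sum H in_B_adj_compose gA A)
  qed
  have "positive_matrix (pair_matrix (\<lambda>x x' a a'. gns_op (e x x' a a')))"
  proof (rule positive_matrixI[OF closed_csubspace_gns])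
    show "in_B gns_space gns_space (pair_matrix (\<lambda>x x' a a'. gns_op (e x x' a a')) p q)" for p q
      by (simp add: pair_matrix_def gns_op_in_B)
    fix h :: "'x \<times> 'a \<Rightarrow> 'u" assume h: "\<And>p. h p \<in> gns_space"
    have "\<forall>p. \<exists>f A. (\<forall>n. represents (f n) (A n)) \<and> f \<longlonglongrightarrow> h p"
      using represents_dense[OF h] by metis
    then obtain f A where f: "\<And>p n. represents (f p n) (A p n)" "\<And>p. f p \<longlonglongrightarrow> h p" by metis
    have lim: "(\<lambda>n. ?s (\<lambda>p. f p n)) \<longlonglongrightarrow> ?s h"
      by (intro tendsto_sum tendsto_cinner bcl_tendsto[OF in_B_bcl[OF gns_op_in_B]] f(2))
    have 1: "Im (?s (\<lambda>p. f p n)) = 0" and 2: "0 \<le> Re (?s (\<lambda>p. f p n))" for n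
      using dense[of "\<lambda>p. f p n" "\<lambda>p. A p n", OF f(1)] by blast+
    have "Im (?s h) = 0"
      using LIMSEQ_unique[OF tendsto_Im[OF lim], of 0] unfolding 1 by simp
    moreover have "0 \<le> Re (?s h)"
      by (rule LIMSEQ_le_const[OF tendsto_Re[OF lim]]) (use 2 in blast)
    ultimately show "Im (\<Sum>p\<in>UNIV. \<Sum>q\<in>UNIV. cinner (pair_matrix (\<lambda>x x' a a'. gns_op (e x x' a a')) p q (h q)) (h p)) = 0
      \<and> 0 \<le> Re (\<Sum>p\<in>UNIV. \<Sum>q\<in>UNIV. cinner (pair_matrix (\<lambda>x x' a a'. gns_op (e x x' a a')) p q (h q)) (h p))"
      by (simp add: pair_matrix_def)
  qed
  moreover have "(\<Sum>a\<in>UNIV. gns_op (e x x' a a) v) = (if x = x' then proj gns_space v else 0)" for x x' v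
  proof (rule gns_operator_eqI[of "\<lambda>v. \<Sum>a\<in>UNIV. gns_op (e x x' a a) v"
        "\<lambda>v. if x = x' then proj gns_space v else 0"])
    show "in_B gns_space gns_space (\<lambda>v. \<Sum>a\<in>UNIV. gns_op (e x x' a a) v)"
      by (intro in_B_sum closed_csubspace_gns gns_op_in_B)
    show "in_B gns_space gns_space (\<lambda>v. if x = x' then proj gns_space v else 0)"
      by (cases "x = x'") (simp_all add: in_B_proj in_B_zero closed_csubspace_gns)
    fix z A assume r: "represents z A"
    have "z \<in> cspan gram UNIV" using r by (auto simp: represents_def cspan_def)
    then have z: "z \<in> gns_space" unfolding gns_space_def using closure_subset by blast
    have "represents (if x = x' then z else 0) (\<lambda>v. \<Sum>a\<in>UNIV. g (e x x' a a) (A v))"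
      using r by (simp add: Esum in_B_proj_left[OF represents_in_B[OF r] H] represents_zero)
    from represents_sum_eq[OF finite represents_gns_op[OF r] this]
    show "(\<Sum>a\<in>UNIV. gns_op (e x x' a a) z) = (if x = x' then proj gns_space z else 0)"
      by (simp add: proj_id closed_csubspace_gns z)
  qed
  ultimately show ?thesis
    by (simp add: stochastic_op_matrix_iff closed_csubspace_gns gns_op_in_B)
qed

lemma gram_Nil_in: "gram [] \<in> gns_space"
  unfolding gns_space_def using cspan_base[of "[]" UNIV gram] closure_subset by blast

lemma norm_gram_Nil: "\<sigma> (proj H) = 1 \<Longrightarrow> norm (gram []) = 1"
  by (simp add: norm_eq_sqrt_cinner cinner_gram ip_def adj_proj H proj_id proj_in)

lemma cinner_gns_op:
  "cinner (gns_op s (gns_op t (gram []))) (gram []) = \<sigma> (\<lambda>v. g s (g t v))"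
  by (simp add: gns_op_gram cinner_gram ip_def adj_proj H in_B_proj_left[OF g H] in_B_proj_right[OF g H])

end

section \<open>The inclusion of \<open>QC_R_qc\<close> in \<open>Q_qc\<close>\<close>

lemma Q_qc_gns:
  assumes inf: "infinite_dimensional TYPE('u::chilbert_space)"
    and H: "closed_csubspace (H :: 'u::chilbert_space set)" and \<sigma>: "normal_state H \<sigma>"
    and E: "stochastic_op_matrix H (E :: 'x::finite \<Rightarrow> 'x \<Rightarrow> 'a::finite \<Rightarrow> 'a \<Rightarrow> 'u \<Rightarrow> 'u)"
    and F: "stochastic_op_matrix H (F :: 'y::finite \<Rightarrow> 'y \<Rightarrow> 'b::finite \<Rightarrow> 'b \<Rightarrow> 'u \<Rightarrow> 'u)"
    and comm: "\<And>x x' a a' y y' b b' v. E x x' a a' (F y y' b b' v) = F y y' b b' (E x x' a a' v)"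
    and W: "\<And>a b x y a' b' x' y'. \<sigma> (adj (W (a, b) (x, y)) \<circ> W (a', b') (x', y'))
      = \<sigma> (\<lambda>v. E x x' a a' (F y y' b b' v))"
  shows "Gamma_W W \<sigma> \<in> Q_qc TYPE('u)"
proof -
  \<comment> \<open>A single family over a sum type, so that both matrices act on the same GNS
    space.\<close>
  define g :: "('x \<times> 'x \<times> 'a \<times> 'a) + ('y \<times> 'y \<times> 'b \<times> 'b) \<Rightarrow> 'u \<Rightarrow> 'u" where
    "g s = (case s of Inl (x, x', a, a') \<Rightarrow> E x x' a a' | Inr (y, y', b, b') \<Rightarrow> F y y' b b')" for s
  interpret gns H \<sigma> g
  proof
    show "in_B H H (g s)" for s
      using E F by (auto simp: g_def stochastic_op_matrix_iff H split: sum.split)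
  qed (use \<sigma> H inf in \<open>auto simp: normal_state_def\<close>)
  let ?E = "\<lambda>x x' a a'. gns_op (Inl (x, x', a, a'))" and ?F = "\<lambda>y y' b b'. gns_op (Inr (y, y', b, b'))"
  have "stochastic_op_matrix gns_space ?E" "stochastic_op_matrix gns_space ?F"
    by (rule stochastic_gns; simp add: g_def E F)+
  moreover have "?E x x' a a' \<circ> ?F y y' b b' = ?F y y' b b' \<circ> ?E x x' a a'" for x x' a a' y y' b b'
    using gns_op_commute[of "Inl (x, x', a, a')" "Inr (y, y', b, b')"] by (simp add: fun_eq_iff g_def comm)
  moreover have "Gamma_W W \<sigma> = Gamma_Q ?E ?F (gram [])"
    by (rule Gamma_W_eq_Gamma_Q) (simp add: W cinner_gns_op g_def)
  moreover have "\<sigma> (proj H) = 1" using \<sigma> by (simp add: normal_state_def)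
  ultimately show ?thesis
    unfolding Q_qc_def using closed_csubspace_gns gram_Nil_in norm_gram_Nil
    by (intro CollectI exI[of _ gns_space] exI[of _ "gram []"] exI[of _ ?E] exI[of _ ?F]) blast
qed

lemma QC_R_qc_subset_Q_qc:
  fixes U :: "'a::finite \<Rightarrow> 'x::finite \<Rightarrow> 'u::chilbert_space \<Rightarrow> 'u"
    and V :: "'b::finite \<Rightarrow> 'y::finite \<Rightarrow> 'u \<Rightarrow> 'u"
  assumes inf: "infinite_dimensional TYPE('u)"
    and H: "closed_csubspace H" and K: "closed_csubspace K" and L: "closed_csubspace L"
    and U: "block_isometry K L U" and V: "block_isometry H K V"
    and semi: "semi_commute U V" and \<sigma>: "normal_state H \<sigma>"
  shows "Gamma_W (block_prod U V) \<sigma> \<in> Q_qc TYPE('u)"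
proof -
  note UB = block_isometry_in_B[OF U] and VB = block_isometry_in_B[OF V]
  note bU = in_B_bcl[OF UB] and bV = in_B_bcl[OF VB]
  define T where "T x x' a a' v = adj (U a x) (U a' x' v)" for x x' a a' v
  have TB: "in_B K K (T x x' a a')" for x x' a a'
    using in_B_compose[OF in_B_adj[OF UB K] UB] by (simp add: T_def[abs_def])
  note bT = in_B_bcl[OF TB]
  have TV: "T x x' a a' (V b y (adj (V b' y') v)) = V b y (adj (V b' y') (T x x' a a' v))" for x x' a a' b y b' y' v
    using semi unfolding semi_commute_def T_def by (auto simp: fun_eq_iff)
  \<comment> \<open>Any column of \<open>V\<close> will do, since each of them sums to the identity
    of \<open>H\<close> in \<open>VV\<close>.\<close>
  define y0 :: 'y where "y0 = undefined"
  define E where "E x x' a a' v = (\<Sum>c\<in>UNIV. adj (V c y0) (T x x' a a' (V c y0 v)))" for x x' a a' v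
  define F where "F y y' b b' v = adj (V b y) (V b' y' v)" for y y' b b' v
  have VV: "(\<Sum>c\<in>UNIV. adj (V c y) (V c y' v)) = (if y = y' then proj H v else 0)" for y y' v
    by (rule block_isometry_sum[OF H V])
  \<comment> \<open>Semi-commutation moves \<open>T\<close> to the right past \<open>V c y0\<close>
    and \<open>adj (V b y)\<close>; the sum over \<open>c\<close> then collapses to the identity of
    \<open>H\<close>.\<close>
  have EF: "E x x' a a' (F y y' b b' v) = adj (V b y) (T x x' a a' (V b' y' v))" for x x' a a' y y' b b' v
    by (simp add: E_def F_def TV VV in_B_proj_left[OF in_B_adj[OF VB H] H])
  have FE: "F y y' b b' (E x x' a a' v) = adj (V b y) (T x x' a a' (V b' y' v))" for x x' a a' y y' b b' v
  proof -
    have "V b' y' (E x x' a a' v) = T x x' a a' (V b' y' (\<Sum>c\<in>UNIV. adj (V c y0) (V c y0 v)))"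
      by (simp add: E_def bcl_sum bV bT TV)
    then show ?thesis by (simp add: F_def VV in_B_proj_right[OF VB H])
  qed
  have F_stoch: "stochastic_op_matrix H F"
    unfolding stochastic_op_matrix_iff[OF H]
  proof (intro conjI allI)
    show "in_B H H (F y y' b b')" for y y' b b'
      using in_B_compose[OF in_B_adj[OF VB H] VB] by (simp add: F_def[abs_def])
    show "(\<Sum>b\<in>UNIV. F y y' b b v) = (if y = y' then proj H v else 0)" for y y' v by (simp add: F_def VV)
    have "(\<Sum>p\<in>UNIV. \<Sum>q\<in>UNIV. cinner (pair_matrix F p q (h q)) (h p))
      = of_real ((norm (\<Sum>p\<in>UNIV. V (snd p) (fst p) (h p)))\<^sup>2)" for h
      by (simp add: pair_matrix_def F_def cinner_adj_left bV cinner_self[symmetric] cinner_sum_left cinner_sum_right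
          del: of_real_power)
    then show "positive_matrix (pair_matrix F)" by (simp add: positive_matrix_def)
  qed
  have E_stoch: "stochastic_op_matrix H E"
    unfolding stochastic_op_matrix_iff[OF H]
  proof (intro conjI allI)
    show "in_B H H (E x x' a a')" for x x' a a'
      using in_B_sum[OF H in_B_compose[OF in_B_adj[OF VB H] in_B_compose[OF TB VB]]] by (simp add: E_def[abs_def])
    show "(\<Sum>a\<in>UNIV. E x x' a a v) = (if x = x' then proj H v else 0)" for x x' v
    proof -
      have "(\<Sum>a\<in>UNIV. T x x' a a (V c y0 v)) = (if x = x' then V c y0 v else 0)" for c
        unfolding T_def by (simp add: block_isometry_sum[OF K U] in_B_proj_left[OF VB K])
      moreover have "(\<Sum>a\<in>UNIV. E x x' a a v) = (\<Sum>c\<in>UNIV. adj (V c y0) (\<Sum>a\<in>UNIV. T x x' a a (V c y0 v)))"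
        unfolding E_def by (subst sum.swap) (simp add: bcl_sum bcl_adj bV)
      ultimately show ?thesis by (simp add: VV bcl_zero bcl_adj bV)
    qed
    \<comment> \<open>For each \<open>c\<close> the form is that of the matrix
      \<open>adj U U\<close> at the vectors \<open>V c y0 (h p)\<close>, hence a sum of
      squares.\<close>
    have "(\<Sum>p\<in>UNIV. \<Sum>q\<in>UNIV. cinner (pair_matrix E p q (h q)) (h p))
      = of_real (\<Sum>c\<in>UNIV. (norm (\<Sum>p\<in>UNIV. U (snd p) (fst p) (V c y0 (h p))))\<^sup>2)" for h
    proof -
      have "(\<Sum>p\<in>UNIV. \<Sum>q\<in>UNIV. cinner (pair_matrix E p q (h q)) (h p))
        = (\<Sum>p\<in>UNIV. \<Sum>q\<in>UNIV. \<Sum>c\<in>UNIV. cinner (U (snd q) (fst q) (V c y0 (h q))) (U (snd p) (fst p) (V c y0 (h p))))"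
        by (simp add: pair_matrix_def E_def T_def cinner_adj_left bV bU cinner_sum_left)
      also have "\<dots> = (\<Sum>c\<in>UNIV. \<Sum>p\<in>UNIV. \<Sum>q\<in>UNIV. cinner (U (snd q) (fst q) (V c y0 (h q))) (U (snd p) (fst p) (V c y0 (h p))))"
        by (subst (2) sum.swap, subst sum.swap) simp
      finally show ?thesis
        by (simp add: cinner_self[symmetric] cinner_sum_left cinner_sum_right del: of_real_power)
    qed
    then show "positive_matrix (pair_matrix E)" by (simp add: positive_matrix_def sum_nonneg)
  qed
  show ?thesis
  proof (rule Q_qc_gns[OF inf H \<sigma> E_stoch F_stoch])
    show "E x x' a a' (F y y' b b' v) = F y y' b b' (E x x' a a' v)" for x x' a a' y y' b b' v
      by (simp only: EF FE)
    show "\<sigma> (adj (block_prod U V (a, b) (x, y)) \<circ> block_prod U V (a', b') (x', y'))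
        = \<sigma> (\<lambda>v. E x x' a a' (F y y' b b' v))" for a b x y a' b' x' y'
      by (simp add: block_prod_def comp_def adj_compose bU bV EF T_def)
  qed
qed

theorem theorem5p7:
  assumes "infinite_dimensional TYPE('u::chilbert_space)"
  shows "(QC_R_qc TYPE('u) :: (('x::finite \<times> 'y::finite) mat \<Rightarrow> ('a::finite \<times> 'b::finite) mat) set)
         = Q_qc TYPE('u)"
proof
  show "(QC_R_qc TYPE('u) :: (('x \<times> 'y) mat \<Rightarrow> ('a \<times> 'b) mat) set) \<subseteq> Q_qc TYPE('u)"
    unfolding QC_R_qc_def using QC_R_qc_subset_Q_qc[OF assms] by blast
  show "Q_qc TYPE('u) \<subseteq> (QC_R_qc TYPE('u) :: (('x \<times> 'y) mat \<Rightarrow> ('a \<times> 'b) mat) set)"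
    unfolding Q_qc_def using Q_qc_subset_QC_R_qc[OF assms] by blast
qed

end
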